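(* Let $P \subset \mathbb{R}^3$ be a 3-dimensional simple integral convex polytope, and let $E_1, \ldots, E_m$ and $F_1, \ldots, F_n$ be the edges and the facets of $P$, respectively. Let $|(lP) \cap \mathbb{Z}^3| = c_3l^3+c_2l^2+c_1l+c_0$ (for all non-negative integers $l$) be the Ehrhart polynomial of $P$. Then $$c_1=\sum_{j=1}^m \left(s(E_j)+\frac{1}{4}\right)\mathrm{Vol}(E_j)+\frac{1}{12}\sum_{k=1}^n C(F_k),$$ where $\mathrm{Vol}(E_j)$, $s(E_j)$ and $C(F_k)$ are the quantities defined in the context.
   Context: An integral convex polytope is a convex polytope all of whose vertices have integer coordinates; a 3-dimensional polytope is simple if every vertex lies in exactly three facets. For a non-negative integer $l$, $lP=\{lx \mid x\in P\}$. By Ehrhart's theorem, for an integral convex polytope $P\subset\mathbb{R}^3$ of dimension 3, $|(lP)\cap\mathbb{Z}^3|$ is a polynomial in $l$ of degree 3, called the Ehrhart polynomial of $P$. $\langle\cdot,\cdot\rangle$ is the standard inner product on $\mathbb{R}^3$. For each facet $F_k$ of $P$, $v_k\in\mathbb{Z}^3$ denotes the inward-pointing primitive normal vector of $F_k$. For an edge $E$ of $P$, $\mathrm{Vol}(E)$ is the relative volume of $E$, i.e. the length of $E$ measured with respect to the lattice of rank one in the line containing $E$ (so a primitive lattice vector has length 1). Definition of $m(E)$ and $s(E)$. For an edge $E=F_{k_1}\cap F_{k_2}$ of $P$: (1) $m(E)=|((\mathbb{R}v_{k_1}+\mathbb{R}v_{k_2})\cap\mathbb{Z}^3)/(\mathbb{Z}v_{k_1}+\mathbb{Z}v_{k_2})|$.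 (2) There exists a basis $e_1,e_2$ of the lattice $(\mathbb{R}v_{k_1}+\mathbb{R}v_{k_2})\cap\mathbb{Z}^3$ such that $v_{k_1}=e_1$ and $v_{k_2}=pe_1+qe_2$ for some integers $q>p\geq 0$ (then $q=m(E)$). Put $s(E)=s(p,q)$, where $s(p,q)$ is the Dedekind sum $$s(p,q)=\sum_{i=1}^q\left(\left(\frac{i}{q}\right)\right)\left(\left(\frac{pi}{q}\right)\right),$$ with $((x))=x-[x]-\frac12$ if $x\notin\mathbb{Z}$ and $((x))=0$ if $x\in\mathbb{Z}$, $[x]$ being the integer part (floor) of $x$. The number $s(E)$ does not depend on the choice of $e_1,e_2$. Definition of $C(F)$. Let $F$ be a facet of $P$ with inward-pointing primitive normal vector $v\in\mathbb{Z}^3$, and let $r$ be the number of its vertices. Let $F_{k_1},\ldots,F_{k_r}$ be the facets of $P$ adjacent to $F$ (sharing an edge with $F$), listed in cyclic order around $F$, and let $P_1,\ldots,P_r$ be the vertices of $F$, named so that, with indices read cyclically ($F_{k_0}=F_{k_r}$, $F_{k_{r+1}}=F_{k_1}$, $P_0=P_r$, $P_{r+1}=P_1$), $P_i=F\cap F_{k_i}\cap F_{k_{i+1}}$; thus $F\cap F_{k_i}$ is the edge $P_{i-1}P_i$ with endpoints $P_{i-1}$ and $P_i$. The direction of the cyclic order is the one for which all the determinants $\varepsilon_i$ below are positive (counterclockwise when $F$ is viewed from outside $P$). Let $Q_i$ be the other endpoint of the edge $F_{k_i}\cap F_{k_{i+1}}$ of $P$ emanating from $P_i$ (the edge at $P_i$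 not contained in $F$). For $i=1,\ldots,r$ define $$\varepsilon_i=\det(v,v_{k_{i+1}},v_{k_i})>0,\quad a_i=\frac{\langle\overrightarrow{P_{i-1}Q_{i-1}},v_{k_{i+1}}\rangle}{\varepsilon_i\langle\overrightarrow{P_{i-1}Q_{i-1}},v\rangle},\quad b_i=\frac{\langle\overrightarrow{P_iP_{i+1}},v_{k_{i-1}}\rangle}{\varepsilon_{i-1}\langle\overrightarrow{P_iP_{i+1}},v_{k_i}\rangle},$$ where $v_{k_0}=v_{k_r}$, $v_{k_{r+1}}=v_{k_1}$, $\varepsilon_0=\varepsilon_r$, $P_0=P_r$, $P_{r+1}=P_1$, $Q_0=Q_r$. Then $$C(F)=-\sum_{2\leq i<j\leq r}a_i\left|\begin{array}{ccccc} b_{i+1}&\varepsilon_{i+1}^{-1}&0&\cdots&0\\ \varepsilon_{i+1}^{-1}&b_{i+2}&\varepsilon_{i+2}^{-1}&\ddots&\vdots\\ 0&\varepsilon_{i+2}^{-1}&\ddots&\ddots&0\\ \vdots&\ddots&\ddots&b_{j-2}&\varepsilon_{j-2}^{-1}\\ 0&\cdots&0&\varepsilon_{j-2}^{-1}&b_{j-1}\end{array}\right|\varepsilon_i\varepsilon_{i+1}\cdots\varepsilon_{j-1}\frac{\mathrm{Vol}(P_{j-1}P_j)}{m(P_{j-1}P_j)}.$$ Here the determinant is that of the symmetric tridiagonal matrix of size $j-i-1$ with diagonal entries $b_{i+1},\ldots,b_{j-1}$ and off-diagonal entries $\varepsilon_{i+1}^{-1},\ldots,\varepsilon_{j-2}^{-1}$,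 and it is understood to be $1$ when $j=i+1$. For each facet $F$, any choice of the starting facet $F_{k_1}$ is allowed; the value of $C(F)$ does not depend on this choice. *)

theory Defs
  imports "Jordan_Normal_Form.Determinant" "HOL-Analysis.Analysis"
begin

(* Both imported matrix libraries use these two infixes; here they mean the Analysis ones. *)
no_notation vec_index (infixl \<open>$\<close> 100)
no_notation scalar_prod (infix \<open>\<bullet>\<close> 70)

definition int_lattice :: "(real^3) set" where
  "int_lattice = {x. \<forall>i. x $ i \<in> \<int>}"

definition primitive :: "real^3 \<Rightarrow> bool" where
  "primitive v \<longleftrightarrow> v \<in> int_lattice \<and> v \<noteq> 0 \<and>
     (\<forall>w\<in>int_lattice. \<forall>k::int. v = of_int k *\<^sub>R w \<longrightarrow> \<bar>k\<bar> = 1)"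

definition integral_polytope :: "(real^3) set \<Rightarrow> bool" where
  "integral_polytope P \<longleftrightarrow> polytope P \<and> (\<forall>x. x extreme_point_of P \<longrightarrow> x \<in> int_lattice)"

definition simple_polytope :: "(real^3) set \<Rightarrow> bool" where
  "simple_polytope P \<longleftrightarrow>
     polytope P \<and> (\<forall>x. x extreme_point_of P \<longrightarrow> card {F. F facet_of P \<and> x \<in> F} = 3)"

definition lattice_points :: "(real^3) set \<Rightarrow> nat \<Rightarrow> nat" where
  "lattice_points P l = card ((\<lambda>x. real l *\<^sub>R x) ` P \<inter> int_lattice)"

definition inward_normal :: "(real^3) set \<Rightarrow> (real^3) set \<Rightarrow> real^3" where
  "inward_normal P F =
     (THE v. primitive v \<and> (\<exists>c. P \<subseteq> {x. c \<le> v \<bullet> x} \<and> F = P \<inter> {x. v \<bullet> x = c}))"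

definition rel_vol :: "(real^3) set \<Rightarrow> real" where
  "rel_vol E =
     (THE t. 0 \<le> t \<and> (\<exists>x y u. E = closed_segment x y \<and> primitive u \<and> y - x = t *\<^sub>R u))"

definition plane_lattice :: "real^3 \<Rightarrow> real^3 \<Rightarrow> (real^3) set" where
  "plane_lattice v w = span {v, w} \<inter> int_lattice"

definition int_span :: "real^3 \<Rightarrow> real^3 \<Rightarrow> (real^3) set" where
  "int_span v w = {of_int a *\<^sub>R v + of_int b *\<^sub>R w | a b :: int. True}"

definition lattice_index :: "real^3 \<Rightarrow> real^3 \<Rightarrow> nat" where
  "lattice_index v w =
     card (plane_lattice v w //
       {(x, y). x \<in> plane_lattice v w \<and> y \<in> plane_lattice v w \<and> x - y \<in> int_span v w})"

definition facet_pair :: "(real^3) set \<Rightarrow> (real^3) set \<Rightarrow> (real^3) set \<Rightarrow> (real^3) set \<Rightarrow> bool" where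
  "facet_pair P E F G \<longleftrightarrow> F facet_of P \<and> G facet_of P \<and> F \<noteq> G \<and> E = F \<inter> G"

(* An edge of a simple polytope lies in exactly two facets; their order and, in edge_s, the
   lattice basis are immaterial, so the descriptions below determine their values. *)
definition edge_m :: "(real^3) set \<Rightarrow> (real^3) set \<Rightarrow> nat" where
  "edge_m P E =
     (THE m. \<exists>F G. facet_pair P E F G \<and> m = lattice_index (inward_normal P F) (inward_normal P G))"

definition sawtooth :: "real \<Rightarrow> real" where
  "sawtooth x = (if x \<in> \<int> then 0 else x - of_int \<lfloor>x\<rfloor> - 1/2)"

definition dedekind_sum :: "int \<Rightarrow> int \<Rightarrow> real" where
  "dedekind_sum p q = (\<Sum>i = 1..q. sawtooth (of_int i / of_int q) * sawtooth (of_int (p * i) / of_int q))"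

definition edge_s :: "(real^3) set \<Rightarrow> (real^3) set \<Rightarrow> real" where
  "edge_s P E =
     (THE s. \<exists>F G e1 e2 p q.
        facet_pair P E F G \<and>
        independent {e1, e2} \<and> e1 \<noteq> e2 \<and>
        int_span e1 e2 = plane_lattice (inward_normal P F) (inward_normal P G) \<and>
        inward_normal P F = e1 \<and>
        inward_normal P G = of_int p *\<^sub>R e1 + of_int q *\<^sub>R e2 \<and>
        0 \<le> p \<and> p < q \<and>
        s = dedekind_sum p q)"

definition eps :: "(real^3) set \<Rightarrow> (real^3) set \<Rightarrow> (nat \<Rightarrow> (real^3) set) \<Rightarrow> nat \<Rightarrow> real" where
  "eps P F G i =
     det (vector [inward_normal P F, inward_normal P (G (i + 1)), inward_normal P (G i)] :: real^3^3)"

(* The index i = 0 and, for facets and vertices, i = r + 1 repeat the indices r and 1, so that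
   neighbours in the cyclic order can be written with i - 1 and i + 1 for i in {1..r}. Positivity of eps fixes the direction of
   the order: counterclockwise when F is viewed from outside P. *)
definition facet_labelling ::
  "(real^3) set \<Rightarrow> (real^3) set \<Rightarrow> nat \<Rightarrow> (nat \<Rightarrow> (real^3) set) \<Rightarrow> (nat \<Rightarrow> real^3) \<Rightarrow> (nat \<Rightarrow> real^3) \<Rightarrow> bool"
where
  "facet_labelling P F r G p q \<longleftrightarrow>
     r = card {x. x extreme_point_of F} \<and>
     bij_betw G {1..r} {H. H facet_of P \<and> (F \<inter> H) edge_of P} \<and>
     bij_betw p {1..r} {x. x extreme_point_of F} \<and>
     G 0 = G r \<and> G (r + 1) = G 1 \<and>
     p 0 = p r \<and> p (r + 1) = p 1 \<and>
     q 0 = q r \<and>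
     (\<forall>i\<in>{1..r}.
        F \<inter> G i \<inter> G (i + 1) = {p i} \<and>
        F \<inter> G i = closed_segment (p (i - 1)) (p i) \<and>
        (G i \<inter> G (i + 1)) edge_of P \<and>
        G i \<inter> G (i + 1) = closed_segment (p i) (q i) \<and>
        0 < eps P F G i)"

definition coeff_a ::
  "(real^3) set \<Rightarrow> (real^3) set \<Rightarrow> (nat \<Rightarrow> (real^3) set) \<Rightarrow> (nat \<Rightarrow> real^3) \<Rightarrow> (nat \<Rightarrow> real^3) \<Rightarrow> nat \<Rightarrow> real"
where
  "coeff_a P F G p q i =
     ((q (i - 1) - p (i - 1)) \<bullet> inward_normal P (G (i + 1))) /
     (eps P F G i * ((q (i - 1) - p (i - 1)) \<bullet> inward_normal P F))"

definition coeff_b ::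
  "(real^3) set \<Rightarrow> (real^3) set \<Rightarrow> (nat \<Rightarrow> (real^3) set) \<Rightarrow> (nat \<Rightarrow> real^3) \<Rightarrow> nat \<Rightarrow> real"
where
  "coeff_b P F G p i =
     ((p (i + 1) - p i) \<bullet> inward_normal P (G (i - 1))) /
     (eps P F G (i - 1) * ((p (i + 1) - p i) \<bullet> inward_normal P (G i)))"

(* The symmetric tridiagonal n x n determinant with diagonal d 0, ..., d (n - 1) and
   off-diagonal entries e 0, ..., e (n - 2); it equals 1 for n = 0. *)
definition tridiag_det :: "nat \<Rightarrow> (nat \<Rightarrow> real) \<Rightarrow> (nat \<Rightarrow> real) \<Rightarrow> real" where
  "tridiag_det n d e =
     Determinant.det (Matrix.mat n n (\<lambda>(k, l).
       if k = l then d k else if l = k + 1 then e k else if k = l + 1 then e l else 0))"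

definition C_formula ::
  "(real^3) set \<Rightarrow> (real^3) set \<Rightarrow> nat \<Rightarrow> (nat \<Rightarrow> (real^3) set) \<Rightarrow> (nat \<Rightarrow> real^3) \<Rightarrow> (nat \<Rightarrow> real^3) \<Rightarrow> real"
where
  "C_formula P F r G p q =
     - (\<Sum>(i, j)\<in>{(i, j). 2 \<le> i \<and> i < j \<and> j \<le> r}.
          coeff_a P F G p q i *
          tridiag_det (j - i - 1)
            (\<lambda>k. coeff_b P F G p (i + 1 + k)) (\<lambda>k. inverse (eps P F G (i + 1 + k))) *
          (\<Prod>k\<in>{i..<j}. eps P F G k) *
          (rel_vol (closed_segment (p (j - 1)) (p j)) /
           real (edge_m P (closed_segment (p (j - 1)) (p j)))))"

(* A labelling exists for every facet of a simple integral 3-polytope and is unique up to cyclic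
   rotation, which does not change C_formula. *)
definition facet_C :: "(real^3) set \<Rightarrow> (real^3) set \<Rightarrow> real" where
  "facet_C P F = (THE c. \<exists>r G p q. facet_labelling P F r G p q \<and> c = C_formula P F r G p q)"

end

theory Submission
  imports Defs "HOL-Real_Asymp.Real_Asymp"
begin

text \<open>
  Fix a generic direction \<open>\<xi>\<close>. The indicator function of a simple polytope is a signed sum of indicator
  functions of half-open simplicial cones at its vertices, flipped so that \<open>\<xi>\<close> is bounded above on each
  of them (Lawrence and Varchenko); summing \<open>exp (\<xi> \<bullet> x)\<close> over the lattice points of these cones
  gives Brion's formula for \<open>l P\<close>. Replacing \<open>\<xi>\<close> by \<open>t \<xi>\<close> and letting \<open>t\<close> tend to 0, the coefficient of \<open>l\<close>
  becomes a sum over the vertices of Bernoulli polynomials of degree two, evaluated at the points of the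
  fundamental parallelepipeds. The products of two linear Bernoulli polynomials sum to
  \<open>m(E) (s(E) + 1/4)\<close>, and the contributions of the two ends of an edge combine to \<open>(s(E) + 1/4) Vol(E)\<close>.
  The quadratic ones sum to 1/6, and collecting them along a facet \<open>F\<close> gives
  \<open>- (\<Sum>\<^sub>j (u \<bullet> v\<^sub>j) / (u \<bullet> v) * Vol(E\<^sub>j) / m(E\<^sub>j))\<close>, the sum being over the edges of \<open>F\<close>. This number
  does not depend on \<open>u\<close>. For \<open>u\<close> orthogonal to the normals of the first two neighbours of \<open>F\<close> the
  numbers \<open>(u \<bullet> v\<^sub>j) / (u \<bullet> v)\<close> satisfy a three-term recurrence, whose solution in terms of continuants is
  the expression defining \<open>C(F)\<close>.
\<close>

section \<open>Integer vectors\<close>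

unbundle cross3_syntax

text \<open>For no direction does the series of \<open>exp (\<xi> \<bullet> x)\<close> converge on
  the tangent cones of all vertices. Flipping a generator replaces a half-line of exponents by minus
  the complementary one, which has the same formal value \<open>1 / (1 - exp X)\<close>; so one
  \<xi> serves all vertices with absolutely convergent series. The decomposition holds because,
  expanded over faces, it counts for each face the vertices where \<xi> is minimal on it, and there
  is exactly one. The signed sum is therefore independent of \<xi>, and for a point outside
  \<open>P\<close> a separating direction annihilates every term. That the sum over the edges of
  \<open>F\<close> does not depend on \<open>u\<close> is the closing of a polygon: with
  \<open>n\<close> the normal of \<open>F\<close>, the edge vectors are multiples of
  \<open>n \<times> v\<close> for the neighbouring normals \<open>v\<close>, and they sum to 0, so
  the corresponding combination of the normals is a multiple of \<open>n\<close>. As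
  \<open>edge_s\<close> and \<open>facet_C\<close> are definite descriptions, each is identified
  with a quantity free of choices: a lattice point sum over a parallelepiped for the first, the
  share of \<open>F\<close> in the vertex sum for the second.\<close>

lemma int_lattice_simps [intro, simp]:
  "0 \<in> int_lattice"
  "x \<in> int_lattice \<Longrightarrow> y \<in> int_lattice \<Longrightarrow> x + y \<in> int_lattice"
  "x \<in> int_lattice \<Longrightarrow> y \<in> int_lattice \<Longrightarrow> x - y \<in> int_lattice"
  "x \<in> int_lattice \<Longrightarrow> - x \<in> int_lattice"
  "x \<in> int_lattice \<Longrightarrow> c \<in> \<int> \<Longrightarrow> c *\<^sub>R x \<in> int_lattice"
  "axis i 1 \<in> int_lattice"
  by (auto simp: int_lattice_def axis_def)

lemma cross3_int_lattice [intro, simp]: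
  "x \<in> int_lattice \<Longrightarrow> y \<in> int_lattice \<Longrightarrow> x \<times> y \<in> int_lattice"
  by (auto simp: int_lattice_def cross3_def forall_3)

lemma inner_int_lattice [intro, simp]:
  "x \<in> int_lattice \<Longrightarrow> y \<in> int_lattice \<Longrightarrow> x \<bullet> y \<in> \<int>"
  by (auto simp: int_lattice_def inner_vec_def sum_3)

text \<open>Bezout's identity for the three coordinates: \<open>k\<close> is their gcd, and
  \<open>z\<close> certifies that those of \<open>w\<close> are coprime. Such a dual vector is the
  working form of primitivity, since pairing with it reads off the coefficient of a multiple of
  \<open>w\<close>.\<close>

lemma int_lattice_obtain_multiple:
  assumes "v \<in> int_lattice" "v \<noteq> 0"
  obtains k :: int and w z where "k > 0" "w \<in> int_lattice" "z \<in> int_lattice"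
    "v = of_int k *\<^sub>R w" "z \<bullet> w = 1"
proof -
  obtain a1 a2 a3 where a: "v$1 = of_int a1" "v$2 = of_int a2" "v$3 = of_int a3"
    using assms(1) unfolding int_lattice_def by (metis (mono_tags, lifting) Ints_cases mem_Collect_eq)
  define k where "k = gcd (gcd a1 a2) a3"
  have "a1 \<noteq> 0 \<or> a2 \<noteq> 0 \<or> a3 \<noteq> 0"
    using assms(2) a by (auto simp: vec_eq_iff forall_3)
  hence k0: "k \<noteq> 0" by (auto simp: k_def)
  hence k: "k > 0" by (metis gcd_ge_0_int k_def order_less_le)
  obtain b1 b2 b3 where b: "a1 = k * b1" "a2 = k * b2" "a3 = k * b3"
    by (metis dvd_def gcd_dvd1 gcd_dvd2 dvd_trans k_def)
  obtain s t where st: "s * a1 + t * a2 = gcd a1 a2" using bezout_int by blast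
  obtain s' t' where st': "s' * gcd a1 a2 + t' * a3 = k" unfolding k_def using bezout_int by blast
  define w :: "real^3" where "w = vector [of_int b1, of_int b2, of_int b3]"
  define z :: "real^3" where "z = vector [of_int (s' * s), of_int (s' * t), of_int t']"
  have "k = s' * (s * a1 + t * a2) + t' * a3" by (simp only: st st')
  hence "k = k * ((s' * s) * b1 + (s' * t)*b2 + t'*b3)" using b by (simp add: algebra_simps)
  hence one: "(s' * s) * b1 + (s' * t)*b2 + t'*b3 = 1" using k0 by simp
  show ?thesis
  proof (rule that[of k w z])
    show "w \<in> int_lattice" "z \<in> int_lattice"
      by (auto simp: w_def z_def int_lattice_def forall_3)
    show "v = of_int k *\<^sub>R w"
      using a b by (auto simp: w_def vec_eq_iff forall_3)
    have "z \<bullet> w = of_int ((s' * s) * b1 + (s' * t)*b2 + t'*b3)"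
      by (simp add: z_def w_def inner_vec_def sum_3)
    thus "z \<bullet> w = 1" using one by simp
  qed (use k in auto)
qed

lemma primitive_iff:
  "primitive v \<longleftrightarrow> v \<in> int_lattice \<and> (\<exists>z\<in>int_lattice. z \<bullet> v = 1)"
proof
  assume v: "primitive v"
  then obtain k w z where kw: "k > (0::int)" "w \<in> int_lattice" "z \<in> int_lattice"
    "v = of_int k *\<^sub>R w" "z \<bullet> w = 1"
    by (auto simp: primitive_def intro: int_lattice_obtain_multiple)
  hence "\<bar>k\<bar> = 1" using v by (auto simp: primitive_def)
  hence "v = w" using kw by simp
  thus "v \<in> int_lattice \<and> (\<exists>z\<in>int_lattice. z \<bullet> v = 1)" using kw by auto
next
  assume R: "v \<in> int_lattice \<and> (\<exists>z\<in>int_lattice. z \<bullet> v = 1)"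
  then obtain z where z: "z \<in> int_lattice" "z \<bullet> v = 1" by auto
  have "\<bar>k\<bar> = 1" if "w \<in> int_lattice" "v = of_int k *\<^sub>R w" for w and k :: int
  proof -
    obtain m :: int where "z \<bullet> w = of_int m" using inner_int_lattice z(1) \<open>w \<in> int_lattice\<close> by (meson Ints_cases)
    hence "of_int (k * m) = (1::real)" using z that by simp
    hence "k * m = 1" by (metis of_int_eq_1_iff)
    thus ?thesis by (auto simp: zmult_eq_1_iff)
  qed
  thus "primitive v" using R z by (auto simp: primitive_def)
qed

lemma primitive_obtain_dual:
  assumes "primitive v" obtains z where "z \<in> int_lattice" "z \<bullet> v = 1"
  using assms by (auto simp: primitive_iff)

lemma primitive_int_lattice [simp]: "primitive v \<Longrightarrow> v \<in> int_lattice"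
  by (simp add: primitive_def)

lemma primitive_nonzero: "primitive v \<Longrightarrow> v \<noteq> 0"
  unfolding primitive_def by blast

lemma primitive_uminus [simp]: "primitive (- v) \<longleftrightarrow> primitive v"
proof -
  have "primitive (- v)" if v: "primitive v" for v
  proof -
    obtain z where "z \<in> int_lattice" "z \<bullet> v = 1" using v by (rule primitive_obtain_dual)
    hence "- z \<in> int_lattice" "- z \<bullet> - v = 1" by auto
    moreover have "- v \<in> int_lattice" using v by auto
    ultimately show ?thesis unfolding primitive_iff by blast
  qed
  from this[of v] this[of "-v"] show ?thesis by (metis minus_minus)
qed

lemma int_lattice_obtain_primitive:
  assumes "v \<in> int_lattice" "v \<noteq> 0"
  obtains k :: int and w where "k > 0" "primitive w" "v = of_int k *\<^sub>R w"
  using int_lattice_obtain_multiple[OF assms] primitive_iff by metis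

lemma primitive_multiple_Ints:
  assumes "primitive w" "c *\<^sub>R w \<in> int_lattice" shows "c \<in> \<int>"
proof -
  obtain z where "z \<in> int_lattice" "z \<bullet> w = 1" using assms(1) by (rule primitive_obtain_dual)
  thus ?thesis using inner_int_lattice[of z "c *\<^sub>R w"] assms(2) by simp
qed

lemma primitive_parallel:
  assumes "primitive v" "primitive w" "v = c *\<^sub>R w" shows "c = 1 \<or> c = -1"
proof -
  have "c \<in> \<int>" using assms primitive_multiple_Ints by (metis primitive_int_lattice)
  then obtain k where k: "c = of_int k" by (auto elim: Ints_cases)
  hence "\<bar>k\<bar> = 1" using assms unfolding primitive_def by blast
  thus ?thesis using k by auto
qed

lemma primitive_scaleR_eq:
  assumes "primitive v" "primitive w" "a *\<^sub>R v = b *\<^sub>R w" shows "\<bar>a\<bar> = \<bar>b\<bar>"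
proof (cases "a = 0")
  case True
  thus ?thesis using assms by (auto dest: primitive_nonzero)
next
  case False
  have "(1/a) *\<^sub>R (a *\<^sub>R v) = (1/a) *\<^sub>R (b *\<^sub>R w)" using assms(3) by simp
  hence "v = (b/a) *\<^sub>R w" using False by simp
  hence "b/a = 1 \<or> b/a = -1" using primitive_parallel assms by blast
  thus ?thesis using False by (auto simp: divide_eq_eq)
qed

lemma cross3_orthogonal_parallel:
  fixes a x y :: "real^3"
  assumes "a \<bullet> x = 0" "a \<bullet> y = 0" "x \<times> y \<noteq> 0"
  obtains c where "a = c *\<^sub>R (x \<times> y)"
proof -
  have "a \<times> (x \<times> y) = 0" by (simp add: Lagrange assms)
  hence "(x \<times> y) \<times> a = 0" using cross_skew[of "x \<times> y" a] by simp
  hence "collinear {0, x \<times> y, a}" by (simp only: cross_eq_0)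
  thus ?thesis using assms(3) that by (auto simp: collinear_lemma)
qed

lemma triple_rotate: "b \<bullet> (c \<times> a) = a \<bullet> (b \<times> c)" "c \<bullet> (a \<times> b) = a \<bullet> (b \<times> c)" for a b c :: "real^3"
  by (simp_all add: cross3_simps)

lemma triple_swap: "a \<bullet> (c \<times> b) = - (a \<bullet> (b \<times> c))" for a b c :: "real^3"
  by (simp add: cross3_simps)

text \<open>Cramer's rule for the dual basis. With the facet normals at a vertex as
  \<open>a\<close>, \<open>b\<close>, \<open>c\<close>, the cross products point along the edges and
  the coefficients are heights over the facets.\<close>

lemma triple_dual_expansion:
  fixes a b c x :: "real^3"
  shows "(a \<bullet> (b \<times> c)) *\<^sub>R x
    = (a \<bullet> x) *\<^sub>R (b \<times> c) + (b \<bullet> x) *\<^sub>R (c \<times> a) + (c \<bullet> x) *\<^sub>R (a \<times> b)"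
  unfolding vec_eq_iff forall_3
  by (simp add: cross3_def inner_vec_def sum_3 algebra_simps)

text \<open>Cramer's rule for the basis \<open>a\<close>, \<open>b\<close>, \<open>c\<close> itself;
  later it expresses a facet normal by three others.\<close>

lemma triple_expansion:
  fixes a b c x :: "real^3"
  shows "(a \<bullet> (b \<times> c)) *\<^sub>R x
    = (x \<bullet> (b \<times> c)) *\<^sub>R a + (x \<bullet> (c \<times> a)) *\<^sub>R b + (x \<bullet> (a \<times> b)) *\<^sub>R c"
  unfolding vec_eq_iff forall_3
  by (simp add: cross3_def inner_vec_def sum_3 algebra_simps)

lemma exists_orthogonal_if_triple_0:
  fixes a b c :: "real^3"
  assumes "a \<bullet> (b \<times> c) = 0"
  obtains d where "d \<noteq> 0" "a \<bullet> d = 0" "b \<bullet> d = 0" "c \<bullet> d = 0"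
proof -
  have "det (vector [a, b, c] :: real^3^3) = 0" using assms by (simp add: dot_cross_det)
  hence "\<not> invertible (vector [a, b, c] :: real^3^3)" by (simp add: invertible_det_nz)
  then obtain d where d: "d \<noteq> 0" "(vector [a, b, c] :: real^3^3) *v d = 0"
    unfolding invertible_left_inverse matrix_left_invertible_ker by blast
  have "(vector [a, b, c] :: real^3^3) $ i \<bullet> d = 0" for i
    using d(2) by (metis matrix_vector_mul_component zero_index)
  from this[of 1] this[of 2] this[of 3] show ?thesis using that d(1) by simp
qed

section \<open>Bernoulli polynomials, Dedekind sums and lattice points of a parallelepiped\<close>

definition bern1 :: "real \<Rightarrow> real" where "bern1 x = x - 1/2"
definition bern2 :: "real \<Rightarrow> real" where "bern2 x = x\<^sup>2 - x + 1/6"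

lemma int_div_less_iff:
  fixes a q m :: int
  assumes "q > 0" shows "a div q < m \<longleftrightarrow> a < q * m"
proof -
  have a: "a = q * (a div q) + a mod q" "0 \<le> a mod q" "a mod q < q" using assms by simp_all
  show ?thesis
  proof
    assume "a div q < m"
    hence "q * (a div q) \<le> q * (m - 1)" using assms by (intro mult_left_mono) auto
    also have "\<dots> = q * m - q" by (simp add: algebra_simps)
    finally show "a < q * m" using a by linarith
  next
    assume "a < q * m"
    hence "q * (a div q) < q * m" using a by linarith
    thus "a div q < m" using assms by simp
  qed
qed

lemma sum_int_div_mod:
  fixes f :: "int \<Rightarrow> real"
  assumes "q > 0"
  shows "(\<Sum>a\<in>{0..<q * m}. f a) = (\<Sum>i\<in>{0..<q}. \<Sum>t\<in>{0..<m}. f (i + q * t))"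
proof -
  have "(\<Sum>a\<in>{0..<q * m}. f a) = (\<Sum>(i, t)\<in>Sigma {0..<q} (\<lambda>_. {0..<m}). f (i + q * t))"
  proof (rule sum.reindex_bij_witness[of _ "\<lambda>(i, t). i + q * t" "\<lambda>a. (a mod q, a div q)"])
    fix a assume a: "a \<in> {0..<q * m}"
    have "a div q < m" using a assms by (simp add: int_div_less_iff)
    thus "(a mod q, a div q) \<in> Sigma {0..<q} (\<lambda>_. {0..<m})"
      using a assms by (auto simp: pos_imp_zdiv_nonneg_iff)
  next
    fix b assume b: "b \<in> Sigma {0..<q} (\<lambda>_. {0..<m})"
    then obtain i t where it: "b = (i, t)" "0 \<le> i" "i < q" "0 \<le> t" "t < m" by auto
    have "i + q * t < q + q * t" using it by simp
    also have "\<dots> = q * (t + 1)" by (simp add: algebra_simps)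
    also have "\<dots> \<le> q * m" using it assms by (intro mult_left_mono) auto
    finally show "(case b of (i, t) \<Rightarrow> i + q * t) \<in> {0..<q * m}"
      using it assms by auto
  qed (use assms in auto)
  thus ?thesis by (simp add: sum.cartesian_product)
qed

lemma sum_int_residue_class:
  fixes f :: "int \<Rightarrow> real"
  assumes "q > 0"
  shows "(\<Sum>b\<in>{b\<in>{0..<q * m}. q dvd b - r}. f b) = (\<Sum>t\<in>{0..<m}. f (r mod q + q * t))"
proof (rule sum.reindex_bij_witness[of _ "\<lambda>t. r mod q + q * t" "\<lambda>a. a div q"])
  fix a assume a: "a \<in> {b\<in>{0..<q * m}. q dvd b - r}"
  hence "a mod q = r mod q" by (simp add: mod_eq_dvd_iff)
  thus "r mod q + q * (a div q) = a" "f (r mod q + q * (a div q)) = f a"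
    by (metis mod_mult_div_eq)+
  have "a div q < m" using a assms by (simp add: int_div_less_iff)
  thus "a div q \<in> {0..<m}" using a assms by (auto simp: pos_imp_zdiv_nonneg_iff)
next
  fix t assume t: "t \<in> {0..<m}"
  show "(r mod q + q * t) div q = t" using assms by simp
  have "r mod q + q * t < q + q * t" using assms by simp
  also have "\<dots> = q * (t + 1)" by (simp add: algebra_simps)
  also have "\<dots> \<le> q * m" using t assms by (intro mult_left_mono) auto
  finally have "r mod q + q * t < q * m" .
  moreover have "q dvd (r mod q + q * t) - r"
    by (metis mod_eq_dvd_iff mod_mod_trivial mod_mult_self2)
  moreover have "0 \<le> r mod q + q * t" using t assms by simp
  ultimately show "r mod q + q * t \<in> {b\<in>{0..<q * m}. q dvd b - r}" by simp
qed

lemma sum_int_ivl_nat: "(\<Sum>t\<in>{0..<int n}. f t) = (\<Sum>t<n. f (int t))"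
  by (rule sum.reindex_bij_witness[of _ int nat]) auto

lemma sum_int_ivl_id:
  assumes "m \<ge> 0"
  shows "(\<Sum>t\<in>{0..<m}. real_of_int t) = of_int m * (of_int m - 1) / 2"
proof -
  have "(\<Sum>t<n. real t) = real n * (real n - 1) / 2" for n :: nat
    by (induction n) (auto simp: field_simps)
  from this[of "nat m"] show ?thesis
    using sum_int_ivl_nat[of real_of_int "nat m"] assms by simp
qed

lemma sum_int_ivl_square:
  assumes "m \<ge> 0"
  shows "(\<Sum>t\<in>{0..<m}. (real_of_int t)\<^sup>2) = of_int m * (of_int m - 1) * (2 * of_int m - 1) / 6"
proof -
  have "(\<Sum>t<n. (real t)\<^sup>2) = real n * (real n - 1) * (2 * real n - 1) / 6" for n :: nat
    by (induction n) (auto simp: field_simps power2_eq_square)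
  from this[of "nat m"] show ?thesis
    using sum_int_ivl_nat[of "\<lambda>t. (real_of_int t)\<^sup>2" "nat m"] assms by simp
qed

text \<open>Raabe's multiplication formula for the first Bernoulli polynomial. The parallelepiped at
  a vertex has the modulus \<open>q * m\<close>, while the edge only knows \<open>q\<close>; this
  formula removes \<open>m\<close>.\<close>

lemma bern1_multiplication:
  assumes "q > 0" "m > 0"
  shows "(\<Sum>t\<in>{0..<m}. bern1 (of_int (r + q * t) / of_int (q * m))) = bern1 (of_int r / of_int q)"
proof -
  have "bern1 (of_int (r + q * t) / of_int (q * m))
      = (of_int r / of_int (q * m) - 1/2) + of_int t / of_int m" for t
    using assms by (simp add: bern1_def field_simps)
  hence "(\<Sum>t\<in>{0..<m}. bern1 (of_int (r + q * t) / of_int (q * m)))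
    = of_int m * (of_int r / of_int (q * m) - 1/2) + (\<Sum>t\<in>{0..<m}. of_int t) / of_int m"
    using assms by (simp only: sum.distrib sum_divide_distrib) simp
  also have "\<dots> = bern1 (of_int r / of_int q)"
    using assms by (simp add: sum_int_ivl_id bern1_def field_simps)
  finally show ?thesis .
qed

text \<open>Raabe's formula for the second Bernoulli polynomial at 0, where its value is
  1/6.\<close>

lemma bern2_sum:
  assumes "m > 0"
  shows "(\<Sum>a\<in>{0..<m}. bern2 (of_int a / of_int m)) = 1 / (6 * of_int m)"
proof -
  have "bern2 (of_int a / of_int m) = (of_int a)\<^sup>2 / (of_int m)\<^sup>2 - of_int a / of_int m + 1/6" for a
    by (simp add: bern2_def power_divide)
  hence "(\<Sum>a\<in>{0..<m}. bern2 (of_int a / of_int m))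
      = (\<Sum>a\<in>{0..<m}. (of_int a)\<^sup>2) / (of_int m)\<^sup>2 - (\<Sum>a\<in>{0..<m}. of_int a) / of_int m + of_int m / 6"
    using assms by (simp only: sum.distrib sum_subtractf sum_divide_distrib) simp
  also have "\<dots> = of_int m * (of_int m - 1) * (2 * of_int m - 1) / 6 / (of_int m)\<^sup>2
      - of_int m * (of_int m - 1) / 2 / of_int m + of_int m / 6"
    using assms by (simp only: sum_int_ivl_id sum_int_ivl_square less_imp_le)
  also have "\<dots> = 1 / (6 * of_int m)"
    using assms by (simp add: field_simps power2_eq_square)
  finally show ?thesis .
qed

lemma sawtooth_of_int_divide:
  assumes "q > 0"
  shows "sawtooth (of_int i / of_int q) = (if q dvd i then 0 else bern1 (of_int (i mod q) / of_int q))"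
proof -
  have "real_of_int i / of_int q \<in> \<int> \<longleftrightarrow> q dvd i"
    using assms by (simp add: of_int_div_of_int_in_Ints_iff)
  moreover have "real_of_int i / of_int q - of_int \<lfloor>real_of_int i / of_int q\<rfloor> = of_int (i mod q) / of_int q"
  proof -
    have "real_of_int i = of_int q * of_int (i div q) + of_int (i mod q)"
      by (metis mult_div_mod_eq of_int_add of_int_mult)
    hence "real_of_int i / of_int q = of_int (i div q) + of_int (i mod q) / of_int q"
      using assms by (simp add: field_simps)
    thus ?thesis by (simp add: floor_divide_of_int_eq)
  qed
  ultimately show ?thesis by (simp add: sawtooth_def bern1_def)
qed

text \<open>On fractional parts, \<open>bern1\<close> differs from the sawtooth function only at 0.
  Coprimality makes \<open>i = 0\<close> the only index where this happens, and there the product is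
  \<open>(-1/2)\<^sup>2\<close>: the origin of the 1/4 added to s(E).\<close>

lemma dedekind_sum_eq_bern1:
  assumes "q > 0" "coprime p q"
  shows "(\<Sum>i\<in>{0..<q}. bern1 (of_int i / of_int q) * bern1 (of_int (p * i mod q) / of_int q))
    = dedekind_sum p q + 1/4"
proof -
  have "dedekind_sum p q = (\<Sum>i\<in>{1..q}. if i = q then 0 else
     bern1 (of_int i / of_int q) * bern1 (of_int (p * i mod q) / of_int q))"
    unfolding dedekind_sum_def
  proof (rule sum.cong[OF refl])
    fix i assume i: "i \<in> {1..q}"
    have "q dvd i \<longleftrightarrow> i = q" using i assms zdvd_imp_le[of q i] by auto
    moreover have "q dvd p * i \<longleftrightarrow> q dvd i"
      using assms by (simp add: coprime_commute coprime_dvd_mult_right_iff)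
    ultimately show "sawtooth (of_int i / of_int q) * sawtooth (of_int (p * i) / of_int q)
      = (if i = q then 0 else bern1 (of_int i / of_int q) * bern1 (of_int (p * i mod q) / of_int q))"
      using i assms unfolding sawtooth_of_int_divide[OF assms(1)] by auto
  qed
  also have "\<dots> = (\<Sum>i\<in>{1..<q}. bern1 (of_int i / of_int q) * bern1 (of_int (p * i mod q) / of_int q))"
    by (rule sum.mono_neutral_cong_right) auto
  finally have *: "dedekind_sum p q = (\<Sum>i\<in>{1..<q}. bern1 (of_int i / of_int q) * bern1 (of_int (p * i mod q) / of_int q))" .
  have "{0..<q} = insert 0 {1..<q}" using assms by auto
  thus ?thesis unfolding * by (simp add: bern1_def)
qed

section \<open>Lattice points of a half-open parallelepiped\<close>

lemma int_arith_progression_in_ivl: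
  assumes "c \<noteq> 0" "q \<ge> 0"
  shows "finite {k :: int. 0 \<le> r + k * c \<and> r + k * c < q * \<bar>c\<bar>}"
    and "int (card {k :: int. 0 \<le> r + k * c \<and> r + k * c < q * \<bar>c\<bar>}) = q"
proof -
  have pos: "{k :: int. 0 \<le> r + k * c \<and> r + k * c < q * c} = {- (r div c)..<- (r div c) + q}"
    if c: "c > 0" for c
  proof -
    have "0 \<le> r + k * c \<and> r + k * c < q * c \<longleftrightarrow> 0 \<le> (r + k * c) div c \<and> (r + k * c) div c < q" for k
      by (metis int_div_less_iff[OF c] pos_imp_zdiv_nonneg_iff[OF c] mult.commute)
    moreover have "(r + k * c) div c = r div c + k" for k using c by simp
    ultimately show ?thesis by auto
  qed
  have "finite {k :: int. 0 \<le> r + k * c \<and> r + k * c < q * \<bar>c\<bar>} \<and>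
    int (card {k :: int. 0 \<le> r + k * c \<and> r + k * c < q * \<bar>c\<bar>}) = q"
  proof (cases "c > 0")
    case True
    thus ?thesis using pos[of c] assms by simp
  next
    case False
    hence c: "- c > 0" using assms by simp
    have "{k :: int. 0 \<le> r + k * c \<and> r + k * c < q * \<bar>c\<bar>}
      = uminus ` {k :: int. 0 \<le> r + k * (-c) \<and> r + k * (-c) < q * (-c)}"
    proof (intro Set.set_eqI iffI)
      fix k assume "k \<in> {k :: int. 0 \<le> r + k * c \<and> r + k * c < q * \<bar>c\<bar>}"
      thus "k \<in> uminus ` {k :: int. 0 \<le> r + k * (-c) \<and> r + k * (-c) < q * (-c)}"
        using c by (intro image_eqI[of _ _ "-k"]) auto
    qed (use c in auto)
    thus ?thesis using pos[OF c] assms by (simp add: card_image)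
  qed
  thus "finite {k :: int. 0 \<le> r + k * c \<and> r + k * c < q * \<bar>c\<bar>}"
    and "int (card {k :: int. 0 \<le> r + k * c \<and> r + k * c < q * \<bar>c\<bar>}) = q" by auto
qed

text \<open>For independent \<open>a\<close>, \<open>b\<close>, \<open>c\<close> these are the
  lattice points of the half-open parallelepiped spanned, up to a common sign, by
  \<open>b \<times> c\<close>, \<open>c \<times> a\<close>, \<open>a \<times> b\<close>. With these
  generators all three heights equal the same determinant.\<close>

definition box_points :: "real^3 \<Rightarrow> real^3 \<Rightarrow> real^3 \<Rightarrow> (real^3) set" where
  "box_points a b c = {x \<in> int_lattice. \<forall>n\<in>{a, b, c}. 0 \<le> n \<bullet> x \<and> n \<bullet> x < \<bar>a \<bullet> (b \<times> c)\<bar>}"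

text \<open>Values \<open>a\<close>, \<open>b\<close> of \<open>n1\<close>, \<open>n2\<close> occur
  exactly if \<open>q\<close> divides \<open>b - p * a\<close>. The lattice points over one such
  pair lie on a line in direction \<open>n1 \<times> e\<close>, along which \<open>n3\<close>
  advances in steps of a fixed integer \<open>c\<close> with \<open>m = \<bar>c\<bar>\<close>; a
  half-open range of length \<open>q * m\<close> therefore catches exactly \<open>q\<close> of
  them.\<close>

lemma sum_box_points:
  fixes n1 n2 n3 e :: "real^3" and p q :: int
  assumes int: "n1 \<in> int_lattice" "e \<in> int_lattice" "n3 \<in> int_lattice"
    and w: "primitive (n1 \<times> e)" and q: "q > 0" and n2: "n2 = of_int p *\<^sub>R n1 + of_int q *\<^sub>R e"
    and nz: "n1 \<bullet> (n2 \<times> n3) \<noteq> 0"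
  shows "\<exists>m. m > 0 \<and> \<bar>n1 \<bullet> (n2 \<times> n3)\<bar> = of_int (q * m) \<and> finite (box_points n1 n2 n3) \<and>
    (\<forall>f :: real \<Rightarrow> real \<Rightarrow> real. (\<Sum>x\<in>box_points n1 n2 n3. f (n1 \<bullet> x) (n2 \<bullet> x))
      = of_int q * (\<Sum>a\<in>{0..<q * m}. \<Sum>b\<in>{b\<in>{0..<q * m}. q dvd b - p * a}. f (of_int a) (of_int b)))"
proof -
  define w where "w = n1 \<times> e"
  obtain z where z: "z \<in> int_lattice" "z \<bullet> w = 1" using w unfolding w_def by (rule primitive_obtain_dual)
  have wint: "w \<in> int_lattice" using int w_def by auto
  \<comment> \<open>\<open>n1\<close>, \<open>e\<close>, \<open>z\<close> is a unimodular basis, so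
    the integral vectors \<open>e \<times> z\<close>, \<open>z \<times> n1\<close>, \<open>w\<close>
    form its dual basis, and lattice points have integer coordinates in it; \<open>X\<close> and
    \<open>Y\<close> below translate between both.\<close>
  have unit: "n1 \<bullet> (e \<times> z) = 1" using z(2) triple_rotate[of z n1 e] unfolding w_def by simp
  obtain c where c: "n3 \<bullet> w = of_int c" using wint int by (meson Ints_cases inner_int_lattice)
  have cross: "n1 \<times> n2 = of_int q *\<^sub>R w" unfolding n2 w_def by (simp add: cross_add_right cross_mult_right)
  have det: "n1 \<bullet> (n2 \<times> n3) = of_int (q * c)"
    using cross c triple_rotate[of n3 n1 n2] by simp
  hence c0: "c \<noteq> 0" using nz by auto
  define m where "m = \<bar>c\<bar>"
  have m: "m > 0" using c0 m_def by simp
  have M: "\<bar>n1 \<bullet> (n2 \<times> n3)\<bar> = of_int (q * m)" using det q m_def by (simp add: abs_mult)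
  define X where "X = (\<lambda>((a, b), k). of_int a *\<^sub>R (e \<times> z) + of_int ((b - p * a) div q) *\<^sub>R (z \<times> n1) + of_int k *\<^sub>R w)"
  define Y where "Y = (\<lambda>x. ((\<lfloor>n1 \<bullet> x\<rfloor>, \<lfloor>n2 \<bullet> x\<rfloor>), \<lfloor>z \<bullet> x\<rfloor>))"
  obtain s1 where s1: "n3 \<bullet> (e \<times> z) = of_int s1" using int z by (meson Ints_cases inner_int_lattice cross3_int_lattice)
  obtain s2 where s2: "n3 \<bullet> (z \<times> n1) = of_int s2" using int z by (meson Ints_cases inner_int_lattice cross3_int_lattice)
  define r where "r a b = s1 * a + s2 * ((b - p * a) div q)" for a b
  define T where "T = Sigma {0..<q * m} (\<lambda>a. {b\<in>{0..<q * m}. q dvd b - p * a})"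
  define K where "K = (\<lambda>(a, b). {k. 0 \<le> r a b + k * c \<and> r a b + k * c < q * m})"
  have K: "finite (K ab)" "int (card (K ab)) = q" for ab
    using int_arith_progression_in_ivl[OF c0, of q] q unfolding K_def m_def by (auto split: prod.splits)
  have T: "finite T" unfolding T_def by (intro finite_SigmaI) (auto intro: finite_subset[of _ "{0..<q * m}"])
  have zX: "z \<bullet> (e \<times> z) = 0" "z \<bullet> (z \<times> n1) = 0" by (simp_all add: dot_cross_self)
  have n1X: "n1 \<bullet> (z \<times> n1) = 0" "n1 \<bullet> w = 0" "e \<bullet> (e \<times> z) = 0" "e \<bullet> w = 0" "e \<bullet> (z \<times> n1) = 1"
    using unit triple_rotate[of e z n1] by (simp_all add: dot_cross_self w_def)
  have inn: "n1 \<bullet> X ((a, b), k) = of_int a" "z \<bullet> X ((a, b), k) = of_int k"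
    "e \<bullet> X ((a, b), k) = of_int ((b - p * a) div q)"
    "n3 \<bullet> X ((a, b), k) = of_int (r a b + k * c)" for a b k
    by (simp_all add: X_def inner_add_right unit zX n1X z s1 s2 c r_def mult.commute)
  have n2e: "n2 \<bullet> x = of_int p * (n1 \<bullet> x) + of_int q * (e \<bullet> x)" for x
    by (simp add: n2 inner_add_left)
  have inn2: "n2 \<bullet> X ((a, b), k) = of_int b" if "q dvd b - p * a" for a b k
  proof -
    have "n2 \<bullet> X ((a, b), k) = of_int (p * a + q * ((b - p * a) div q))" by (simp add: n2e inn)
    also have "p * a + q * ((b - p * a) div q) = b" using that q by simp
    finally show ?thesis .
  qed
  have Xint: "X t \<in> int_lattice" for t
    using z int wint by (auto simp: X_def split: prod.splits)
  have XY: "X (Y x) = x" and Yin: "q dvd \<lfloor>n2 \<bullet> x\<rfloor> - p * \<lfloor>n1 \<bullet> x\<rfloor>" 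
    and fl: "of_int \<lfloor>n1 \<bullet> x\<rfloor> = n1 \<bullet> x" "of_int \<lfloor>n2 \<bullet> x\<rfloor> = n2 \<bullet> x" if x: "x \<in> int_lattice" for x
  proof -
    have fl': "of_int \<lfloor>y \<bullet> x\<rfloor> = y \<bullet> x" if "y \<in> int_lattice" for y
      using inner_int_lattice[OF that x] by (auto elim: Ints_cases)
    have n2int: "n2 \<in> int_lattice" using int by (auto simp: n2)
    show "of_int \<lfloor>n1 \<bullet> x\<rfloor> = n1 \<bullet> x" "of_int \<lfloor>n2 \<bullet> x\<rfloor> = n2 \<bullet> x"
      using fl'[OF int(1)] fl'[OF n2int] by (simp_all only:)
    have "real_of_int (\<lfloor>n2 \<bullet> x\<rfloor> - p * \<lfloor>n1 \<bullet> x\<rfloor>) = of_int (q * \<lfloor>e \<bullet> x\<rfloor>)"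
      by (simp only: of_int_diff of_int_mult fl'[OF n2int] fl'[OF int(1)] fl'[OF int(2)]) (simp add: n2e)
    hence eq: "\<lfloor>n2 \<bullet> x\<rfloor> - p * \<lfloor>n1 \<bullet> x\<rfloor> = q * \<lfloor>e \<bullet> x\<rfloor>" by (simp only: of_int_eq_iff)
    thus "q dvd \<lfloor>n2 \<bullet> x\<rfloor> - p * \<lfloor>n1 \<bullet> x\<rfloor>" by simp
    have "X (Y x) = (n1 \<bullet> x) *\<^sub>R (e \<times> z) + (e \<bullet> x) *\<^sub>R (z \<times> n1) + (z \<bullet> x) *\<^sub>R w"
      using q by (simp only: X_def Y_def prod.case eq fl'[OF int(1)] fl'[OF int(2)] fl'[OF z(1)]) (simp add: fl'[OF int(2)])
    also have "\<dots> = x" using triple_dual_expansion[of n1 e z x] unit w_def by simp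
    finally show "X (Y x) = x" .
  qed
  have YX: "Y (X ((a, b), k)) = ((a, b), k)" if "q dvd b - p * a" for a b k
    using that by (simp add: Y_def inn inn2)
  have bij: "bij_betw X (Sigma T K) (box_points n1 n2 n3)"
  proof (rule bij_betw_byWitness[of _ Y])
    show "\<forall>t\<in>Sigma T K. Y (X t) = t" using YX by (auto simp: T_def)
    show "\<forall>x\<in>box_points n1 n2 n3. X (Y x) = x" using XY by (auto simp: box_points_def)
    show "X ` Sigma T K \<subseteq> box_points n1 n2 n3"
    proof
      fix x assume "x \<in> X ` Sigma T K"
      then obtain a b k where x: "x = X ((a, b), k)" "(a, b) \<in> T" "k \<in> K (a, b)" by auto
      have "n1 \<bullet> x = of_int a" "n2 \<bullet> x = of_int b" "n3 \<bullet> x = of_int (r a b + k * c)"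
        using x inn inn2 by (auto simp: T_def)
      thus "x \<in> box_points n1 n2 n3"
        unfolding box_points_def M using x Xint by (auto simp: T_def K_def simp flip: of_int_mult of_int_add)
    qed
    show "Y ` box_points n1 n2 n3 \<subseteq> Sigma T K"
    proof
      fix t assume "t \<in> Y ` box_points n1 n2 n3"
      then obtain x where x: "x \<in> box_points n1 n2 n3" "t = Y x" by auto
      obtain a b k where t: "Y x = ((a, b), k)" by (metis surj_pair)
      have xi: "x \<in> int_lattice" using x by (auto simp: box_points_def)
      have xX: "x = X ((a, b), k)" using XY[OF xi] t by simp
      have ab: "q dvd b - p * a" using Yin[OF xi] t by (simp add: Y_def)
      have "n1 \<bullet> x = of_int a" "n2 \<bullet> x = of_int b" "n3 \<bullet> x = of_int (r a b + k * c)"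
        using inn inn2 ab xX by auto
      hence "0 \<le> a" "a < q * m" "0 \<le> b" "b < q * m" "0 \<le> r a b + k * c" "r a b + k * c < q * m"
        using x(1) unfolding box_points_def M by (simp_all only: mem_Collect_eq insert_iff ball_simps simp_thms of_int_less_iff of_int_0_le_iff)
      thus "t \<in> Sigma T K" using ab x t by (auto simp: T_def K_def)
    qed
  qed
  have fin: "finite (box_points n1 n2 n3)"
    using bij_betw_finite[OF bij] T K by auto
  have main: "(\<Sum>x\<in>box_points n1 n2 n3. f (n1 \<bullet> x) (n2 \<bullet> x))
      = of_int q * (\<Sum>a\<in>{0..<q * m}. \<Sum>b\<in>{b\<in>{0..<q * m}. q dvd b - p * a}. f (of_int a) (of_int b))"
    for f :: "real \<Rightarrow> real \<Rightarrow> real"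
  proof -
    have "(\<Sum>x\<in>box_points n1 n2 n3. f (n1 \<bullet> x) (n2 \<bullet> x)) = (\<Sum>t\<in>Sigma T K. f (n1 \<bullet> X t) (n2 \<bullet> X t))"
      by (rule sum.reindex_bij_betw[OF bij, symmetric])
    also have "\<dots> = (\<Sum>t\<in>Sigma T K. f (of_int (fst (fst t))) (of_int (snd (fst t))))"
      by (intro sum.cong refl) (auto simp: T_def inn inn2)
    also have "\<dots> = (\<Sum>ab\<in>T. \<Sum>k\<in>K ab. f (of_int (fst ab)) (of_int (snd ab)))"
      using T K by (subst sum.Sigma) (auto simp: case_prod_unfold)
    also have "\<dots> = (\<Sum>ab\<in>T. of_int q * f (of_int (fst ab)) (of_int (snd ab)))"
      by (intro sum.cong refl) (metis K(2) of_int_of_nat_eq sum_constant)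
    also have "\<dots> = of_int q * (\<Sum>(a, b)\<in>T. f (of_int a) (of_int b))"
      by (simp add: sum_distrib_left case_prod_unfold)
    also have "(\<Sum>(a, b)\<in>T. f (of_int a) (of_int b))
        = (\<Sum>a\<in>{0..<q * m}. \<Sum>b\<in>{b\<in>{0..<q * m}. q dvd b - p * a}. f (of_int a) (of_int b))"
      unfolding T_def by (subst sum.Sigma) (auto intro: finite_subset[of _ "{0..<q * m}"])
    finally show ?thesis .
  qed
  show ?thesis using m M fin main by (intro exI[of _ m] conjI allI)
qed

text \<open>A residue class modulo \<open>q\<close> has \<open>m\<close> members, which turns the
  first sum into \<open>M\<close> times a complete sum with modulus \<open>M\<close>. In the
  product, the multiplication formula collapses first the sum over \<open>b\<close> and then, inside
  each residue class, the sum over \<open>a\<close>; the modulus drops from \<open>q * m\<close> to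
  \<open>q\<close>.\<close>

lemma box_points_bern_sums:
  fixes n1 n2 n3 e :: "real^3" and p q :: int
  assumes int: "n1 \<in> int_lattice" "e \<in> int_lattice" "n3 \<in> int_lattice"
    and w: "primitive (n1 \<times> e)" and q: "q > 0" and n2: "n2 = of_int p *\<^sub>R n1 + of_int q *\<^sub>R e"
    and nz: "n1 \<bullet> (n2 \<times> n3) \<noteq> 0"
  defines "M \<equiv> \<bar>n1 \<bullet> (n2 \<times> n3)\<bar>"
  shows "(\<Sum>x\<in>box_points n1 n2 n3. bern2 ((n1 \<bullet> x) / M)) = 1/6"
    and "coprime p q \<Longrightarrow> (\<Sum>x\<in>box_points n1 n2 n3. bern1 ((n1 \<bullet> x) / M) * bern1 ((n2 \<bullet> x) / M))
      = of_int q * (dedekind_sum p q + 1/4)"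
proof -
  obtain m where m: "m > 0" "\<bar>n1 \<bullet> (n2 \<times> n3)\<bar> = of_int (q * m)"
    "\<forall>f :: real \<Rightarrow> real \<Rightarrow> real. (\<Sum>x\<in>box_points n1 n2 n3. f (n1 \<bullet> x) (n2 \<bullet> x))
      = of_int q * (\<Sum>a\<in>{0..<q * m}. \<Sum>b\<in>{b\<in>{0..<q * m}. q dvd b - p * a}. f (of_int a) (of_int b))"
    using sum_box_points[OF int w q n2 nz] by (elim exE conjE)
  have M: "M = of_int (q * m)" using m M_def by simp
  have "(\<Sum>x\<in>box_points n1 n2 n3. bern2 ((n1 \<bullet> x) / M))
     = of_int q * (\<Sum>a\<in>{0..<q * m}. \<Sum>b\<in>{b\<in>{0..<q * m}. q dvd b - p * a}. bern2 (of_int a / M))"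
    by (rule m(3)[rule_format, of "\<lambda>u v. bern2 (u / M)"])
  also have "\<dots> = of_int q * (\<Sum>a\<in>{0..<q * m}. of_int m * bern2 (of_int a / M))"
    using m by (simp only: sum_int_residue_class[OF q]) simp
  also have "\<dots> = M * (\<Sum>a\<in>{0..<q * m}. bern2 (of_int a / of_int (q * m)))"
    by (simp add: sum_distrib_left M mult.assoc)
  also have "\<dots> = 1/6" using bern2_sum[of "q * m"] m q by (simp add: M)
  finally show "(\<Sum>x\<in>box_points n1 n2 n3. bern2 ((n1 \<bullet> x) / M)) = 1/6" .
  assume cop: "coprime p q"
  have "(\<Sum>x\<in>box_points n1 n2 n3. bern1 ((n1 \<bullet> x) / M) * bern1 ((n2 \<bullet> x) / M))
    = of_int q * (\<Sum>a\<in>{0..<q * m}. \<Sum>b\<in>{b\<in>{0..<q * m}. q dvd b - p * a}. bern1 (of_int a / M) * bern1 (of_int b / M))"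
    by (rule m(3)[rule_format, of "\<lambda>u v. bern1 (u / M) * bern1 (v / M)"])
  also have "(\<Sum>a\<in>{0..<q * m}. \<Sum>b\<in>{b\<in>{0..<q * m}. q dvd b - p * a}. bern1 (of_int a / M) * bern1 (of_int b / M))
    = (\<Sum>a\<in>{0..<q * m}. bern1 (of_int a / M) * bern1 (of_int (p * a mod q) / of_int q))"
    using bern1_multiplication[OF q m(1)]
    by (simp only: sum_int_residue_class[OF q] M flip: sum_distrib_left)
  also have "\<dots> = (\<Sum>i\<in>{0..<q}. \<Sum>t\<in>{0..<m}. bern1 (of_int (i + q * t) / M) * bern1 (of_int (p * (i + q * t) mod q) / of_int q))"
    by (rule sum_int_div_mod[OF q])
  also have "\<dots> = (\<Sum>i\<in>{0..<q}. \<Sum>t\<in>{0..<m}. bern1 (of_int (i + q * t) / M) * bern1 (of_int (p * i mod q) / of_int q))"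
  proof (intro sum.cong refl)
    fix i t
    have "p * (i + q * t) mod q = (p * i + q * (p * t)) mod q" by (simp add: algebra_simps)
    hence "p * (i + q * t) mod q = p * i mod q" by simp
    thus "bern1 (of_int (i + q * t) / M) * bern1 (of_int (p * (i + q * t) mod q) / of_int q)
      = bern1 (of_int (i + q * t) / M) * bern1 (of_int (p * i mod q) / of_int q)" by simp
  qed
  also have "\<dots> = (\<Sum>i\<in>{0..<q}. bern1 (of_int i / of_int q) * bern1 (of_int (p * i mod q) / of_int q))"
    using bern1_multiplication[OF q m(1)] by (simp only: M flip: sum_distrib_right)
  also have "\<dots> = dedekind_sum p q + 1/4" by (rule dedekind_sum_eq_bern1[OF q cop])
  finally show "(\<Sum>x\<in>box_points n1 n2 n3. bern1 ((n1 \<bullet> x) / M) * bern1 ((n2 \<bullet> x) / M))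
      = of_int q * (dedekind_sum p q + 1/4)" .
qed

section \<open>Bases of plane lattices\<close>

lemma cross3_eq_0_obtain:
  fixes x y :: "real^3"
  assumes "x \<times> y = 0" "x \<noteq> 0"
  obtains c where "y = c *\<^sub>R x"
  using assms that unfolding cross_eq_0 collinear_lemma by (metis scaleR_zero_left)

lemma plane_lattice_eq:
  assumes "v \<times> w \<noteq> 0"
  shows "plane_lattice v w = {x \<in> int_lattice. x \<bullet> (v \<times> w) = 0}"
proof -
  have "span {v, w} = {x. x \<bullet> (v \<times> w) = 0}"
  proof (intro subset_antisym subsetI)
    fix x assume "x \<in> span {v, w}"
    hence "(v \<times> w) \<bullet> x = 0"
      by (rule span_induct) (auto simp: subspace_hyperplane[of "v \<times> w"] dot_cross_self)
    thus "x \<in> {x. x \<bullet> (v \<times> w) = 0}" by (simp add: inner_commute)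
  next
    fix x assume "x \<in> {x. x \<bullet> (v \<times> w) = 0}"
    hence x: "x \<bullet> (v \<times> w) = 0" by simp
    \<comment> \<open>The determinant of \<open>v\<close>, \<open>w\<close>,
      \<open>v \<times> w\<close>, which is the squared norm of \<open>v \<times> w\<close>.\<close>
    define c where "c = v \<bullet> (w \<times> (v \<times> w))"
    have c: "c = (v \<times> w) \<bullet> (v \<times> w)" unfolding c_def using triple_rotate(2)[of "v \<times> w" v w] by simp
    hence c0: "c \<noteq> 0" using assms by simp
    have "c *\<^sub>R x = (x \<bullet> (w \<times> (v \<times> w))) *\<^sub>R v + (x \<bullet> ((v \<times> w) \<times> v)) *\<^sub>R w"
      using triple_expansion[of v w "v \<times> w" x] x c_def by simp
    also have "\<dots> \<in> span {v, w}" by (intro span_add span_scale span_base) auto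
    finally have "(1 / c) *\<^sub>R (c *\<^sub>R x) \<in> span {v, w}" by (rule span_scale)
    thus "x \<in> span {v, w}" using c0 by simp
  qed
  thus ?thesis by (auto simp: plane_lattice_def)
qed

lemma int_span_memI: "of_int a *\<^sub>R v + of_int b *\<^sub>R w \<in> int_span v w"
  by (auto simp: int_span_def)

lemma int_span_memE:
  assumes "x \<in> int_span v w"
  obtains a b :: int where "x = of_int a *\<^sub>R v + of_int b *\<^sub>R w"
  using assms by (auto simp: int_span_def)

lemma int_span_cross_multiple:
  assumes "x \<in> int_span v w" "y \<in> int_span v w"
  obtains k :: int where "x \<times> y = of_int k *\<^sub>R (v \<times> w)"
proof -
  obtain a b where x: "x = of_int a *\<^sub>R v + of_int b *\<^sub>R w" using assms(1) by (rule int_span_memE)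
  obtain c d where y: "y = of_int c *\<^sub>R v + of_int d *\<^sub>R w" using assms(2) by (rule int_span_memE)
  have "x \<times> y = of_int (a * d - b * c) *\<^sub>R (v \<times> w)"
    unfolding x y using cross_skew[of w v]
    by (simp add: cross_add_left cross_add_right cross_mult_left cross_mult_right algebra_simps)
  thus ?thesis by (rule that)
qed

lemma cross3_axis_axis:
  fixes w :: "real^3"
  shows "(axis 1 1 \<times> w) \<times> (axis 2 1 \<times> w) = (w $ 3) *\<^sub>R w"
    and "(axis 2 1 \<times> w) \<times> (axis 3 1 \<times> w) = (w $ 1) *\<^sub>R w"
    and "(axis 3 1 \<times> w) \<times> (axis 1 1 \<times> w) = (w $ 2) *\<^sub>R w"
  by (simp_all add: cross3_def axis_def vec_eq_iff forall_3 algebra_simps)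

text \<open>
  If \<open>e1 \<times> e2 = k w\<close> with \<open>w\<close> primitive, then \<open>k\<close> divides every coordinate of \<open>w\<close>, because the products
  of the vectors \<open>axis i 1 \<times> w\<close> of the plane lattice are the multiples of \<open>w\<close> by its coordinates.
\<close>

lemma primitive_cross_if_int_span_eq_plane_lattice:
  assumes span: "int_span e1 e2 = {x \<in> int_lattice. x \<bullet> (e1 \<times> e2) = 0}" and nz: "e1 \<times> e2 \<noteq> 0"
  shows "primitive (e1 \<times> e2)"
proof -
  have "of_int 1 *\<^sub>R e1 + of_int 0 *\<^sub>R e2 \<in> int_span e1 e2" "of_int 0 *\<^sub>R e1 + of_int 1 *\<^sub>R e2 \<in> int_span e1 e2"
    by (rule int_span_memI)+
  hence int: "e1 \<in> int_lattice" "e2 \<in> int_lattice" unfolding span by auto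
  obtain k :: int and w where k: "k > 0" "primitive w" "e1 \<times> e2 = of_int k *\<^sub>R w"
    using int_lattice_obtain_primitive[OF cross3_int_lattice[OF int] nz] by metis
  have ax: "axis i 1 \<times> w \<in> int_span e1 e2" for i
    unfolding span using k by (auto simp: dot_cross_self)
  have comp: "w $ i / of_int k \<in> \<int>" for i
  proof -
    obtain a b where ab: "(axis a 1 \<times> w) \<times> (axis b 1 \<times> w) = (w $ i) *\<^sub>R w"
      using cross3_axis_axis exhaust_3[of i] by metis
    obtain l :: int where "(w $ i) *\<^sub>R w = of_int l *\<^sub>R (e1 \<times> e2)"
      using int_span_cross_multiple[OF ax ax] ab by metis
    hence "w $ i = of_int l * of_int k" using k primitive_nonzero[OF k(2)] by simp
    thus ?thesis using k by simp
  qed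
  have "(1 / of_int k) *\<^sub>R w \<in> int_lattice" unfolding int_lattice_def using comp by simp
  hence "1 / real_of_int k \<in> \<int>" using primitive_multiple_Ints k by blast
  then obtain l :: int where "1 / real_of_int k = of_int l" by (auto elim: Ints_cases)
  hence "real_of_int (l * k) = 1" using k by (simp add: field_simps)
  hence "l * k = 1" by (metis of_int_eq_1_iff)
  hence "k = 1" using k zmult_eq_1_iff by auto
  thus ?thesis using k by simp
qed

text \<open>The data of \<open>edge_s\<close> with \<open>e1 = v\<close>. That \<open>v\<close> and
  \<open>e\<close> form a basis of the plane lattice is encoded by the primitivity of their cross
  product, the form in which the lattice point sums use it; \<open>normal_basis_iff\<close> gives
  the equivalence.\<close>

definition normal_basis :: "real^3 \<Rightarrow> real^3 \<Rightarrow> real^3 \<Rightarrow> int \<Rightarrow> int \<Rightarrow> bool" where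
  "normal_basis v w e p q \<longleftrightarrow> e \<in> int_lattice \<and> primitive (v \<times> e) \<and>
     w = of_int p *\<^sub>R v + of_int q *\<^sub>R e \<and> 0 \<le> p \<and> p < q"

lemma normal_basis_cross:
  assumes "normal_basis v w e p q" shows "v \<times> w = of_int q *\<^sub>R (v \<times> e)" "v \<times> w \<noteq> 0"
proof -
  show *: "v \<times> w = of_int q *\<^sub>R (v \<times> e)"
    using assms by (simp add: normal_basis_def cross_add_right cross_mult_right)
  have "q \<noteq> 0" "v \<times> e \<noteq> 0" using assms primitive_nonzero by (auto simp: normal_basis_def)
  thus "v \<times> w \<noteq> 0" unfolding * by simp
qed

text \<open>A dual vector of \<open>w\<close> yields a Bezout identity for \<open>p\<close> and
  \<open>q\<close>.\<close>

lemma normal_basis_coprime: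
  assumes "normal_basis v w e p q" "primitive w" "v \<in> int_lattice" shows "coprime p q"
proof -
  obtain z where z: "z \<in> int_lattice" "z \<bullet> w = 1" using assms(2) by (rule primitive_obtain_dual)
  obtain a b where "z \<bullet> v = of_int a" "z \<bullet> e = of_int b"
    using z assms unfolding normal_basis_def by (meson Ints_cases inner_int_lattice)
  hence "of_int (p * a + q * b) = (1 :: real)"
    using z assms(1) by (simp add: normal_basis_def inner_add_right)
  hence "p * a + q * b = 1" by (metis of_int_eq_1_iff)
  thus ?thesis by (metis coprime_iff_gcd_eq_1 dvd_add dvd_mult2 gcd_dvd1 gcd_dvd2 is_unit_gcd_iff)
qed

text \<open>For \<open>x\<close> in the plane, \<open>v \<times> x\<close> is a multiple of
  \<open>v \<times> e\<close>, with an integer factor because the latter is primitive. Subtracting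
  that multiple of \<open>e\<close> from \<open>x\<close> leaves a multiple of \<open>v\<close>,
  again with an integer factor.\<close>

lemma normal_basis_plane_lattice:
  assumes nb: "normal_basis v w e p q" and v: "primitive v"
  shows "plane_lattice v w = int_span v e"
    and "x \<in> plane_lattice v w \<Longrightarrow> \<exists>a b. x = of_int a *\<^sub>R v + of_int b *\<^sub>R e"
proof -
  define u where "u = v \<times> e"
  have e: "e \<in> int_lattice" and u: "primitive u" and q: "q > 0" using nb by (auto simp: normal_basis_def u_def)
  have pl: "plane_lattice v w = {x \<in> int_lattice. x \<bullet> u = 0}"
    using plane_lattice_eq[OF normal_basis_cross(2)[OF nb]] normal_basis_cross(1)[OF nb] q by (simp add: u_def)
  show ex: "\<exists>a b. x = of_int a *\<^sub>R v + of_int b *\<^sub>R e" if "x \<in> plane_lattice v w" for x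
  proof -
    have x: "x \<in> int_lattice" "x \<bullet> u = 0" using that pl by auto
    have "u \<times> (v \<times> x) = 0" using x unfolding Lagrange
      by (simp add: inner_commute u_def dot_cross_self)
    then obtain c where c: "v \<times> x = c *\<^sub>R u" using cross3_eq_0_obtain primitive_nonzero[OF u] by metis
    have "c \<in> \<int>" by (rule primitive_multiple_Ints[OF u]) (use c x v in \<open>auto simp flip: c\<close>)
    then obtain b where b: "c = of_int b" by (auto elim: Ints_cases)
    have "v \<times> (x - c *\<^sub>R e) = 0" using c u_def by (simp add: Cross3.right_diff_distrib cross_mult_right)
    then obtain d where d: "x - c *\<^sub>R e = d *\<^sub>R v" using cross3_eq_0_obtain primitive_nonzero[OF v] by metis
    have "d \<in> \<int>" by (rule primitive_multiple_Ints[OF v]) (use x e b in \<open>auto simp flip: d\<close>)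
    then obtain a where a: "d = of_int a" by (auto elim: Ints_cases)
    have "x = of_int a *\<^sub>R v + of_int b *\<^sub>R e" using d a b by (simp add: algebra_simps)
    thus ?thesis by blast
  qed
  show "plane_lattice v w = int_span v e"
  proof (intro subset_antisym subsetI)
    fix x assume "x \<in> plane_lattice v w"
    thus "x \<in> int_span v e" using ex[of x] by (auto simp: int_span_def)
  next
    fix x assume "x \<in> int_span v e"
    then obtain a b where "x = of_int a *\<^sub>R v + of_int b *\<^sub>R e" by (rule int_span_memE)
    thus "x \<in> plane_lattice v w" using v e by (auto simp: pl u_def inner_add_left dot_cross_self)
  qed
qed

lemma normal_basis_exists:
  assumes v: "primitive v" and w: "w \<in> int_lattice" and nz: "v \<times> w \<noteq> 0"
  obtains e p q where "normal_basis v w e p q"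
proof -
  obtain m :: int and u where m: "m > 0" "primitive u" "v \<times> w = of_int m *\<^sub>R u"
    using int_lattice_obtain_primitive[OF cross3_int_lattice[OF primitive_int_lattice[OF v] w] nz] by metis
  obtain y where y: "y \<in> int_lattice" "y \<bullet> v = 1" using v by (rule primitive_obtain_dual)
  have vu: "v \<bullet> u = 0"
    using m dot_cross_self(1)[of v w] by simp
  \<comment> \<open>By Lagrange's formula \<open>v \<times> (u \<times> y)\<close> is
    \<open>(v \<bullet> y) *\<^sub>R u - (v \<bullet> u) *\<^sub>R y\<close>, and this is
    \<open>u\<close>.\<close>
  define e where "e = u \<times> y"
  have e: "v \<times> e = u" "e \<in> int_lattice"
    using y vu m unfolding e_def Lagrange by (simp_all add: inner_commute)
  have "v \<times> (w - of_int m *\<^sub>R e) = 0"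
    using m e by (simp add: Cross3.right_diff_distrib cross_mult_right)
  then obtain d where d: "w - of_int m *\<^sub>R e = d *\<^sub>R v" using cross3_eq_0_obtain primitive_nonzero[OF v] by metis
  have "d \<in> \<int>" by (rule primitive_multiple_Ints[OF v]) (use w e in \<open>auto simp flip: d\<close>)
  then obtain a where a: "d = of_int a" by (auto elim: Ints_cases)
  \<comment> \<open>Adding a multiple of \<open>v\<close> does not change the product with
    \<open>v\<close> and moves the coefficient of \<open>v\<close> into the range from 0 to
    \<open>m - 1\<close>.\<close>
  define f where "f = e + of_int (a div m) *\<^sub>R v"
  have "w = of_int a *\<^sub>R v + of_int m *\<^sub>R e" using d a by (simp add: algebra_simps)
  also have "a = a mod m + m * (a div m)" by simp
  also have "of_int (a mod m + m * (a div m)) *\<^sub>R v + of_int m *\<^sub>R e = of_int (a mod m) *\<^sub>R v + of_int m *\<^sub>R f"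
    by (simp only: f_def of_int_add of_int_mult) (simp add: algebra_simps)
  finally have "w = of_int (a mod m) *\<^sub>R v + of_int m *\<^sub>R f" .
  moreover have "v \<times> f = u" using e by (simp add: f_def cross_add_right cross_mult_right)
  ultimately have "normal_basis v w f (a mod m) m"
    using m e v by (auto simp: normal_basis_def f_def)
  thus ?thesis by (rule that)
qed

text \<open>The coefficient of \<open>e\<close> modulo \<open>q\<close> separates the cosets, since
  \<open>v\<close> does not affect it and \<open>w\<close> contributes multiples of
  \<open>q\<close>.\<close>

lemma lattice_index_eq:
  assumes nb: "normal_basis v w e p q" and v: "primitive v"
  shows "int (lattice_index v w) = q"
proof -
  define L where "L = plane_lattice v w"
  have q: "q > 0" and e: "e \<in> int_lattice" and u: "primitive (v \<times> e)" and w: "w = of_int p *\<^sub>R v + of_int q *\<^sub>R e"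
    using nb by (auto simp: normal_basis_def)
  obtain z where z: "z \<bullet> (v \<times> e) = 1" using u by (rule primitive_obtain_dual)
  \<comment> \<open>\<open>z \<bullet> (v \<times> x)\<close> is the coefficient of \<open>e\<close>
    in \<open>x\<close>.\<close>
  define f where "f x = \<lfloor>z \<bullet> (v \<times> x)\<rfloor> mod q" for x
  have f: "f (of_int a *\<^sub>R v + of_int b *\<^sub>R e) = b mod q" for a b :: int
    using z by (simp add: f_def cross_add_right cross_mult_right)
  have L: "x \<in> L \<longleftrightarrow> (\<exists>a b. x = of_int a *\<^sub>R v + of_int b *\<^sub>R e)" for x
    unfolding L_def normal_basis_plane_lattice(1)[OF nb v] int_span_def by auto
  have S: "x - y \<in> int_span v w \<longleftrightarrow> f x = f y" if xL: "x \<in> L" and yL: "y \<in> L" for x y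
  proof -
    obtain a b :: int where x: "x = of_int a *\<^sub>R v + of_int b *\<^sub>R e" using xL L by blast
    obtain c d :: int where y: "y = of_int c *\<^sub>R v + of_int d *\<^sub>R e" using yL L by blast
    have "f x = f y \<longleftrightarrow> q dvd b - d" unfolding x y f by (simp add: mod_eq_dvd_iff)
    also have "\<dots> \<longleftrightarrow> x - y \<in> int_span v w"
    proof
      assume "q dvd b - d"
      then obtain t where t: "b - d = q * t" by auto
      have "x - y = of_int (a - c) *\<^sub>R v + of_int (b - d) *\<^sub>R e" unfolding x y by (simp add: algebra_simps)
      also have "\<dots> = of_int (a - c - t * p) *\<^sub>R v + of_int t *\<^sub>R w"
        unfolding t w by (simp add: algebra_simps)
      finally show "x - y \<in> int_span v w" using int_span_memI by metis
    next
      assume "x - y \<in> int_span v w"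
      then obtain s t where "x - y = of_int s *\<^sub>R v + of_int t *\<^sub>R w" by (rule int_span_memE)
      hence "of_int (a - c) *\<^sub>R v + of_int (b - d) *\<^sub>R e = of_int (s + t * p) *\<^sub>R v + of_int (t * q) *\<^sub>R e"
        unfolding x y w by (simp add: algebra_simps)
      hence "z \<bullet> (v \<times> (of_int (a - c) *\<^sub>R v + of_int (b - d) *\<^sub>R e))
         = z \<bullet> (v \<times> (of_int (s + t * p) *\<^sub>R v + of_int (t * q) *\<^sub>R e))" by (simp only:)
      hence "real_of_int (b - d) = of_int (t * q)"
        using z by (simp add: cross_add_right cross_mult_right)
      hence "b - d = t * q" by (simp only: of_int_eq_iff)
      thus "q dvd b - d" by simp
    qed
    finally show ?thesis by simp
  qed
  define R where "R = {(x, y). x \<in> L \<and> y \<in> L \<and> x - y \<in> int_span v w}"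
  have R: "R = {(x, y). x \<in> L \<and> y \<in> L \<and> f x = f y}" unfolding R_def using S by auto
  have "bij_betw (\<lambda>j. {x \<in> L. f x = j}) {0..<q} (L // R)"
  proof (rule bij_betw_imageI)
    have rep: "of_int j *\<^sub>R e \<in> L" "f (of_int j *\<^sub>R e) = j" if "j \<in> {0..<q}" for j
      using that f[of 0 j] L[of "of_int j *\<^sub>R e"] by (auto intro: exI[of _ "0::int"])
    show "inj_on (\<lambda>j. {x \<in> L. f x = j}) {0..<q}"
    proof (rule inj_onI)
      fix j k assume jk: "j \<in> {0..<q}" "k \<in> {0..<q}" "{x \<in> L. f x = j} = {x \<in> L. f x = k}"
      have "of_int j *\<^sub>R e \<in> {x \<in> L. f x = j}" using rep[OF jk(1)] by simp
      hence "f (of_int j *\<^sub>R e) = k" unfolding jk(3) by simp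
      thus "j = k" using rep(2)[OF jk(1)] by simp
    qed
    show "(\<lambda>j. {x \<in> L. f x = j}) ` {0..<q} = L // R"
    proof (intro subset_antisym subsetI)
      fix A assume "A \<in> (\<lambda>j. {x \<in> L. f x = j}) ` {0..<q}"
      then obtain j where j: "j \<in> {0..<q}" "A = {x \<in> L. f x = j}" by auto
      have "A = R `` {of_int j *\<^sub>R e}" using rep[OF j(1)] j(2) by (auto simp: R)
      thus "A \<in> L // R" using rep[OF j(1)] by (auto simp: quotient_def)
    next
      fix A assume "A \<in> L // R"
      then obtain x where x: "x \<in> L" "A = R `` {x}" by (auto simp: quotient_def)
      hence "A = {y \<in> L. f y = f x}" by (auto simp: R)
      moreover have "f x \<in> {0..<q}" using q by (simp add: f_def)
      ultimately show "A \<in> (\<lambda>j. {x \<in> L. f x = j}) ` {0..<q}" by blast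
    qed
  qed
  hence "card (L // R) = card {0..<q}" by (rule bij_betw_same_card[symmetric])
  thus ?thesis using q unfolding lattice_index_def L_def R_def by simp
qed

lemma normal_basis_iff:
  assumes v: "primitive v" and nz: "v \<times> w \<noteq> 0"
  shows "normal_basis v w e p q \<longleftrightarrow>
    independent {v, e} \<and> v \<noteq> e \<and> int_span v e = plane_lattice v w \<and>
    w = of_int p *\<^sub>R v + of_int q *\<^sub>R e \<and> 0 \<le> p \<and> p < q"
proof
  assume nb: "normal_basis v w e p q"
  have ve: "v \<times> e \<noteq> 0" using nb primitive_nonzero by (auto simp: normal_basis_def)
  hence e0: "e \<noteq> 0" "v \<noteq> e" by auto
  have "v \<notin> span {e}"
    using ve by (auto simp: span_singleton cross_mult_left)
  hence "independent {v, e}" using e0 by (simp add: independent_insert)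
  thus "independent {v, e} \<and> v \<noteq> e \<and> int_span v e = plane_lattice v w \<and>
    w = of_int p *\<^sub>R v + of_int q *\<^sub>R e \<and> 0 \<le> p \<and> p < q"
    using nb e0 normal_basis_plane_lattice(1)[OF nb v] unfolding normal_basis_def by blast
next
  assume R: "independent {v, e} \<and> v \<noteq> e \<and> int_span v e = plane_lattice v w \<and>
    w = of_int p *\<^sub>R v + of_int q *\<^sub>R e \<and> 0 \<le> p \<and> p < q"
  hence wE: "w = of_int p *\<^sub>R v + of_int q *\<^sub>R e" and q: "q \<noteq> 0"
    and pl: "int_span v e = plane_lattice v w" and pq: "0 \<le> p" "p < q" by auto
  have cr: "v \<times> w = of_int q *\<^sub>R (v \<times> e)" unfolding wE by (simp add: cross_add_right cross_mult_right)
  hence ve: "v \<times> e \<noteq> 0" using nz by auto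
  have sp: "int_span v e = {x \<in> int_lattice. x \<bullet> (v \<times> e) = 0}"
    unfolding pl plane_lattice_eq[OF nz] cr using q by simp
  have "of_int 0 *\<^sub>R v + of_int 1 *\<^sub>R e \<in> int_span v e" by (rule int_span_memI)
  hence "e \<in> int_lattice" unfolding sp by simp
  thus "normal_basis v w e p q"
    using primitive_cross_if_int_span_eq_plane_lattice[OF sp ve] wE pq
    unfolding normal_basis_def by blast
qed

lemma lattice_index_commute: "lattice_index v w = lattice_index w v"
proof -
  have "int_span v w = int_span w v" by (auto simp: int_span_def) (metis add.commute)+
  moreover have "plane_lattice v w = plane_lattice w v" by (simp add: plane_lattice_def insert_commute)
  ultimately show ?thesis by (simp add: lattice_index_def)
qed

section \<open>Asymptotic expansions and geometric series\<close>

text \<open>\<open>expansion f a b c d\<close> means \<open>f t = a + b t + c t\<^sup>2 + d t\<^sup>3 + o(t\<^sup>3)\<close> for \<open>t \<rightarrow> 0+\<close>.\<close>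

definition expansion :: "(real \<Rightarrow> real) \<Rightarrow> real \<Rightarrow> real \<Rightarrow> real \<Rightarrow> real \<Rightarrow> bool" where
  "expansion f a b c d \<longleftrightarrow> ((\<lambda>t. (f t - (a + b * t + c * t\<^sup>2 + d * t ^ 3)) / t ^ 3) \<longlongrightarrow> 0) (at_right 0)"

lemma expansion_eqI:
  assumes "expansion f a b c d" "a = a'" "b = b'" "c = c'" "d = d'"
  shows "expansion f a' b' c' d'"
  using assms by simp

lemma expansion_const: "expansion (\<lambda>_. a) a 0 0 0"
  by (simp add: expansion_def)

text \<open>The hypothesis is a two-sided limit because \<open>X\<close> may have either sign,
  although \<open>t\<close> tends to 0 from the right.\<close>

lemma expansion_rescale:
  assumes h: "((\<lambda>x. (h x - (a + b * x + c * x\<^sup>2 + d * x ^ 3)) / x ^ 3) \<longlongrightarrow> 0) (at 0)" and X: "X \<noteq> 0"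
  shows "expansion (\<lambda>t. h (t * X)) a (b * X) (c * X\<^sup>2) (d * X ^ 3)"
proof -
  have "filterlim (\<lambda>t. t * X) (at 0) (at_right 0)"
    unfolding filterlim_at using X
    by (auto intro!: tendsto_eq_intros simp: eventually_at_filter)
  from filterlim_compose[OF h this]
  have "((\<lambda>t. X ^ 3 * ((h (t * X) - (a + b * (t * X) + c * (t * X)\<^sup>2 + d * (t * X) ^ 3)) / (t * X) ^ 3))
    \<longlongrightarrow> X ^ 3 * 0) (at_right 0)" by (intro tendsto_intros)
  thus ?thesis using X unfolding expansion_def by (simp add: power_mult_distrib mult_ac)
qed

lemma expansion_exp: "expansion (\<lambda>t. exp (t * c)) 1 c (c\<^sup>2 / 2) (c ^ 3 / 6)"
proof (cases "c = 0")
  case False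
  have "((\<lambda>x::real. (exp x - (1 + 1 * x + 1/2 * x\<^sup>2 + 1/6 * x ^ 3)) / x ^ 3) \<longlongrightarrow> 0) (at 0)"
    by real_asymp
  from expansion_rescale[OF this False] show ?thesis by simp
qed (simp add: expansion_const)

lemma expansion_add:
  assumes "expansion f a b c d" "expansion g a' b' c' d'"
  shows "expansion (\<lambda>t. f t + g t) (a + a') (b + b') (c + c') (d + d')"
proof -
  have "((\<lambda>t. (f t - (a + b * t + c * t\<^sup>2 + d * t ^ 3)) / t ^ 3 +
    (g t - (a' + b' * t + c' * t\<^sup>2 + d' * t ^ 3)) / t ^ 3) \<longlongrightarrow> 0 + 0) (at_right 0)"
    using assms unfolding expansion_def by (rule tendsto_add)
  moreover have "(f t - (a + b * t + c * t\<^sup>2 + d * t ^ 3)) / t ^ 3 +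
    (g t - (a' + b' * t + c' * t\<^sup>2 + d' * t ^ 3)) / t ^ 3 =
    (f t + g t - ((a + a') + (b + b') * t + (c + c') * t\<^sup>2 + (d + d') * t ^ 3)) / t ^ 3" for t
    by (simp add: algebra_simps flip: add_divide_distrib)
  ultimately show ?thesis unfolding expansion_def by simp
qed

lemma expansion_sum:
  assumes "\<And>i. i \<in> A \<Longrightarrow> expansion (f i) (a i) (b i) (c i) (d i)"
  shows "expansion (\<lambda>t. \<Sum>i\<in>A. f i t) (\<Sum>i\<in>A. a i) (\<Sum>i\<in>A. b i) (\<Sum>i\<in>A. c i) (\<Sum>i\<in>A. d i)"
  using assms
proof (induction A rule: infinite_finite_induct)
  case (insert x A)
  thus ?case using expansion_add[of "f x"] by simp
qed (simp_all add: expansion_const)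

lemma expansion_mult:
  assumes f: "expansion f a b c d" and g: "expansion g a' b' c' d'"
  shows "expansion (\<lambda>t. f t * g t) (a * a') (a * b' + b * a') (a * c' + b * b' + c * a')
    (a * d' + b * c' + c * b' + d * a')"
proof -
  define P where "P t = a + b * t + c * t\<^sup>2 + d * t ^ 3" for t
  define Q where "Q t = a' + b' * t + c' * t\<^sup>2 + d' * t ^ 3" for t
  define u where "u t = (f t - P t) / t ^ 3" for t
  define v where "v t = (g t - Q t) / t ^ 3" for t
  define R where "R t = a * a' + (a * b' + b * a') * t + (a * c' + b * b' + c * a') * t\<^sup>2 +
    (a * d' + b * c' + c * b' + d * a') * t ^ 3" for t
  define S where "S t = (b * d' + c * c' + d * b') + (c * d' + d * c') * t + d * d' * t\<^sup>2" for t
  have u: "(u \<longlongrightarrow> 0) (at_right 0)" and v: "(v \<longlongrightarrow> 0) (at_right 0)"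
    using f g unfolding expansion_def u_def v_def P_def Q_def by auto
  have eq: "(f t * g t - R t) / t ^ 3 = t * S t + u t * Q t + v t * P t + t ^ 3 * u t * v t"
    if "t > 0" for t
  proof -
    have ft: "f t = P t + t ^ 3 * u t" and gt: "g t = Q t + t ^ 3 * v t"
      using that by (simp_all add: u_def v_def)
    have "f t * g t - R t = t ^ 3 * (t * S t + u t * Q t + v t * P t + t ^ 3 * u t * v t)"
      unfolding ft gt unfolding P_def Q_def R_def S_def by (simp add: power2_eq_square power3_eq_cube algebra_simps)
    thus ?thesis using that by simp
  qed
  have "(P \<longlongrightarrow> P 0) (at_right 0)" "(Q \<longlongrightarrow> Q 0) (at_right 0)" "(S \<longlongrightarrow> S 0) (at_right 0)"
    unfolding P_def Q_def S_def by (auto intro!: tendsto_eq_intros)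
  hence "((\<lambda>t. t * S t + u t * Q t + v t * P t + t ^ 3 * u t * v t) \<longlongrightarrow> 0 * S 0 + 0 * Q 0 + 0 * P 0 + 0 ^ 3 * 0 * 0) (at_right 0)"
    by (intro tendsto_intros u v) auto
  hence "((\<lambda>t. t * S t + u t * Q t + v t * P t + t ^ 3 * u t * v t) \<longlongrightarrow> 0) (at_right 0)" by simp
  moreover have "\<forall>\<^sub>F t in at_right 0. t * S t + u t * Q t + v t * P t + t ^ 3 * u t * v t =
    (f t * g t - R t) / t ^ 3"
    unfolding eventually_at_filter by (rule always_eventually) (use eq in auto)
  ultimately show ?thesis unfolding expansion_def R_def by (rule Lim_transform_eventually)
qed

text \<open>The generating function of the Bernoulli polynomials with a minus sign; the factor
  \<open>t\<close> cancels its simple pole. The coefficients contain the polynomials of degree 0 to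
  3 at \<open>g\<close>.\<close>

lemma expansion_bernoulli:
  assumes "X \<noteq> 0"
  shows "expansion (\<lambda>t. t * (exp (g * (t * X)) / (1 - exp (t * X))))
    (- 1 / X) (- (g - 1/2)) (- (g\<^sup>2 - g + 1/6) * X / 2) (- (g ^ 3 - 3/2 * g\<^sup>2 + g / 2) * X\<^sup>2 / 6)"
proof -
  \<comment> \<open>The coefficients are the negated Bernoulli numbers divided by
    factorials.\<close>
  have "((\<lambda>x::real. (x / (1 - exp x) - (- 1 + 1/2 * x + (- 1/12) * x\<^sup>2 + 0 * x ^ 3)) / x ^ 3) \<longlongrightarrow> 0) (at 0)"
    by real_asymp
  note E = expansion_mult[OF expansion_const[of "1 / X"] expansion_mult[OF expansion_rescale[OF this assms] expansion_exp[of "g * X"]]]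
  have "expansion (\<lambda>t. 1 / X * (t * X / (1 - exp (t * X)) * exp (t * (g * X))))
    (- 1 / X) (- (g - 1/2)) (- (g\<^sup>2 - g + 1/6) * X / 2) (- (g ^ 3 - 3/2 * g\<^sup>2 + g / 2) * X\<^sup>2 / 6)"
    by (rule expansion_eqI[OF E]) (use assms in \<open>simp_all add: field_simps power2_eq_square power3_eq_cube\<close>)
  moreover have "1 / X * (t * X / (1 - exp (t * X)) * exp (t * (g * X))) = t * (exp (g * (t * X)) / (1 - exp (t * X)))" for t
    using assms by (simp add: mult_ac)
  ultimately show ?thesis by (simp only:)
qed

lemma tendsto_at_right_cubic:
  fixes a b c d :: real
  shows "((\<lambda>t. a + b * t + c * t\<^sup>2 + d * t ^ 3) \<longlongrightarrow> a) (at_right 0)"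
  by (auto intro!: tendsto_eq_intros)

text \<open>A finite limit of \<open>f t / t ^ 3\<close> forces the lower coefficients to vanish one
  after the other. In the application this expresses that the poles at the individual vertices
  cancel in the sum.\<close>

lemma expansion_limit:
  assumes f: "expansion f a b c d" and lim: "((\<lambda>t. f t / t ^ 3) \<longlongrightarrow> N) (at_right 0)"
  shows "d = N"
proof -
  have id: "((\<lambda>t::real. t) \<longlongrightarrow> 0) (at_right 0)" by (rule tendsto_ident_at)
  have "((\<lambda>t. f t / t ^ 3 - (f t - (a + b * t + c * t\<^sup>2 + d * t ^ 3)) / t ^ 3) \<longlongrightarrow> N - 0) (at_right 0)"
    using f lim unfolding expansion_def by (intro tendsto_diff)
  hence p3: "((\<lambda>t. (a + b * t + c * t\<^sup>2 + d * t ^ 3) / t ^ 3) \<longlongrightarrow> N) (at_right 0)"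
    by (simp add: diff_divide_distrib)
  have step: "h 0 = 0" if h: "(h \<longlongrightarrow> h 0) (at_right 0)" and hl: "((\<lambda>t. h t / t ^ k) \<longlongrightarrow> L) (at_right 0)" and k: "k > 0" for h :: "real \<Rightarrow> real" and L and k :: nat
  proof -
    have "((\<lambda>t. t ^ k * (h t / t ^ k)) \<longlongrightarrow> 0 ^ k * L) (at_right 0)" by (rule tendsto_mult[OF tendsto_power[OF id] hl])
    moreover have "\<forall>\<^sub>F t in at_right 0. t ^ k * (h t / t ^ k) = h t"
      unfolding eventually_at_filter by (rule always_eventually) auto
    ultimately have "(h \<longlongrightarrow> 0 ^ k * L) (at_right 0)" by (rule Lim_transform_eventually)
    hence "(h \<longlongrightarrow> 0) (at_right 0)" using k by (simp add: zero_power)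
    thus ?thesis using h tendsto_unique trivial_limit_at_right_real by blast
  qed
  have ev: "\<forall>\<^sub>F t in at_right 0. t > (0::real)" by (simp add: eventually_at_filter)
  have a: "a = 0"
    using step[of "\<lambda>t. a + b * t + c * t\<^sup>2 + d * t ^ 3", OF _ p3] tendsto_at_right_cubic[of a b c d] by simp
  have p2: "((\<lambda>t. (b + c * t + d * t\<^sup>2) / t ^ 2) \<longlongrightarrow> N) (at_right 0)"
    by (rule Lim_transform_eventually[OF p3]) (use ev in \<open>auto elim!: eventually_mono simp: a field_simps power2_eq_square power3_eq_cube\<close>)
  have b: "b = 0"
    using step[of "\<lambda>t. b + c * t + d * t\<^sup>2", OF _ p2] tendsto_at_right_cubic[of b c d 0] by simp
  have p1: "((\<lambda>t. (c + d * t) / t ^ 1) \<longlongrightarrow> N) (at_right 0)"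
    by (rule Lim_transform_eventually[OF p2]) (use ev in \<open>auto elim!: eventually_mono simp: b field_simps power2_eq_square\<close>)
  have c: "c = 0"
    using step[of "\<lambda>t. c + d * t", OF _ p1] tendsto_at_right_cubic[of c d 0 0] by simp
  have p0: "((\<lambda>t::real. d) \<longlongrightarrow> N) (at_right 0)"
    by (rule Lim_transform_eventually[OF p1], rule eventually_mono[OF ev]) (simp add: c)
  thus ?thesis using tendsto_unique[OF trivial_limit_at_right_real tendsto_const] by blast
qed

text \<open>Four positive arguments determine a cubic. The argument 0 is left out because the cone
  formula rescales points by \<open>1 / l\<close>.\<close>

lemma cubic_eq_coeff_1:
  fixes a b c d a' b' c' d' :: real
  assumes "\<And>l::nat. l \<ge> 1 \<Longrightarrow> a * real l ^ 3 + b * (real l)\<^sup>2 + c * real l + d = a' * real l ^ 3 + b' * (real l)\<^sup>2 + c' * real l + d'"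
  shows "c = c'"
  using assms[of 1] assms[of 2] assms[of 3] assms[of 4] by simp

text \<open>The dilation factor \<open>l\<close> enters only through the exponentials, so the
  coefficient of \<open>t ^ 3\<close> is a cubic in \<open>l\<close>. Its linear part pairs the
  linear term of the exponential with the \<open>t\<^sup>2\<close> coefficient of
  \<open>R v\<close>.\<close>

lemma linear_coefficient_of_exponential_sum:
  fixes \<alpha> :: "'a \<Rightarrow> real" and R :: "'a \<Rightarrow> real \<Rightarrow> real"
  assumes R: "\<And>v. v \<in> V \<Longrightarrow> expansion (R v) (r0 v) (r1 v) (r2 v) (r3 v)"
    and lim: "\<And>l::nat. l \<ge> 1 \<Longrightarrow> ((\<lambda>t. (\<Sum>v\<in>V. exp (t * (real l * \<alpha> v)) * R v t) / t ^ 3)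
      \<longlongrightarrow> c3 * real l ^ 3 + c2 * (real l)\<^sup>2 + c1 * real l + c0) (at_right 0)"
  shows "c1 = (\<Sum>v\<in>V. \<alpha> v * r2 v)"
proof (rule cubic_eq_coeff_1)
  fix l :: nat assume l: "l \<ge> 1"
  have "expansion (\<lambda>t. exp (t * (real l * \<alpha> v)) * R v t) (1 * r0 v) (1 * r1 v + (real l * \<alpha> v) * r0 v)
      (1 * r2 v + (real l * \<alpha> v) * r1 v + (real l * \<alpha> v)\<^sup>2 / 2 * r0 v)
      (1 * r3 v + (real l * \<alpha> v) * r2 v + (real l * \<alpha> v)\<^sup>2 / 2 * r1 v + (real l * \<alpha> v) ^ 3 / 6 * r0 v)"
    if "v \<in> V" for v
    using that by (intro expansion_mult expansion_exp R)
  from expansion_limit[OF expansion_sum[of V, OF this] lim[OF l], symmetric]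
  have "c3 * real l ^ 3 + c2 * (real l)\<^sup>2 + c1 * real l + c0 = (\<Sum>v\<in>V. 1 * r3 v + (real l * \<alpha> v) * r2 v
    + (real l * \<alpha> v)\<^sup>2 / 2 * r1 v + (real l * \<alpha> v) ^ 3 / 6 * r0 v)" .
  also have "\<dots> = (\<Sum>v\<in>V. (\<alpha> v) ^ 3 / 6 * r0 v) * real l ^ 3 + (\<Sum>v\<in>V. (\<alpha> v)\<^sup>2 / 2 * r1 v) * (real l)\<^sup>2
      + (\<Sum>v\<in>V. \<alpha> v * r2 v) * real l + (\<Sum>v\<in>V. r3 v)"
    unfolding sum_distrib_right sum.distrib[symmetric]
    by (intro sum.cong refl) (simp add: power_mult_distrib algebra_simps)
  finally show "c3 * real l ^ 3 + c2 * (real l)\<^sup>2 + c1 * real l + c0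
    = (\<Sum>v\<in>V. (\<alpha> v) ^ 3 / 6 * r0 v) * real l ^ 3 + (\<Sum>v\<in>V. (\<alpha> v)\<^sup>2 / 2 * r1 v) * (real l)\<^sup>2
      + (\<Sum>v\<in>V. \<alpha> v * r2 v) * real l + (\<Sum>v\<in>V. r3 v)"
    .
qed

section \<open>Geometric series over the integers\<close>

lemma has_sum_product_real:
  fixes f :: "'a \<Rightarrow> real" and g :: "'b \<Rightarrow> real"
  assumes f: "(f has_sum a) A" and g: "(g has_sum b) B"
  shows "((\<lambda>(x, y). f x * g y) has_sum a * b) (Sigma A (\<lambda>_. B))"
proof (rule has_sum_SigmaI)
  show "((\<lambda>y. case (x, y) of (x, y) \<Rightarrow> f x * g y) has_sum f x * b) B" for x
    using has_sum_cmult_right[OF g] by simp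
  show "((\<lambda>x. f x * b) has_sum a * b) A" by (rule has_sum_cmult_left[OF f])
  have f': "(\<lambda>x. \<bar>f x\<bar>) summable_on A" and g': "(\<lambda>x. \<bar>g x\<bar>) summable_on B"
    using has_sum_imp_summable[OF f, THEN summable_on_iff_abs_summable_on_real[THEN iffD1]]
      has_sum_imp_summable[OF g, THEN summable_on_iff_abs_summable_on_real[THEN iffD1]] by simp_all
  obtain b' where b': "((\<lambda>x. \<bar>g x\<bar>) has_sum b') B" using g' by (auto simp: summable_on_def)
  have "(\<lambda>p. \<bar>f (fst p)\<bar> * \<bar>g (snd p)\<bar>) summable_on (Sigma A (\<lambda>_. B))"
  proof (rule summable_on_SigmaI)
    show "((\<lambda>y. \<bar>f (fst (x, y))\<bar> * \<bar>g (snd (x, y))\<bar>) has_sum \<bar>f x\<bar> * b') B" for x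
      using has_sum_cmult_right[OF b'] by simp
    show "(\<lambda>x. \<bar>f x\<bar> * b') summable_on A" by (rule summable_on_cmult_left[OF f'])
  qed auto
  hence "(\<lambda>p. norm (case p of (x, y) \<Rightarrow> f x * g y)) summable_on (Sigma A (\<lambda>_. B))"
    by (simp add: case_prod_unfold abs_mult)
  thus "(\<lambda>(x, y). f x * g y) summable_on (Sigma A (\<lambda>_. B))" by (rule abs_summable_summable)
qed

lemma has_sum_exp_nat:
  fixes X :: real assumes "X < 0"
  shows "((\<lambda>n::nat. exp (real n * X)) has_sum 1 / (1 - exp X)) UNIV"
proof -
  have "exp (real n * X) = exp X ^ n" for n by (simp add: exp_of_nat_mult)
  moreover have "((\<lambda>n. exp X ^ n) has_sum 1 / (1 - exp X)) UNIV"
    using assms by (intro norm_summable_imp_has_sum geometric_sums) (auto simp: summable_geometric)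
  ultimately show ?thesis by simp
qed

text \<open>For \<open>0 < X\<close> the summand is minus the exponential on the negative integers;
  both half-lines give the same value \<open>1 / (1 - exp X)\<close>. This is why flipping a
  generator of a cone comes with a change of sign.\<close>

lemma has_sum_exp_int:
  fixes X :: real assumes "X \<noteq> 0"
  shows "((\<lambda>n::int. (of_bool (0 \<le> n) - of_bool (0 < X)) * exp (of_int n * X)) has_sum 1 / (1 - exp X)) UNIV"
proof (cases "X < 0")
  case True
  have "((\<lambda>n::int. exp (of_int n * X)) has_sum 1 / (1 - exp X)) (range int)"
    using has_sum_exp_nat[OF True] by (subst has_sum_reindex) (auto simp: o_def)
  moreover have "range int = {0..}" by (auto simp: image_iff) (metis nat_0_le)
  ultimately have *: "((\<lambda>n::int. exp (of_int n * X)) has_sum 1 / (1 - exp X)) {0..}" by simp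
  show ?thesis
    using * by (rule has_sum_cong_neutral[THEN iffD1, rotated -1]) (use True in auto)
next
  case False
  hence X: "X > 0" using assms by simp
  define h where "h n = - 1 - int n" for n
  have "((\<lambda>n::nat. - exp (- X) * exp (real n * (- X))) has_sum - exp (- X) * (1 / (1 - exp (- X)))) UNIV"
    by (rule has_sum_cmult_right[OF has_sum_exp_nat]) (use X in auto)
  moreover have "- exp (- X) * exp (real n * (- X)) = - exp (of_int (h n) * X)" for n
    by (simp add: h_def algebra_simps flip: exp_add)
  moreover have "- exp (- X) * (1 / (1 - exp (- X))) = 1 / (1 - exp X)"
    using X by (simp add: exp_minus field_simps)
  ultimately have "((\<lambda>n::nat. - exp (of_int (h n) * X)) has_sum 1 / (1 - exp X)) UNIV" by simp
  hence "((\<lambda>n::int. - exp (of_int n * X)) has_sum 1 / (1 - exp X)) (range h)"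
    by (subst has_sum_reindex) (auto simp: o_def h_def inj_on_def)
  moreover have "range h = {..<0}"
  proof (intro subset_antisym subsetI)
    fix n assume "n \<in> {..<(0::int)}"
    hence "n = h (nat (- 1 - n))" by (simp add: h_def)
    thus "n \<in> range h" by blast
  qed (auto simp: h_def)
  ultimately have *: "((\<lambda>n::int. - exp (of_int n * X)) has_sum 1 / (1 - exp X)) {..<0}" by simp
  show ?thesis
    using * by (rule has_sum_cong_neutral[THEN iffD1, rotated -1]) (use X in auto)
qed

section \<open>The signed cone decomposition of a simple polytope\<close>

lemma exists_common_small_scale:
  fixes f g :: "'a \<Rightarrow> real"
  assumes "finite A" "\<And>a. a \<in> A \<Longrightarrow> f a > 0"
  shows "\<exists>e>0. \<forall>a\<in>A. e * \<bar>g a\<bar> \<le> f a"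
  using assms
proof (induction A rule: finite_induct)
  case empty
  show ?case by (intro exI[of _ 1]) auto
next
  case (insert b A)
  then obtain e where e: "e > 0" "\<forall>a\<in>A. e * \<bar>g a\<bar> \<le> f a" by auto
  define d where "d = min e (f b / (1 + \<bar>g b\<bar>))"
  have fb: "f b > 0" using insert by auto
  have "d > 0" using e fb by (auto simp: d_def)
  moreover have "d * \<bar>g a\<bar> \<le> f a" if "a \<in> A" for a
    using e that mult_right_mono[of d e "\<bar>g a\<bar>"] by (auto simp: d_def)
  moreover have "d * \<bar>g b\<bar> \<le> f b"
  proof -
    have "d * \<bar>g b\<bar> \<le> f b / (1 + \<bar>g b\<bar>) * \<bar>g b\<bar>" by (intro mult_right_mono) (auto simp: d_def)
    also have "\<dots> \<le> f b" using fb by (simp add: field_simps)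
    finally show ?thesis .
  qed
  ultimately show ?case by auto
qed

lemma ex1_iff_eq: "\<exists>!v. Q v \<Longrightarrow> \<exists>v. \<forall>u. Q u \<longleftrightarrow> u = v"
  by auto

text \<open>A nonempty open set is not contained in a hyperplane, so finitely many hyperplanes can
  be avoided one at a time.\<close>

lemma exists_generic_in_open:
  fixes B :: "'a::euclidean_space set"
  assumes "finite B" "0 \<notin> B" "open U" "U \<noteq> {}"
  shows "\<exists>\<xi>\<in>U. \<forall>w\<in>B. \<xi> \<bullet> w \<noteq> 0"
  using assms
proof (induction B arbitrary: U rule: finite_induct)
  case (insert w B)
  have w: "w \<noteq> 0" using insert by auto
  have "open (U \<inter> {x. w \<bullet> x \<noteq> 0})"
    by (intro open_Int insert.prems open_Collect_neq continuous_intros)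
  moreover have "U \<inter> {x. w \<bullet> x \<noteq> 0} \<noteq> {}"
  proof
    assume empty: "U \<inter> {x. w \<bullet> x \<noteq> 0} = {}"
    have "U \<subseteq> {x. w \<bullet> x = 0}" using empty by auto
    hence "U \<subseteq> interior {x. w \<bullet> x = 0}" using insert.prems by (intro interior_maximal)
    thus False using interior_hyperplane[OF w, of 0] insert.prems(3) by blast
  qed
  ultimately obtain \<xi> where "\<xi> \<in> U \<inter> {x. w \<bullet> x \<noteq> 0}" "\<forall>w\<in>B. \<xi> \<bullet> w \<noteq> 0"
    using insert.IH[of "U \<inter> {x. w \<bullet> x \<noteq> 0}"] insert.prems by auto
  thus ?case by (auto simp: inner_commute)
qed auto

section \<open>Facets, primitive normals and vertices\<close>

locale simple_lattice_polytope =
  fixes P :: "(real^3) set"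
  assumes integral: "integral_polytope P" and simple: "simple_polytope P" and full_dim: "aff_dim P = 3"
begin

definition facets where "facets = {F. F facet_of P}"
definition verts where "verts = {x. x extreme_point_of P}"
definition fac where "fac v = {F. F facet_of P \<and> v \<in> F}"
abbreviation nrm where "nrm F \<equiv> inward_normal P F"
text \<open>For a facet \<open>F\<close>, the lattice height over its plane: the definite
  description is the constant value of the normal on \<open>F\<close>.\<close>

definition lam where "lam F x = nrm F \<bullet> x - (THE c. \<exists>y\<in>F. c = nrm F \<bullet> y)"

lemma P_polytope: "polytope P" and P_polyhedron: "polyhedron P" and P_compact: "compact P"
  and P_convex: "convex P" and P_closed: "closed P"
  using integral by (auto simp: integral_polytope_def polytope_imp_polyhedron polytope_imp_compact
    polytope_imp_convex polytope_imp_closed)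

lemma finite_facets: "finite facets" and finite_verts: "finite verts"
  unfolding facets_def verts_def
  using finite_polytope_facets[OF P_polytope] finite_polyhedron_extreme_points[OF P_polyhedron] by auto

lemma verts_int_lattice: "v \<in> verts \<Longrightarrow> v \<in> int_lattice"
  using integral by (auto simp: verts_def integral_polytope_def)

lemma verts_in_P: "v \<in> verts \<Longrightarrow> v \<in> P"
  by (auto simp: verts_def extreme_point_of_def)

lemma convex_hull_verts_face:
  assumes "Q face_of P" shows "Q = convex hull (verts \<inter> Q)"
proof -
  have "compact Q" "convex Q" using face_of_imp_compact[OF P_convex P_compact assms] face_of_imp_convex[OF assms] by auto
  hence "Q = convex hull {x. x extreme_point_of Q}" by (rule Krein_Milman_Minkowski)
  also have "{x. x extreme_point_of Q} = verts \<inter> Q"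
    using extreme_point_of_face[OF assms] by (auto simp: verts_def)
  finally show ?thesis .
qed

lemma facet_obtain_points:
  assumes "F facet_of P"
  obtains x y z where "x \<in> verts \<inter> F" "y \<in> verts \<inter> F" "z \<in> verts \<inter> F" "(y - x) \<times> (z - x) \<noteq> 0"
proof -
  define E where "E = verts \<inter> F"
  have "aff_dim F = 2" using assms full_dim by (simp add: facet_of_def)
  moreover have "F = convex hull E"
    unfolding E_def by (rule convex_hull_verts_face[OF facet_of_imp_face_of[OF assms]])
  ultimately have "aff_dim E = 2" by (metis aff_dim_convex_hull)
  hence nc: "\<not> collinear E" by (simp add: collinear_aff_dim)
  hence "E \<noteq> {}" by auto
  then obtain x where x: "x \<in> E" by auto
  have "\<exists>y\<in>E. y \<noteq> x"
  proof (rule ccontr)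
    assume "\<not> (\<exists>y\<in>E. y \<noteq> x)"
    hence "E = {x}" using x by blast
    thus False using nc by simp
  qed
  then obtain y where y: "y \<in> E" "y \<noteq> x" by auto
  have "insert y (insert x E) = E" using x y by auto
  hence "\<not> (\<forall>z\<in>E. collinear {y, x, z})" using nc collinear_triples[OF y(2), of E] by simp
  then obtain z where z: "z \<in> E" "\<not> collinear {y, x, z}" by auto
  hence "\<not> collinear {0, y - x, z - x}" using collinear_3[of y x z] by (auto simp: NO_MATCH_def)
  hence "(y - x) \<times> (z - x) \<noteq> 0" by (simp add: cross_eq_0)
  thus ?thesis using x y(1) z(1) unfolding E_def by (intro that[of x y z])
qed

text \<open>The plane of a facet contains three noncollinear lattice points, so its real normal is a
  multiple of an integral cross product. Dividing that by the gcd of its coordinates and choosing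
  the sign gives the primitive inward normal.\<close>

lemma facet_exists_normal:
  assumes "F facet_of P"
  shows "\<exists>v. primitive v \<and> (\<exists>c. P \<subseteq> {x. c \<le> v \<bullet> x} \<and> F = P \<inter> {x. v \<bullet> x = c})"
proof -
  obtain a b where ab: "a \<noteq> 0" "P \<subseteq> {x. a \<bullet> x \<le> b}" "F = P \<inter> {x. a \<bullet> x = b}"
    using facet_of_polyhedron[OF P_polyhedron assms] by blast
  obtain x y z where xyz: "x \<in> verts \<inter> F" "y \<in> verts \<inter> F" "z \<in> verts \<inter> F" and nz: "(y - x) \<times> (z - x) \<noteq> 0"
    using facet_obtain_points[OF assms] by blast
  have int: "(y - x) \<times> (z - x) \<in> int_lattice" using xyz verts_int_lattice by auto
  have "a \<bullet> (y - x) = 0" "a \<bullet> (z - x) = 0" using xyz ab(3) by (auto simp: inner_diff_right)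
  then obtain k where k: "a = k *\<^sub>R ((y - x) \<times> (z - x))" using cross3_orthogonal_parallel nz by blast
  obtain m :: int and w where m: "m > 0" "primitive w" "(y - x) \<times> (z - x) = of_int m *\<^sub>R w"
    using int_lattice_obtain_primitive[OF int nz] by blast
  define r where "r = k * of_int m"
  have a: "a = r *\<^sub>R w" using k m r_def by simp
  have r: "r \<noteq> 0" using ab(1) a by auto
  show ?thesis
  proof (cases "r > 0")
    case True
    have "P \<subseteq> {x. - b / r \<le> (- w) \<bullet> x}" using ab(2) a True by (auto simp: field_simps)
    moreover have "F = P \<inter> {x. (- w) \<bullet> x = - b / r}"
      unfolding ab(3) a using True by (auto simp: field_simps)
    moreover have "primitive (- w)" using m by simp
    ultimately show ?thesis by blast
  next
    case False
    hence r: "r < 0" using r by simp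
    have "P \<subseteq> {x. b / r \<le> w \<bullet> x}" using ab(2) a r by (auto simp: field_simps)
    moreover have "F = P \<inter> {x. w \<bullet> x = b / r}"
      unfolding ab(3) a using r by (auto simp: field_simps)
    ultimately show ?thesis using m by blast
  qed
qed

text \<open>Two primitive normals of the same plane differ at most by a sign, and opposite signs
  would squeeze all of \<open>P\<close> into that plane.\<close>

lemma facet_normal_unique:
  assumes F: "F facet_of P"
    and v: "primitive v" "P \<subseteq> {x. c \<le> v \<bullet> x}" "F = P \<inter> {x. v \<bullet> x = c}"
    and w: "primitive w" "P \<subseteq> {x. d \<le> w \<bullet> x}" "F = P \<inter> {x. w \<bullet> x = d}"
  shows "v = w"
proof -
  obtain x y z where xyz: "x \<in> verts \<inter> F" "y \<in> verts \<inter> F" "z \<in> verts \<inter> F" and nz: "(y - x) \<times> (z - x) \<noteq> 0"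
    using facet_obtain_points[OF F] by blast
  have in_v: "v \<bullet> x = c" "v \<bullet> y = c" "v \<bullet> z = c" and in_w: "w \<bullet> x = d" "w \<bullet> y = d" "w \<bullet> z = d"
    using xyz v(3) w(3) by blast+
  obtain k where k: "v = k *\<^sub>R ((y - x) \<times> (z - x))"
    using cross3_orthogonal_parallel[OF _ _ nz, of v] in_v by (auto simp: inner_diff_right)
  obtain l where l: "w = l *\<^sub>R ((y - x) \<times> (z - x))"
    using cross3_orthogonal_parallel[OF _ _ nz, of w] in_w by (auto simp: inner_diff_right)
  have k0: "k \<noteq> 0" using k primitive_nonzero[OF v(1)] by auto
  have wv: "w = (l / k) *\<^sub>R v" using k l k0 by simp
  hence "l / k = 1 \<or> l / k = - 1" using primitive_parallel[OF w(1) v(1)] by blast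
  thus ?thesis
  proof
    assume "l / k = -1"
    hence wv: "w = - v" using wv by simp
    hence "d = - c" using in_v in_w by simp
    have "v \<bullet> p = c" if p: "p \<in> P" for p
    proof -
      have "c \<le> v \<bullet> p" "d \<le> w \<bullet> p" using v(2) w(2) p by blast+
      thus ?thesis using \<open>d = - c\<close> wv by simp
    qed
    hence "P \<subseteq> F" using v(3) by blast
    hence "F = P" using facet_of_imp_subset[OF F] by auto
    thus ?thesis using F by simp
  qed (use wv in simp)
qed

lemma facet_props:
  assumes "F \<in> facets"
  shows nrm_primitive: "primitive (nrm F)" and lam_nonneg: "x \<in> P \<Longrightarrow> 0 \<le> lam F x"
    and mem_facet_iff: "x \<in> F \<longleftrightarrow> x \<in> P \<and> lam F x = 0"
proof -
  have F: "F facet_of P" using assms by (simp add: facets_def)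
  have "\<exists>!v. primitive v \<and> (\<exists>c. P \<subseteq> {x. c \<le> v \<bullet> x} \<and> F = P \<inter> {x. v \<bullet> x = c})"
    using facet_exists_normal[OF F] facet_normal_unique[OF F] by metis
  hence n: "primitive (nrm F) \<and> (\<exists>c. P \<subseteq> {x. c \<le> nrm F \<bullet> x} \<and> F = P \<inter> {x. nrm F \<bullet> x = c})"
    unfolding inward_normal_def by (rule theI')
  then obtain c where c: "P \<subseteq> {x. c \<le> nrm F \<bullet> x}" "F = P \<inter> {x. nrm F \<bullet> x = c}" by blast
  have "F \<noteq> {}" using F by (simp add: facet_of_def)
  then obtain y where y: "y \<in> F" by auto
  have "nrm F \<bullet> z = c" if "z \<in> F" for z using that c(2) by blast
  hence "(THE c. \<exists>y\<in>F. c = nrm F \<bullet> y) = c" using y by (intro the_equality) auto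
  hence lam: "lam F x = nrm F \<bullet> x - c" for x by (simp add: lam_def)
  show "primitive (nrm F)" using n by simp
  show "x \<in> P \<Longrightarrow> 0 \<le> lam F x" using c lam by auto
  show "x \<in> F \<longleftrightarrow> x \<in> P \<and> lam F x = 0" using c(2) lam by auto
qed

lemma nrm_int [simp]: "F \<in> facets \<Longrightarrow> nrm F \<in> int_lattice"
  using nrm_primitive by simp

lemma lam_diff: "lam F x - lam F y = nrm F \<bullet> (x - y)"
  by (simp add: lam_def inner_diff_right)

lemma lam_add: "lam F (x + d) = lam F x + nrm F \<bullet> d"
  by (simp add: lam_def inner_add_right)

text \<open>A segment from an interior point to a point outside leaves \<open>P\<close> through some
  facet \<open>F\<close>; \<open>lam F\<close> is affine, positive at the start and 0 at the exit,
  hence not nonnegative beyond it.\<close>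

lemma mem_P_iff: "x \<in> P \<longleftrightarrow> (\<forall>F\<in>facets. 0 \<le> lam F x)"
proof
  assume *: "\<forall>F\<in>facets. 0 \<le> lam F x"
  show "x \<in> P"
  proof (rule ccontr)
    assume x: "x \<notin> P"
    have hull: "affine hull P = UNIV" using full_dim aff_dim_eq_full[of P] by simp
    have "P \<noteq> {}" using full_dim by auto
    hence "interior P \<noteq> {}" using rel_interior_interior[OF hull] rel_interior_eq_empty[OF P_convex] by simp
    then obtain y where y: "y \<in> interior P" by auto
    have yP: "y \<in> P" using y interior_subset by auto
    have "closed_segment y x \<inter> frontier P \<noteq> {}"
      by (rule connected_Int_frontier) (use yP x in auto)
    then obtain z where z: "z \<in> closed_segment y x" "z \<in> frontier P" by auto
    have fr: "frontier P = \<Union>{F. F facet_of P}"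
      using rel_frontier_of_polyhedron[OF P_polyhedron] rel_frontier_frontier[OF hull] by simp
    then obtain F where F: "F \<in> facets" "z \<in> F" using z by (auto simp: facets_def)
    have "y \<notin> frontier P" using y by (simp add: frontier_def)
    hence "y \<notin> F" using fr F by (auto simp: facets_def)
    hence ly: "lam F y > 0" using lam_nonneg[OF F(1) yP] mem_facet_iff[OF F(1)] yP by auto
    obtain u where u: "0 \<le> u" "u \<le> 1" "z = (1 - u) *\<^sub>R y + u *\<^sub>R x"
      using z(1) by (auto simp: closed_segment_def)
    have "lam F z = (1 - u) * lam F y + u * lam F x"
      unfolding u(3) by (simp add: lam_def inner_add_right algebra_simps)
    moreover have "lam F z = 0" using F mem_facet_iff by auto
    moreover have "u * lam F x \<ge> 0" using u * F by auto
    ultimately have "(1 - u) * lam F y \<le> 0" by linarith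
    hence "u = 1" using ly u by (simp add: mult_le_0_iff)
    hence "z = x" using u by simp
    thus False using x F mem_facet_iff by auto
  qed
qed (use lam_nonneg in auto)

text \<open>A short step only has to respect the facets through \<open>x\<close>; over the finitely
  many others there is positive height to spare.\<close>

lemma move_into_P:
  assumes x: "x \<in> P" and d: "\<And>F. F \<in> facets \<Longrightarrow> lam F x = 0 \<Longrightarrow> nrm F \<bullet> d \<ge> 0"
  shows "\<exists>e>0. x + e *\<^sub>R d \<in> P"
proof -
  define A where "A = {F \<in> facets. lam F x \<noteq> 0}"
  have "finite A" using finite_facets by (simp add: A_def)
  moreover have "lam F x > 0" if "F \<in> A" for F
    using that lam_nonneg[OF _ x] by (force simp: A_def)
  ultimately obtain e where e: "e > 0" "\<forall>F\<in>A. e * \<bar>nrm F \<bullet> d\<bar> \<le> lam F x"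
    using exists_common_small_scale[of A "\<lambda>F. lam F x" "\<lambda>F. nrm F \<bullet> d"] by blast
  have "0 \<le> lam F (x + e *\<^sub>R d)" if F: "F \<in> facets" for F
  proof (cases "F \<in> A")
    case True
    hence "e * \<bar>nrm F \<bullet> d\<bar> \<le> lam F x" using e by blast
    moreover have "- (e * \<bar>nrm F \<bullet> d\<bar>) \<le> e * (nrm F \<bullet> d)"
      using e(1) mult_left_mono[of "- \<bar>nrm F \<bullet> d\<bar>" "nrm F \<bullet> d" e] by simp
    ultimately show ?thesis by (simp add: lam_add)
  next
    case False
    thus ?thesis using d[OF F] F e(1) by (simp add: lam_add A_def)
  qed
  thus ?thesis using e(1) mem_P_iff by blast
qed

lemma fac_facets: "F \<in> fac v \<Longrightarrow> F \<in> facets" and fac_mem: "F \<in> fac v \<Longrightarrow> v \<in> F"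
  by (auto simp: fac_def facets_def)

lemma mem_fac_iff: "v \<in> P \<Longrightarrow> F \<in> fac v \<longleftrightarrow> F \<in> facets \<and> lam F v = 0"
  using mem_facet_iff[of F v] by (auto simp: fac_def facets_def)

lemma finite_fac [simp]: "finite (fac v)"
  using finite_facets by (rule finite_subset[rotated]) (auto simp: fac_def facets_def)

lemma fac_lam: "F \<in> fac v \<Longrightarrow> lam F v = 0"
  using mem_facet_iff[of F v] by (auto simp: fac_def facets_def)

lemma fac_lam_eq: "F \<in> fac v \<Longrightarrow> lam F x = nrm F \<bullet> (x - v)"
  using lam_diff[of F x v] fac_lam[of F v] by simp

lemma card_fac: "v \<in> verts \<Longrightarrow> card (fac v) = 3"
  using simple by (simp add: simple_polytope_def verts_def fac_def)

text \<open>A direction orthogonal to all normals at \<open>v\<close> would make \<open>v\<close> an inner point of a segment in \<open>P\<close>.\<close>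

lemma vertex_normals_independent:
  assumes v: "v \<in> verts" and fac: "fac v = {F, G, H}"
  shows "nrm F \<bullet> (nrm G \<times> nrm H) \<noteq> 0"
proof
  assume "nrm F \<bullet> (nrm G \<times> nrm H) = 0"
  then obtain d where d: "d \<noteq> 0" "nrm F \<bullet> d = 0" "nrm G \<bullet> d = 0" "nrm H \<bullet> d = 0"
    by (rule exists_orthogonal_if_triple_0)
  have vP: "v \<in> P" using v by (rule verts_in_P)
  have z: "nrm K \<bullet> d = 0" if "K \<in> facets" "lam K v = 0" for K
  proof -
    have "K \<in> fac v" using that mem_fac_iff[OF vP] by simp
    thus ?thesis using d fac by auto
  qed
  obtain e where e: "e > 0" "v + e *\<^sub>R d \<in> P" using move_into_P[OF vP, of d] z by auto
  obtain e' where e': "e' > 0" "v + e' *\<^sub>R (- d) \<in> P" using move_into_P[OF vP, of "-d"] z by auto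
  have "v \<in> open_segment (v + e *\<^sub>R d) (v + e' *\<^sub>R (- d))"
  proof -
    define u where "u = e / (e + e')"
    have "0 < u" "u < 1" using e e' by (auto simp: u_def)
    moreover have "(1 - u) * e - u * e' = 0" using e e' by (simp add: u_def field_simps)
    moreover have "(1 - u) *\<^sub>R (v + e *\<^sub>R d) + u *\<^sub>R (v + e' *\<^sub>R (- d)) = v + ((1 - u) * e - u * e') *\<^sub>R d"
      by (simp add: algebra_simps)
    ultimately have "0 < u" "u < 1" "v = (1 - u) *\<^sub>R (v + e *\<^sub>R d) + u *\<^sub>R (v + e' *\<^sub>R (- d))" by simp_all
    moreover have "v + e *\<^sub>R d \<noteq> v + e' *\<^sub>R (- d)"
    proof
      assume "v + e *\<^sub>R d = v + e' *\<^sub>R (- d)"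
      hence "(e + e') *\<^sub>R d = 0" by (simp add: algebra_simps)
      thus False using e e' d by simp
    qed
    ultimately show ?thesis unfolding in_segment by blast
  qed
  thus False using v e e' by (auto simp: verts_def extreme_point_of_def)
qed

text \<open>Fixing the sign of the determinant makes \<open>G\<close> and \<open>H\<close> unique
  once \<open>v\<close> and \<open>F\<close> are given, and cyclic shifts preserve it.\<close>

definition ori where
  "ori v F G H \<longleftrightarrow> v \<in> verts \<and> fac v = {F, G, H} \<and> 0 < nrm F \<bullet> (nrm G \<times> nrm H)"

text \<open>
  \<open>W v F\<close> points along the edge at \<open>v\<close> that leaves the facet \<open>F\<close>. It need not be primitive: as a cross
  product of the other two normals it is determined, up to its sign, by the edge alone, and all three
  vectors at \<open>v\<close> have the same height over the opposite facet.
\<close>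

definition W where
  "W v F = (THE w. \<exists>G H. ori v F G H \<and> w = nrm G \<times> nrm H)"

lemma oriD:
  assumes "ori v F G H"
  shows "v \<in> verts" "fac v = {F, G, H}" "0 < nrm F \<bullet> (nrm G \<times> nrm H)" "F \<noteq> G" "G \<noteq> H" "F \<noteq> H"
    "F \<in> facets" "G \<in> facets" "H \<in> facets" "F \<in> fac v" "G \<in> fac v" "H \<in> fac v"
proof -
  show v: "v \<in> verts" and f: "fac v = {F, G, H}" and "0 < nrm F \<bullet> (nrm G \<times> nrm H)"
    using assms by (auto simp: ori_def)
  have "card {F, G, H} = 3" using card_fac[OF v] f by simp
  thus "F \<noteq> G" "G \<noteq> H" "F \<noteq> H" by (auto simp: card_insert_if split: if_splits)
  show "F \<in> facets" "G \<in> facets" "H \<in> facets" "F \<in> fac v" "G \<in> fac v" "H \<in> fac v"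
    using f fac_facets[of _ v] by auto
qed

lemma ori_rotate: "ori v F G H \<Longrightarrow> ori v G H F"
  using triple_rotate(1)[of "nrm G" "nrm H" "nrm F"] by (auto simp: ori_def)

lemma ori_exists:
  assumes "v \<in> verts" "F \<in> fac v"
  obtains G H where "ori v F G H"
proof -
  have "card (fac v - {F}) = 2" using card_fac[OF assms(1)] assms(2) by simp
  then obtain G H where "fac v - {F} = {G, H}" by (auto simp: card_2_iff)
  hence f: "fac v = {F, G, H}" using assms by auto
  have "nrm F \<bullet> (nrm G \<times> nrm H) \<noteq> 0" by (rule vertex_normals_independent[OF assms(1) f])
  hence "ori v F G H \<or> ori v F H G"
    using f assms triple_swap[of "nrm F" "nrm H" "nrm G"] by (auto simp: ori_def)
  thus ?thesis using that by auto
qed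

lemma ori_exists':
  assumes "v \<in> verts" obtains F G H where "ori v F G H"
proof -
  have "fac v \<noteq> {}" using card_fac[OF assms] by auto
  then obtain F where "F \<in> fac v" by blast
  then obtain G H where "ori v F G H" by (rule ori_exists[OF assms])
  thus ?thesis by (rule that)
qed

lemma ori_unique:
  assumes "ori v F G H" "ori v F G' H'" shows "G' = G" "H' = H"
proof -
  have "(G' = G \<and> H' = H) \<or> (G' = H \<and> H' = G)"
    using oriD[OF assms(1)] oriD[OF assms(2)] by auto
  moreover have "\<not> (G' = H \<and> H' = G)"
    using oriD(3)[OF assms(1)] oriD(3)[OF assms(2)] triple_swap[of "nrm F" "nrm H" "nrm G"] by auto
  ultimately show "G' = G" "H' = H" by auto
qed

lemma W_eq1: "ori v F G H \<Longrightarrow> W v F = nrm G \<times> nrm H"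
  unfolding W_def by (rule the_equality) (use ori_unique in blast)+

lemma W_eq:
  assumes "ori v F G H"
  shows "W v F = nrm G \<times> nrm H" "W v G = nrm H \<times> nrm F" "W v H = nrm F \<times> nrm G"
  using W_eq1[OF assms] W_eq1[OF ori_rotate[OF assms]] W_eq1[OF ori_rotate[OF ori_rotate[OF assms]]] by auto

lemma nrm_W:
  assumes "v \<in> verts" "F \<in> fac v"
  shows "nrm F \<bullet> W v F > 0" "G \<in> fac v \<Longrightarrow> G \<noteq> F \<Longrightarrow> nrm G \<bullet> W v F = 0"
proof -
  obtain A B where o: "ori v F A B" using ori_exists[OF assms] by blast
  show "nrm F \<bullet> W v F > 0" using W_eq(1)[OF o] oriD(3)[OF o] by simp
  show "nrm G \<bullet> W v F = 0" if "G \<in> fac v" "G \<noteq> F"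
    using W_eq(1)[OF o] oriD(2)[OF o] that by (auto simp: dot_cross_self)
qed

lemma W_nonzero: "v \<in> verts \<Longrightarrow> F \<in> fac v \<Longrightarrow> W v F \<noteq> 0"
  using nrm_W(1)[of v F] by auto

lemma vertex_expansion:
  assumes o: "ori v F G H"
  shows "(nrm F \<bullet> (nrm G \<times> nrm H)) *\<^sub>R (x - v) = (\<Sum>K\<in>fac v. lam K x *\<^sub>R W v K)"
proof -
  have "(\<Sum>K\<in>fac v. lam K x *\<^sub>R W v K) = lam F x *\<^sub>R W v F + lam G x *\<^sub>R W v G + lam H x *\<^sub>R W v H"
    using oriD(2,4,5,6)[OF o] by simp
  also have "\<dots> = (nrm F \<bullet> (nrm G \<times> nrm H)) *\<^sub>R (x - v)"
    using triple_dual_expansion[of "nrm F" "nrm G" "nrm H" "x - v"] W_eq[OF o]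
      fac_lam_eq[OF oriD(10)[OF o]] fac_lam_eq[OF oriD(11)[OF o]] fac_lam_eq[OF oriD(12)[OF o]] by simp
  finally show ?thesis by simp
qed

lemma vertex_expansion_inner:
  assumes v: "v \<in> verts"
  obtains D where "D > 0" "\<And>x \<xi>. D * (\<xi> \<bullet> x - \<xi> \<bullet> v) = (\<Sum>K\<in>fac v. lam K x * (\<xi> \<bullet> W v K))"
proof -
  obtain F G H where o: "ori v F G H" using ori_exists'[OF v] by blast
  define D where "D = nrm F \<bullet> (nrm G \<times> nrm H)"
  show ?thesis
  proof (rule that[of D])
    show "D > 0" using oriD(3)[OF o] by (simp add: D_def)
    fix x \<xi>
    have "D * (\<xi> \<bullet> x - \<xi> \<bullet> v) = \<xi> \<bullet> (D *\<^sub>R (x - v))" by (simp add: inner_diff_right)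
    also have "\<dots> = (\<Sum>K\<in>fac v. lam K x * (\<xi> \<bullet> W v K))"
      unfolding D_def vertex_expansion[OF o] by (simp add: inner_sum_right)
    finally show "D * (\<xi> \<bullet> x - \<xi> \<bullet> v) = (\<Sum>K\<in>fac v. lam K x * (\<xi> \<bullet> W v K))" .
  qed
qed

lemma eq_vertex_if_lam_0:
  assumes v: "v \<in> verts" and l: "\<And>K. K \<in> fac v \<Longrightarrow> lam K x = 0"
  shows "x = v"
proof -
  obtain F G H where o: "ori v F G H" using ori_exists'[OF v] by blast
  have "(nrm F \<bullet> (nrm G \<times> nrm H)) *\<^sub>R (x - v) = 0" using vertex_expansion[OF o] l by simp
  thus ?thesis using oriD(3)[OF o] by simp
qed

section \<open>Generic directions and the signed decomposition\<close>

definition generic where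
  "generic \<xi> \<longleftrightarrow> (\<forall>v\<in>verts. \<forall>F\<in>fac v. \<xi> \<bullet> W v F \<noteq> 0)"

lemma generic_uminus: "generic \<xi> \<Longrightarrow> generic (- \<xi>)"
  by (simp add: generic_def)

lemma generic_scaleR: "generic \<xi> \<Longrightarrow> c \<noteq> 0 \<Longrightarrow> generic (c *\<^sub>R \<xi>)"
  by (simp add: generic_def)

lemma exists_generic:
  assumes "open U" "U \<noteq> {}" obtains \<xi> where "\<xi> \<in> U" "generic \<xi>"
proof -
  define B where "B = (\<Union>v\<in>verts. W v ` fac v)"
  have "finite B" unfolding B_def using finite_verts by auto
  moreover have "0 \<notin> B" unfolding B_def using W_nonzero by force
  ultimately obtain \<xi> where "\<xi> \<in> U" "\<forall>w\<in>B. \<xi> \<bullet> w \<noteq> 0" using exists_generic_in_open assms by meson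
  thus ?thesis using that by (auto simp: generic_def B_def)
qed

text \<open>\<open>S\<close> cuts out a face, and the facets at \<open>v\<close> outside
  \<open>S\<close> correspond to the edges of this face at \<open>v\<close>. The condition says that
  \<xi> increases along all of them; by convexity this holds only at the minimum of \<xi> on the
  face, which is a single vertex for generic \<xi>.\<close>

lemma unique_local_minimum:
  assumes gen: "generic \<xi>" and v0: "v0 \<in> verts" "S \<subseteq> fac v0"
  shows "\<exists>!v. v \<in> verts \<and> S \<subseteq> fac v \<and> (\<forall>F\<in>fac v - S. 0 < \<xi> \<bullet> W v F)"
proof -
  have Sf: "S \<subseteq> facets" using v0 fac_facets by auto
  define Q where "Q = P \<inter> \<Inter>S"
  have Qmem: "x \<in> Q \<longleftrightarrow> x \<in> P \<and> (\<forall>F\<in>S. lam F x = 0)" for x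
    unfolding Q_def using mem_facet_iff Sf by blast
  have Sfac: "S \<subseteq> fac x \<longleftrightarrow> x \<in> Q" if "x \<in> P" for x
    using that Qmem mem_fac_iff[OF that] Sf by blast
  have face: "Q face_of P"
  proof (cases "S = {}")
    case True
    thus ?thesis using face_of_refl[OF P_convex] by (simp add: Q_def)
  next
    case False
    have "\<Inter>S face_of P" using False Sf by (intro face_of_Inter) (auto simp: facets_def facet_of_imp_face_of)
    moreover have "\<Inter>S \<subseteq> P" using calculation by (rule face_of_imp_subset)
    ultimately show ?thesis by (simp add: Q_def Int_absorb1)
  qed
  define T where "T = verts \<inter> Q"
  have "finite T" using finite_verts by (simp add: T_def)
  moreover have "T \<noteq> {}" using v0 Sfac[OF verts_in_P] by (auto simp: T_def)
  ultimately obtain v where v: "v \<in> T" "\<And>w. w \<in> T \<Longrightarrow> \<xi> \<bullet> v \<le> \<xi> \<bullet> w"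
    by (metis arg_min_if_finite(1) arg_min_least)
  have vv: "v \<in> verts" "v \<in> Q" "v \<in> P" using v by (auto simp: T_def verts_in_P)
  have ge: "\<xi> \<bullet> v \<le> \<xi> \<bullet> x" if "x \<in> Q" for x
  proof -
    have "convex hull T \<subseteq> {x. \<xi> \<bullet> v \<le> \<xi> \<bullet> x}"
      by (rule hull_minimal) (use v in \<open>auto simp: convex_halfspace_ge\<close>)
    thus ?thesis using that convex_hull_verts_face[OF face] by (auto simp: T_def)
  qed
  have pos: "0 < \<xi> \<bullet> W v F" if F: "F \<in> fac v - S" for F
  proof -
    have Ff: "F \<in> fac v" "F \<notin> S" using F by auto
    have nn: "nrm K \<bullet> W v F \<ge> 0" if "K \<in> facets" "lam K v = 0" for K
    proof (cases "K = F")
      case True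
      thus ?thesis using nrm_W(1)[OF vv(1) Ff(1)] by simp
    next
      case False
      have "K \<in> fac v" using that mem_fac_iff[OF vv(3)] by simp
      thus ?thesis using nrm_W(2)[OF vv(1) Ff(1) _ False] by simp
    qed
    obtain e where e: "e > 0" "v + e *\<^sub>R W v F \<in> P" using move_into_P[OF vv(3) nn] by blast
    have "lam K (v + e *\<^sub>R W v F) = 0" if "K \<in> S" for K
    proof -
      have "K \<in> fac v" using that Sfac[OF vv(3)] vv by blast
      moreover have "K \<noteq> F" using that Ff by auto
      ultimately show ?thesis using nrm_W(2)[OF vv(1) Ff(1)] fac_lam by (simp add: lam_add)
    qed
    hence "v + e *\<^sub>R W v F \<in> Q" using e Qmem by blast
    hence "0 \<le> e * (\<xi> \<bullet> W v F)" using ge[of "v + e *\<^sub>R W v F"] by (simp add: inner_add_right)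
    hence "0 \<le> \<xi> \<bullet> W v F" using e(1) by (simp add: zero_le_mult_iff)
    moreover have "\<xi> \<bullet> W v F \<noteq> 0" using gen F vv by (auto simp: generic_def)
    ultimately show ?thesis by simp
  qed
  \<comment> \<open>A positive multiple of \<open>x - u\<close> is a combination of edge directions
    with the heights of \<open>x\<close> as coefficients. These are nonnegative and vanish for the
    facets in \<open>S\<close>, so positive slopes make a local minimum global and strict.\<close>
  have diff: "\<xi> \<bullet> u \<le> \<xi> \<bullet> x \<and> (\<xi> \<bullet> u = \<xi> \<bullet> x \<longrightarrow> x = u)"
    if u: "u \<in> verts" "S \<subseteq> fac u" "\<forall>F\<in>fac u - S. 0 < \<xi> \<bullet> W u F" and x: "x \<in> Q" for u x
  proof -
    obtain D where D: "D > 0" "\<And>x \<xi>. D * (\<xi> \<bullet> x - \<xi> \<bullet> u) = (\<Sum>K\<in>fac u. lam K x * (\<xi> \<bullet> W u K))"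
      using vertex_expansion_inner[OF u(1)] by blast
    have xP: "x \<in> P" and xS: "\<And>K. K \<in> S \<Longrightarrow> lam K x = 0" using x Qmem by blast+
    have nn: "0 \<le> lam K x * (\<xi> \<bullet> W u K)" if K: "K \<in> fac u" for K
    proof (cases "K \<in> S")
      case True
      thus ?thesis using xS by simp
    next
      case False
      hence "0 < \<xi> \<bullet> W u K" using u(3) K by blast
      thus ?thesis using lam_nonneg[OF fac_facets[OF K] xP] by simp
    qed
    have "0 \<le> D * (\<xi> \<bullet> x - \<xi> \<bullet> u)" unfolding D(2) by (intro sum_nonneg nn)
    hence le: "\<xi> \<bullet> u \<le> \<xi> \<bullet> x" using D(1) by (simp add: zero_le_mult_iff)
    have "x = u" if eq: "\<xi> \<bullet> u = \<xi> \<bullet> x"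
    proof (rule eq_vertex_if_lam_0[OF u(1)])
      fix K assume K: "K \<in> fac u"
      have "(\<Sum>K\<in>fac u. lam K x * (\<xi> \<bullet> W u K)) = 0" using D(2)[of \<xi> x] eq by simp
      hence z: "lam K x * (\<xi> \<bullet> W u K) = 0" using sum_nonneg_eq_0_iff[OF finite_fac nn] K by simp
      show "lam K x = 0"
      proof (cases "K \<in> S")
        case False
        hence "0 < \<xi> \<bullet> W u K" using u(3) K by blast
        thus ?thesis using z by simp
      qed (rule xS)
    qed
    thus ?thesis using le by blast
  qed
  show ?thesis
  proof (rule ex1I[of _ v])
    have Sv: "S \<subseteq> fac v" using Sfac[OF vv(3)] vv(2) by simp
    thus "v \<in> verts \<and> S \<subseteq> fac v \<and> (\<forall>F\<in>fac v - S. 0 < \<xi> \<bullet> W v F)"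
      using vv(1) pos by blast
    fix u assume u: "u \<in> verts \<and> S \<subseteq> fac u \<and> (\<forall>F\<in>fac u - S. 0 < \<xi> \<bullet> W u F)"
    have uQ: "u \<in> Q" using u Sfac[OF verts_in_P, of u] by blast
    have "\<forall>F\<in>fac v - S. 0 < \<xi> \<bullet> W v F" using pos by blast
    note dv = diff[OF vv(1) Sv this uQ]
    have "\<xi> \<bullet> u \<le> \<xi> \<bullet> v" using diff[of u v] u vv(2) by blast
    hence "\<xi> \<bullet> v = \<xi> \<bullet> u" using dv by linarith
    thus "u = v" using dv by simp
  qed
qed

text \<open>
  A factor is the indicator of \<open>lam F x \<ge> 0\<close> if \<open>\<xi>\<close> decreases along \<open>W v F\<close>, and minus the indicator of
  \<open>lam F x < 0\<close> otherwise; so \<open>\<xi>\<close> is maximal at \<open>v\<close> on the (flipped) cone where the product is nonzero.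
\<close>

definition sgn_term where
  "sgn_term \<xi> x v = (\<Prod>F\<in>fac v. of_bool (0 \<le> lam F x) - of_bool (0 < \<xi> \<bullet> W v F) :: real)"

text \<open>The right-hand side does not involve \<open>\<xi>\<close>, so \<open>\<xi>\<close> may be chosen depending on \<open>x\<close>.\<close>

lemma sum_sgn_term_expansion:
  assumes gen: "generic \<xi>"
  shows "(\<Sum>v\<in>verts. sgn_term \<xi> x v)
    = (\<Sum>S\<in>(\<Union>v\<in>verts. Pow (fac v)). (\<Prod>F\<in>S. of_bool (0 \<le> lam F x)) * (- 1) ^ (3 - card S))"
proof -
  define a :: "(real^3) set \<Rightarrow> real" where "a F = of_bool (0 \<le> lam F x)" for F
  define c :: "(real^3) set set \<Rightarrow> real" where "c S = prod a S * (- 1) ^ (3 - card S)" for S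
  define \<mu> :: "(real^3) set set \<Rightarrow> real^3 \<Rightarrow> real" where "\<mu> S v = of_bool (\<forall>F\<in>fac v - S. 0 < \<xi> \<bullet> W v F)" for S v
  define U where "U = (\<Union>v\<in>verts. Pow (fac v))"
  have U: "finite U" unfolding U_def using finite_verts by auto
  have "(\<Sum>v\<in>verts. sgn_term \<xi> x v)
    = (\<Sum>v\<in>verts. \<Sum>S\<in>Pow (fac v). prod a S * (\<Prod>F\<in>fac v - S. - of_bool (0 < \<xi> \<bullet> W v F)))"
    unfolding sgn_term_def a_def by (intro sum.cong refl, subst prod_add[symmetric]) auto
  also have "\<dots> = (\<Sum>v\<in>verts. \<Sum>S\<in>Pow (fac v). c S * \<mu> S v)"
  proof (intro sum.cong refl)
    fix v S assume v: "v \<in> verts" and S: "S \<in> Pow (fac v)"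
    have fS: "finite (fac v - S)" by simp
    have "(\<Prod>F\<in>fac v - S. - of_bool (0 < \<xi> \<bullet> W v F) :: real)
      = (\<Prod>F\<in>fac v - S. (- 1) * of_bool (0 < \<xi> \<bullet> W v F))" by simp
    also have "\<dots> = (- 1) ^ card (fac v - S) * (\<Prod>F\<in>fac v - S. of_bool (0 < \<xi> \<bullet> W v F))"
      unfolding prod.distrib by simp
    also have "card (fac v - S) = 3 - card S"
      using S card_fac[OF v] by (subst card_Diff_subset) (auto intro: finite_subset[OF _ finite_fac])
    also have "(\<Prod>F\<in>fac v - S. of_bool (0 < \<xi> \<bullet> W v F) :: real) = of_bool (\<forall>F\<in>fac v - S. 0 < \<xi> \<bullet> W v F)"
      using fS by (induction "fac v - S" rule: infinite_finite_induct) (auto simp: prod_zero_iff intro!: prod.neutral)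
    finally show "prod a S * (\<Prod>F\<in>fac v - S. - of_bool (0 < \<xi> \<bullet> W v F))
      = c S * \<mu> S v" by (simp add: c_def \<mu>_def)
  qed
  also have "\<dots> = (\<Sum>v\<in>verts. \<Sum>S\<in>U. if S \<subseteq> fac v then c S * \<mu> S v else 0)"
  proof (rule sum.cong[OF refl])
    fix v assume "v \<in> verts"
    hence eq: "Pow (fac v) = {S \<in> U. S \<subseteq> fac v}" by (auto simp: U_def)
    show "(\<Sum>S\<in>Pow (fac v). c S * \<mu> S v)
      = (\<Sum>S\<in>U. if S \<subseteq> fac v then c S * \<mu> S v else 0)"
      unfolding eq by (rule sum.inter_filter[OF U])
  qed
  also have "\<dots> = (\<Sum>S\<in>U. \<Sum>v\<in>verts. if S \<subseteq> fac v then c S * \<mu> S v else 0)"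
    by (rule sum.swap)
  also have "\<dots> = (\<Sum>S\<in>U. c S)"
  proof (intro sum.cong refl)
    fix S assume "S \<in> U"
    then obtain v0 where "v0 \<in> verts" "S \<subseteq> fac v0" by (auto simp: U_def)
    \<comment> \<open>Exactly one vertex passes the test for \<open>S\<close>, whatever \<xi> is;
      here \<xi> drops out.\<close>
    from ex1_iff_eq[OF unique_local_minimum[OF gen this]] obtain v where
      v: "\<forall>u. u \<in> verts \<and> S \<subseteq> fac u \<and> (\<forall>F\<in>fac u - S. 0 < \<xi> \<bullet> W u F) \<longleftrightarrow> u = v" ..
    have "(\<Sum>u\<in>verts. if S \<subseteq> fac u then c S * \<mu> S u else 0)
      = (\<Sum>u\<in>verts. if u = v then c S else 0)"
      using v by (intro sum.cong refl) (auto simp: \<mu>_def of_bool_def)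
    also have "\<dots> = c S" using v finite_verts by auto
    finally show "(\<Sum>u\<in>verts. if S \<subseteq> fac u then c S * \<mu> S u else 0)
      = c S" .
  qed
  finally show ?thesis unfolding U_def c_def a_def .
qed

lemma verts_nonempty: "verts \<noteq> {}"
  using convex_hull_verts_face[OF face_of_refl[OF P_convex]] full_dim by auto

text \<open>Inside \<open>P\<close> each factor is 0 or 1, and only the vertex maximising \<xi>
  survives. Outside, \<xi> may be exchanged for a direction \<eta> larger at \<open>x\<close> than
  at all vertices, whereas a nonzero term at \<open>v\<close> would force
  \<open>\<eta> \<bullet> x \<le> \<eta> \<bullet> v\<close>.\<close>

lemma sum_sgn_term:
  assumes gen: "generic \<xi>"
  shows "(\<Sum>v\<in>verts. sgn_term \<xi> x v) = of_bool (x \<in> P)"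
proof (cases "x \<in> P")
  case True
  obtain v0 where "v0 \<in> verts" using verts_nonempty by auto
  hence "\<exists>!u. u \<in> verts \<and> (\<forall>F\<in>fac u. 0 > \<xi> \<bullet> W u F)"
    using unique_local_minimum[OF generic_uminus[OF gen], of v0 "{}"] by simp
  from ex1_iff_eq[OF this] obtain v where
    v: "\<forall>u. u \<in> verts \<and> (\<forall>F\<in>fac u. 0 > \<xi> \<bullet> W u F) \<longleftrightarrow> u = v" ..
  have "sgn_term \<xi> x u = (if u = v then 1 else 0)" if u: "u \<in> verts" for u
  proof -
    have "sgn_term \<xi> x u = (\<Prod>F\<in>fac u. of_bool (\<xi> \<bullet> W u F < 0))"
      unfolding sgn_term_def
    proof (intro prod.cong refl)
      fix F assume F: "F \<in> fac u"
      hence "0 \<le> lam F x" "\<xi> \<bullet> W u F \<noteq> 0" using lam_nonneg fac_facets True gen u by (auto simp: generic_def)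
      thus "of_bool (0 \<le> lam F x) - of_bool (0 < \<xi> \<bullet> W u F) = (of_bool (\<xi> \<bullet> W u F < 0) :: real)"
        by auto
    qed
    also have "\<dots> = (if u = v then 1 else 0)"
      using spec[OF v, of u] u by (auto intro!: prod.neutral simp: prod_zero_iff)
    finally show ?thesis .
  qed
  thus ?thesis using True v finite_verts by auto
next
  case False
  obtain a b where ab: "a \<bullet> x < b" "\<forall>y\<in>P. a \<bullet> y > b"
    using separating_hyperplane_closed_point[OF P_convex P_closed False] by blast
  \<comment> \<open>The separating directions form an open set, which leaves room for a generic one
    near \<open>- a\<close>.\<close>
  define U where "U = (\<Inter>v\<in>verts. {\<eta>. (x - v) \<bullet> \<eta> > 0})"
  have "open U" unfolding U_def by (intro open_INT finite_verts ballI open_halfspace_gt)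
  moreover have "- a \<in> U"
    unfolding U_def using ab verts_in_P by (force simp: inner_diff_left inner_diff_right inner_commute)
  ultimately obtain \<eta> where eta: "\<eta> \<in> U" "generic \<eta>" using exists_generic[of U] by blast
  have "sgn_term \<eta> x v = 0" if v: "v \<in> verts" for v
  proof (rule ccontr)
    assume "sgn_term \<eta> x v \<noteq> 0"
    hence nz: "of_bool (0 \<le> lam F x) - of_bool (0 < \<eta> \<bullet> W v F) \<noteq> (0::real)" if "F \<in> fac v" for F
      using that by (auto simp: sgn_term_def)
    obtain D where D: "D > 0" "\<And>x \<xi>. D * (\<xi> \<bullet> x - \<xi> \<bullet> v) = (\<Sum>K\<in>fac v. lam K x * (\<xi> \<bullet> W v K))"
      using vertex_expansion_inner[OF v] by blast
    have "lam K x * (\<eta> \<bullet> W v K) \<le> 0" if "K \<in> fac v" for K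
      using nz[OF that] by (auto simp: mult_le_0_iff of_bool_def split: if_splits)
    hence "D * (\<eta> \<bullet> x - \<eta> \<bullet> v) \<le> 0" unfolding D(2) by (intro sum_nonpos)
    hence "\<eta> \<bullet> x \<le> \<eta> \<bullet> v" using D(1) by (simp add: mult_le_0_iff)
    moreover have "(x - v) \<bullet> \<eta> > 0" using eta(1) v by (auto simp: U_def)
    hence "\<eta> \<bullet> x > \<eta> \<bullet> v" using inner_commute[of x \<eta>] inner_commute[of v \<eta>] by (simp add: inner_diff_left)
    ultimately show False by simp
  qed
  hence "(\<Sum>v\<in>verts. sgn_term \<eta> x v) = 0" by simp
  moreover have "(\<Sum>v\<in>verts. sgn_term \<xi> x v) = (\<Sum>v\<in>verts. sgn_term \<eta> x v)"
    unfolding sum_sgn_term_expansion[OF gen] sum_sgn_term_expansion[OF eta(2)] ..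
  ultimately show ?thesis using False by simp
qed

end

section \<open>The exponential sum over the lattice points\<close>

lemma has_sum_sum:
  fixes f :: "'i \<Rightarrow> 'a \<Rightarrow> real"
  assumes "\<And>i. i \<in> I \<Longrightarrow> (f i has_sum s i) A"
  shows "((\<lambda>x. \<Sum>i\<in>I. f i x) has_sum (\<Sum>i\<in>I. s i)) A"
  using assms by (induction I rule: infinite_finite_induct) (auto intro: has_sum_add)

lemma finite_int_lattice_bounded:
  assumes "bounded S" shows "finite (int_lattice \<inter> S)"
proof -
  obtain r where r: "\<And>x. x \<in> S \<Longrightarrow> norm x \<le> r" using assms by (auto simp: bounded_iff)
  define R where "R = \<lceil>r\<rceil>"
  define f :: "real^3 \<Rightarrow> int \<times> int \<times> int" where "f x = (\<lfloor>x $ 1\<rfloor>, \<lfloor>x $ 2\<rfloor>, \<lfloor>x $ 3\<rfloor>)" for x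
  have fl: "of_int \<lfloor>x $ i\<rfloor> = x $ i" if "x \<in> int_lattice" for x :: "real^3" and i
    using that by (auto simp: int_lattice_def elim: Ints_cases)
  have inj: "inj_on f (int_lattice \<inter> S)"
  proof (rule inj_onI)
    fix x y assume xy: "x \<in> int_lattice \<inter> S" "y \<in> int_lattice \<inter> S" "f x = f y"
    have "x $ i = y $ i" for i
    proof -
      have "\<lfloor>x $ i\<rfloor> = \<lfloor>y $ i\<rfloor>" using xy(3) exhaust_3[of i] by (auto simp: f_def)
      thus ?thesis using fl xy by (metis IntD1)
    qed
    thus "x = y" by (simp add: vec_eq_iff)
  qed
  have "\<lfloor>x $ i\<rfloor> \<in> {-R..R}" if "x \<in> int_lattice \<inter> S" for x and i :: 3
  proof -
    have "\<bar>x $ i\<bar> \<le> r" using r[of x] component_le_norm_cart[of x i] that by simp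
    thus ?thesis unfolding R_def by (auto simp: le_floor_iff floor_le_iff) linarith+
  qed
  hence "f ` (int_lattice \<inter> S) \<subseteq> Sigma {-R..R} (\<lambda>_. Sigma {-R..R} (\<lambda>_. {-R..R}))"
    unfolding f_def by (intro image_subsetI SigmaI)
  hence "finite (f ` (int_lattice \<inter> S))" by (rule finite_subset) simp
  thus ?thesis using inj finite_imageD by blast
qed

text \<open>Translates of the half-open parallelepiped tile space. Each height of
  \<open>x - u\<close> is divided by the determinant: the floor of the quotient is the coefficient
  of a generator, and the remainder is a height of the box point.\<close>

lemma lattice_cone_bij:
  fixes n1 n2 n3 u :: "real^3"
  assumes int: "n1 \<in> int_lattice" "n2 \<in> int_lattice" "n3 \<in> int_lattice" "u \<in> int_lattice"
    and D: "n1 \<bullet> (n2 \<times> n3) > 0"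
  shows "bij_betw (\<lambda>(g, i, j, k). u + g + of_int i *\<^sub>R (n2 \<times> n3) + of_int j *\<^sub>R (n3 \<times> n1) + of_int k *\<^sub>R (n1 \<times> n2))
    (Sigma (box_points n1 n2 n3) (\<lambda>_. UNIV)) int_lattice"
proof -
  define D where "D = n1 \<bullet> (n2 \<times> n3)"
  define X where "X = (\<lambda>(g, i, j, k). u + g + of_int i *\<^sub>R (n2 \<times> n3) + of_int j *\<^sub>R (n3 \<times> n1) + of_int k *\<^sub>R (n1 \<times> n2))"
  define fl where "fl n x = \<lfloor>n \<bullet> (x - u) / D\<rfloor>" for n x
  define g where "g x = x - u - (of_int (fl n1 x) *\<^sub>R (n2 \<times> n3) + of_int (fl n2 x) *\<^sub>R (n3 \<times> n1) + of_int (fl n3 x) *\<^sub>R (n1 \<times> n2))" for x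
  have D0: "D > 0" using D by (simp add: D_def)
  have rot: "n1 \<bullet> (n2 \<times> n3) = D" "n2 \<bullet> (n3 \<times> n1) = D" "n3 \<bullet> (n1 \<times> n2) = D"
    by (simp_all add: D_def triple_rotate(1)[of n2 n3 n1] triple_rotate(2)[of n3 n1 n2])
  have z: "n1 \<bullet> (n3 \<times> n1) = 0" "n1 \<bullet> (n1 \<times> n2) = 0" "n2 \<bullet> (n2 \<times> n3) = 0" "n2 \<bullet> (n1 \<times> n2) = 0"
    "n3 \<bullet> (n2 \<times> n3) = 0" "n3 \<bullet> (n3 \<times> n1) = 0" by (simp_all add: dot_cross_self)
  have inn: "n1 \<bullet> (X (h, i, j, k) - u) = n1 \<bullet> h + D * of_int i"
    "n2 \<bullet> (X (h, i, j, k) - u) = n2 \<bullet> h + D * of_int j"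
    "n3 \<bullet> (X (h, i, j, k) - u) = n3 \<bullet> h + D * of_int k" for h i j k
    by (simp_all add: X_def inner_add_right inner_diff_right rot z)
  have box: "h \<in> box_points n1 n2 n3 \<longleftrightarrow> h \<in> int_lattice \<and> (0 \<le> n1 \<bullet> h \<and> n1 \<bullet> h < D)
    \<and> (0 \<le> n2 \<bullet> h \<and> n2 \<bullet> h < D) \<and> (0 \<le> n3 \<bullet> h \<and> n3 \<bullet> h < D)" for h
    using D0 by (auto simp: box_points_def D_def)
  have "bij_betw X (Sigma (box_points n1 n2 n3) (\<lambda>_. UNIV)) int_lattice"
  proof (rule bij_betw_byWitness[of _ "\<lambda>x. (g x, fl n1 x, fl n2 x, fl n3 x)"])
    show "\<forall>p\<in>Sigma (box_points n1 n2 n3) (\<lambda>_. UNIV). (g (X p), fl n1 (X p), fl n2 (X p), fl n3 (X p)) = p"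
    proof
      fix p assume "p \<in> Sigma (box_points n1 n2 n3) (\<lambda>_. UNIV :: (int \<times> int \<times> int) set)"
      then obtain h i j k where p: "p = (h, i, j, k)" "h \<in> box_points n1 n2 n3" by auto
      have fl_eq: "\<lfloor>(a + D * of_int m) / D\<rfloor> = m" if "0 \<le> a" "a < D" for a m
      proof -
        have "(a + D * of_int m) / D = a / D + of_int m" using D0 by (simp add: field_simps)
        moreover have "\<lfloor>a / D\<rfloor> = 0" using that D0 by (simp add: floor_eq_iff)
        ultimately show ?thesis by simp
      qed
      have "fl n1 (X p) = i" "fl n2 (X p) = j" "fl n3 (X p) = k"
        unfolding fl_def p(1) inn using p(2) box by (auto intro!: fl_eq)
      moreover have "g (X p) = h" unfolding g_def calculation by (simp add: X_def p(1))
      ultimately show "(g (X p), fl n1 (X p), fl n2 (X p), fl n3 (X p)) = p" by (simp add: p(1))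
    qed
    show "\<forall>x\<in>int_lattice. X (g x, fl n1 x, fl n2 x, fl n3 x) = x" by (simp add: X_def g_def)
    show "X ` Sigma (box_points n1 n2 n3) (\<lambda>_. UNIV) \<subseteq> int_lattice"
      using int by (auto simp: X_def box)
    show "(\<lambda>x. (g x, fl n1 x, fl n2 x, fl n3 x)) ` int_lattice \<subseteq> Sigma (box_points n1 n2 n3) (\<lambda>_. UNIV)"
    proof
      fix p assume "p \<in> (\<lambda>x. (g x, fl n1 x, fl n2 x, fl n3 x)) ` int_lattice"
      then obtain x where x: "x \<in> int_lattice" "p = (g x, fl n1 x, fl n2 x, fl n3 x)" by auto
      have fl_le: "0 \<le> a - D * of_int \<lfloor>a / D\<rfloor> \<and> a - D * of_int \<lfloor>a / D\<rfloor> < D" for a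
      proof -
        have "of_int \<lfloor>a / D\<rfloor> * D \<le> a / D * D" using D0 by (intro mult_right_mono) auto
        moreover have "a / D * D < (of_int \<lfloor>a / D\<rfloor> + 1) * D"
          using D0 by (intro mult_strict_right_mono) linarith+
        ultimately show ?thesis using D0 by (simp add: algebra_simps)
      qed
      have "n1 \<bullet> g x = n1 \<bullet> (x - u) - D * of_int (fl n1 x)"
        "n2 \<bullet> g x = n2 \<bullet> (x - u) - D * of_int (fl n2 x)"
        "n3 \<bullet> g x = n3 \<bullet> (x - u) - D * of_int (fl n3 x)"
        by (simp_all add: g_def inner_add_right inner_diff_right rot z)
      hence "g x \<in> box_points n1 n2 n3"
        unfolding box using fl_le x(1) int by (auto simp: fl_def g_def)
      thus "p \<in> Sigma (box_points n1 n2 n3) (\<lambda>_. UNIV)" using x by simp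
    qed
  qed
  thus ?thesis by (simp add: X_def)
qed

text \<open>Box points have heights from 0 to below \<open>D\<close>, so the sign of each
  \<open>n \<bullet> (x - u)\<close> is decided by the integer coefficient of the generator alone.
  Hence the series factors into a finite sum over the box and three geometric series.\<close>

lemma has_sum_lattice_cone:
  fixes n1 n2 n3 u \<xi> :: "real^3"
  assumes int: "n1 \<in> int_lattice" "n2 \<in> int_lattice" "n3 \<in> int_lattice" "u \<in> int_lattice"
    and D: "n1 \<bullet> (n2 \<times> n3) > 0" and fin: "finite (box_points n1 n2 n3)"
    and X: "X1 = \<xi> \<bullet> (n2 \<times> n3)" "X2 = \<xi> \<bullet> (n3 \<times> n1)" "X3 = \<xi> \<bullet> (n1 \<times> n2)"
    and X0: "X1 \<noteq> 0" "X2 \<noteq> 0" "X3 \<noteq> 0"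
  defines "D \<equiv> n1 \<bullet> (n2 \<times> n3)"
  shows "((\<lambda>x. (of_bool (0 \<le> n1 \<bullet> (x - u)) - of_bool (0 < X1)) * (of_bool (0 \<le> n2 \<bullet> (x - u)) - of_bool (0 < X2))
      * (of_bool (0 \<le> n3 \<bullet> (x - u)) - of_bool (0 < X3)) * exp (\<xi> \<bullet> x)) has_sum
    exp (\<xi> \<bullet> u) * (\<Sum>g\<in>box_points n1 n2 n3. (exp ((n1 \<bullet> g) / D * X1) / (1 - exp X1))
      * (exp ((n2 \<bullet> g) / D * X2) / (1 - exp X2)) * (exp ((n3 \<bullet> g) / D * X3) / (1 - exp X3)))) int_lattice"
proof -
  define f :: "real^3 \<Rightarrow> real" where "f = (\<lambda>x. (of_bool (0 \<le> n1 \<bullet> (x - u)) - of_bool (0 < X1)) * (of_bool (0 \<le> n2 \<bullet> (x - u)) - of_bool (0 < X2))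
      * (of_bool (0 \<le> n3 \<bullet> (x - u)) - of_bool (0 < X3)) * exp (\<xi> \<bullet> x))"
  define \<kappa> where "\<kappa> = 1 / (1 - exp X1) * (1 / (1 - exp X2) * (1 / (1 - exp X3)))"
  define \<Phi> where "\<Phi> = (\<lambda>(g, i, j, k). u + g + of_int i *\<^sub>R (n2 \<times> n3) + of_int j *\<^sub>R (n3 \<times> n1) + of_int k *\<^sub>R (n1 \<times> n2))"
  have D0: "D > 0" using assms by simp
  have rot: "n1 \<bullet> (n2 \<times> n3) = D" "n2 \<bullet> (n3 \<times> n1) = D" "n3 \<bullet> (n1 \<times> n2) = D"
    by (simp_all add: D_def triple_rotate(1)[of n2 n3 n1] triple_rotate(2)[of n3 n1 n2])
  have z: "n1 \<bullet> (n3 \<times> n1) = 0" "n1 \<bullet> (n1 \<times> n2) = 0" "n2 \<bullet> (n2 \<times> n3) = 0" "n2 \<bullet> (n1 \<times> n2) = 0"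
    "n3 \<bullet> (n2 \<times> n3) = 0" "n3 \<bullet> (n3 \<times> n1) = 0" by (simp_all add: dot_cross_self)
  define h where "h Y = (\<lambda>n::int. (of_bool (0 \<le> n) - of_bool (0 < Y)) * exp (of_int n * Y))" for Y :: real
  define E where "E g = exp (\<xi> \<bullet> u) * exp (\<xi> \<bullet> g)" for g
  have h: "(h Y has_sum 1 / (1 - exp Y)) UNIV" if "Y \<noteq> 0" for Y
    unfolding h_def using that by (rule has_sum_exp_int)
  note prod = has_sum_product_real[OF h[OF X0(1)] has_sum_product_real[OF h[OF X0(2)] h[OF X0(3)]]]
  from has_sum_product_real[OF has_sum_finite[OF fin, of E] prod]
  have "((\<lambda>(g, i, j, k). E g * (h X1 i * (h X2 j * h X3 k))) has_sum
    (\<Sum>g\<in>box_points n1 n2 n3. E g) * \<kappa>)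
    (Sigma (box_points n1 n2 n3) (\<lambda>_. UNIV))"
    by (simp add: case_prod_unfold \<kappa>_def)
  moreover have "(\<lambda>(g, i, j, k). E g * (h X1 i * (h X2 j * h X3 k))) p =
      f (\<Phi> p)"
    if p: "p \<in> Sigma (box_points n1 n2 n3) (\<lambda>_. UNIV)" for p
  proof -
    obtain g i j k where pe: "p = (g, i, j, k)" by (metis surj_pair)
    have g: "g \<in> box_points n1 n2 n3" using p pe by simp
    hence b: "0 \<le> n1 \<bullet> g" "n1 \<bullet> g < D" "0 \<le> n2 \<bullet> g" "n2 \<bullet> g < D" "0 \<le> n3 \<bullet> g" "n3 \<bullet> g < D"
      using D0 by (auto simp: box_points_def D_def)
    have inn: "n1 \<bullet> (\<Phi> p - u) = n1 \<bullet> g + D * of_int i" "n2 \<bullet> (\<Phi> p - u) = n2 \<bullet> g + D * of_int j"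
      "n3 \<bullet> (\<Phi> p - u) = n3 \<bullet> g + D * of_int k"
      by (simp_all add: \<Phi>_def pe inner_add_right inner_diff_right rot z)
    have sg: "0 \<le> a + D * of_int m \<longleftrightarrow> 0 \<le> m" if "0 \<le> a" "a < D" for a and m :: int
    proof
      assume "0 \<le> m" thus "0 \<le> a + D * of_int m" using that D0 by simp
    next
      assume a: "0 \<le> a + D * of_int m"
      show "0 \<le> m"
      proof (rule ccontr)
        assume "\<not> 0 \<le> m"
        hence "real_of_int m \<le> - 1" by linarith
        hence "D * of_int m \<le> D * (- 1)" using D0 by (intro mult_left_mono) auto
        thus False using a that by simp
      qed
    qed
    have "\<xi> \<bullet> \<Phi> p = \<xi> \<bullet> u + \<xi> \<bullet> g + of_int i * X1 + of_int j * X2 + of_int k * X3"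
      by (simp add: \<Phi>_def pe inner_add_right X)
    hence "exp (\<xi> \<bullet> \<Phi> p) = E g * (exp (of_int i * X1) * exp (of_int j * X2) * exp (of_int k * X3))"
      by (simp add: E_def exp_add mult_ac)
    thus ?thesis unfolding f_def inn sg[OF b(1,2)] sg[OF b(3,4)] sg[OF b(5,6)] by (simp add: f_def pe h_def mult_ac)
  qed
  ultimately have "((\<lambda>p. f (\<Phi> p)) has_sum
      (\<Sum>g\<in>box_points n1 n2 n3. E g) * \<kappa>)
      (Sigma (box_points n1 n2 n3) (\<lambda>_. UNIV))"
    by (subst has_sum_cong[symmetric]) (assumption+)
  hence "(f has_sum
      (\<Sum>g\<in>box_points n1 n2 n3. E g) * \<kappa>) int_lattice"
    unfolding \<Phi>_def by (subst (asm) has_sum_reindex_bij_betw[OF lattice_cone_bij[OF int D]])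
  moreover have "(\<Sum>g\<in>box_points n1 n2 n3. E g) * \<kappa>
    = exp (\<xi> \<bullet> u) * (\<Sum>g\<in>box_points n1 n2 n3. (exp ((n1 \<bullet> g) / D * X1) / (1 - exp X1))
      * (exp ((n2 \<bullet> g) / D * X2) / (1 - exp X2)) * (exp ((n3 \<bullet> g) / D * X3) / (1 - exp X3)))"
    unfolding sum_distrib_left sum_distrib_right
  proof (intro sum.cong refl)
    fix g
    have "D *\<^sub>R g = (n1 \<bullet> g) *\<^sub>R (n2 \<times> n3) + (n2 \<bullet> g) *\<^sub>R (n3 \<times> n1) + (n3 \<bullet> g) *\<^sub>R (n1 \<times> n2)"
      using triple_dual_expansion[of n1 n2 n3 g] by (simp add: D_def)
    hence "\<xi> \<bullet> (D *\<^sub>R g) = (n1 \<bullet> g) * X1 + (n2 \<bullet> g) * X2 + (n3 \<bullet> g) * X3"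
      by (simp only: inner_add_right inner_scaleR_right X)
    hence "\<xi> \<bullet> g = (n1 \<bullet> g) / D * X1 + (n2 \<bullet> g) / D * X2 + (n3 \<bullet> g) / D * X3"
      using D0 by (simp add: field_simps)
    thus "E g * \<kappa>
      = exp (\<xi> \<bullet> u) * ((exp ((n1 \<bullet> g) / D * X1) / (1 - exp X1))
      * (exp ((n2 \<bullet> g) / D * X2) / (1 - exp X2)) * (exp ((n3 \<bullet> g) / D * X3) / (1 - exp X3)))"
      by (simp add: E_def exp_add \<kappa>_def)
  qed
  ultimately show ?thesis by (simp add: f_def)
qed

section \<open>Brion's formula and its expansion at the vertices\<close>

context simple_lattice_polytope
begin

definition cell where
  "cell v = {x \<in> int_lattice. \<forall>K\<in>fac v. 0 \<le> nrm K \<bullet> x \<and> nrm K \<bullet> x < nrm K \<bullet> W v K}"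

text \<open>The coefficient of \<open>W v K\<close> when \<open>x\<close> is written in the three
  edge vectors at \<open>v\<close>.\<close>

definition coord where "coord v K x = (nrm K \<bullet> x) / (nrm K \<bullet> W v K)"

lemma nrm_W_eq_det:
  assumes "ori v F G H"
  shows "nrm F \<bullet> W v F = nrm F \<bullet> (nrm G \<times> nrm H)" "nrm G \<bullet> W v G = nrm F \<bullet> (nrm G \<times> nrm H)"
    "nrm H \<bullet> W v H = nrm F \<bullet> (nrm G \<times> nrm H)"
  by (simp_all add: W_eq[OF assms] triple_rotate(1)[of "nrm G" "nrm H" "nrm F"] triple_rotate(2)[of "nrm H" "nrm F" "nrm G"])

lemma cell_eq_box_points: "ori v F G H \<Longrightarrow> cell v = box_points (nrm F) (nrm G) (nrm H)"
  using nrm_W_eq_det[of v F G H] oriD(2,3)[of v F G H] unfolding cell_def box_points_def by auto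

lemma ori_normal_basis:
  assumes o: "ori v F G H" obtains e p q where "normal_basis (nrm F) (nrm G) e p q"
proof -
  have "nrm F \<times> nrm G \<noteq> 0" using W_eq(3)[OF o] W_nonzero[of v H] oriD[OF o] by auto
  thus ?thesis using normal_basis_exists[of "nrm F" "nrm G"] nrm_primitive oriD(7,8)[OF o] that by (metis nrm_int)
qed

lemma cell_sums:
  assumes o: "ori v F G H" and nb: "normal_basis (nrm F) (nrm G) e p q"
  shows "finite (cell v)" "(\<Sum>x\<in>cell v. bern2 (coord v F x)) = 1/6"
proof -
  define D where "D = nrm F \<bullet> (nrm G \<times> nrm H)"
  have D: "D > 0" using oriD(3)[OF o] by (simp add: D_def)
  have int: "nrm F \<in> int_lattice" "e \<in> int_lattice" "nrm H \<in> int_lattice" and pr: "primitive (nrm F \<times> e)"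
    and q: "q > 0" and w: "nrm G = of_int p *\<^sub>R nrm F + of_int q *\<^sub>R e"
    using nb oriD(7,8,9)[OF o] by (auto simp: normal_basis_def)
  have co: "coord v F x = (nrm F \<bullet> x) / \<bar>D\<bar>" for x
    using nrm_W_eq_det[OF o] D by (simp add: coord_def D_def)
  have nz: "nrm F \<bullet> (nrm G \<times> nrm H) \<noteq> 0" using D by (simp add: D_def)
  show "finite (cell v)" unfolding cell_eq_box_points[OF o] using sum_box_points[OF int pr q w nz] by blast
  show "(\<Sum>x\<in>cell v. bern2 (coord v F x)) = 1/6"
    unfolding cell_eq_box_points[OF o] co D_def by (rule box_points_bern_sums(1)[OF int pr q w nz])
qed

lemma finite_cell: "v \<in> verts \<Longrightarrow> finite (cell v)"
  by (metis ori_exists' ori_normal_basis cell_sums(1))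

lemma lam_scale:
  assumes "v \<in> verts" "K \<in> fac v" "l > 0"
  shows "0 \<le> lam K ((1 / l) *\<^sub>R x) \<longleftrightarrow> 0 \<le> nrm K \<bullet> (x - l *\<^sub>R v)"
proof -
  have "lam K ((1 / l) *\<^sub>R x) = nrm K \<bullet> ((1 / l) *\<^sub>R x - v)" by (rule fac_lam_eq[OF assms(2)])
  also have "(1 / l) *\<^sub>R x - v = (1 / l) *\<^sub>R (x - l *\<^sub>R v)" using assms(3) by (simp add: scaleR_diff_right)
  finally show ?thesis using assms(3) by (simp add: zero_le_divide_iff)
qed

text \<open>The exponential sum over the flipped tangent cone at \<open>v\<close>, moved so that its
  apex is the origin.\<close>

definition vertex_sum where
  "vertex_sum \<xi> v = (\<Sum>g\<in>cell v. \<Prod>K\<in>fac v. exp (coord v K g * (\<xi> \<bullet> W v K)) / (1 - exp (\<xi> \<bullet> W v K)))"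

text \<open>The share of \<open>K\<close> in minus the \<open>t\<^sup>2\<close> coefficient of
  \<open>t ^ 3 * vertex_sum (t *\<^sub>R \<xi>) v\<close>: the quadratic Bernoulli polynomial for
  \<open>K\<close> itself, and the two linear ones for the other facets. The 12 is 2 factorial from
  the expansion times the 6 from the sum of \<open>bern2\<close> over the cell.\<close>

definition vertex_coeff where
  "vertex_coeff \<xi> v K = (\<xi> \<bullet> W v K) / (12 * (\<Prod>J\<in>fac v - {K}. \<xi> \<bullet> W v J))
    + (\<Sum>g\<in>cell v. \<Prod>J\<in>fac v - {K}. bern1 (coord v J g)) / (\<xi> \<bullet> W v K)"

lemma has_sum_vertex:
  fixes l :: nat
  assumes gen: "generic \<xi>" and v: "v \<in> verts" and l: "l \<ge> 1"
  shows "((\<lambda>x. sgn_term \<xi> ((1 / real l) *\<^sub>R x) v * exp (\<xi> \<bullet> x)) has_sum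
    exp (real l * (\<xi> \<bullet> v)) * vertex_sum \<xi> v) int_lattice"
proof -
  obtain F G H where o: "ori v F G H" using ori_exists'[OF v] by blast
  note oD = oriD[OF o]
  have lv: "real l *\<^sub>R v \<in> int_lattice" using verts_int_lattice[OF v] by simp
  have fin: "finite (box_points (nrm F) (nrm G) (nrm H))" using finite_cell[OF v] cell_eq_box_points[OF o] by simp
  have X0: "\<xi> \<bullet> W v F \<noteq> 0" "\<xi> \<bullet> W v G \<noteq> 0" "\<xi> \<bullet> W v H \<noteq> 0" using gen v oD by (auto simp: generic_def)
  have l0: "real l > 0" using l by simp
  have sg: "sgn_term \<xi> ((1 / real l) *\<^sub>R x) v = (of_bool (0 \<le> nrm F \<bullet> (x - real l *\<^sub>R v)) - of_bool (0 < \<xi> \<bullet> W v F))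
    * (of_bool (0 \<le> nrm G \<bullet> (x - real l *\<^sub>R v)) - of_bool (0 < \<xi> \<bullet> W v G))
    * (of_bool (0 \<le> nrm H \<bullet> (x - real l *\<^sub>R v)) - of_bool (0 < \<xi> \<bullet> W v H))" for x
  proof -
    have "sgn_term \<xi> ((1 / real l) *\<^sub>R x) v = (\<Prod>K\<in>fac v. of_bool (0 \<le> nrm K \<bullet> (x - real l *\<^sub>R v)) - of_bool (0 < \<xi> \<bullet> W v K))"
      unfolding sgn_term_def by (intro prod.cong refl) (simp only: lam_scale[OF v _ l0])
    thus ?thesis using oD(4,5,6) by (simp only: oD(2)) (simp add: mult.assoc)
  qed
  have pr: "(\<Prod>K\<in>fac v. exp (coord v K g * (\<xi> \<bullet> W v K)) / (1 - exp (\<xi> \<bullet> W v K)))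
    = (exp (coord v F g * (\<xi> \<bullet> W v F)) / (1 - exp (\<xi> \<bullet> W v F)))
      * (exp (coord v G g * (\<xi> \<bullet> W v G)) / (1 - exp (\<xi> \<bullet> W v G)))
      * (exp (coord v H g * (\<xi> \<bullet> W v H)) / (1 - exp (\<xi> \<bullet> W v H)))" for g
    using oD(4,5,6) by (simp only: oD(2)) (simp add: mult.assoc)
  have co: "coord v F g = nrm F \<bullet> g / (nrm F \<bullet> (nrm G \<times> nrm H))"
    "coord v G g = nrm G \<bullet> g / (nrm F \<bullet> (nrm G \<times> nrm H))"
    "coord v H g = nrm H \<bullet> g / (nrm F \<bullet> (nrm G \<times> nrm H))" for g
    using nrm_W_eq_det[OF o] by (simp_all add: coord_def)
  have ex: "exp (real l * (\<xi> \<bullet> v)) = exp (\<xi> \<bullet> (real l *\<^sub>R v))" by simp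
  show ?thesis
    unfolding vertex_sum_def sg pr cell_eq_box_points[OF o] co ex
    by (rule has_sum_lattice_cone[OF nrm_int[OF oD(7)] nrm_int[OF oD(8)] nrm_int[OF oD(9)] lv oD(3) fin])
      (use X0 W_eq[OF o] in simp_all)
qed

definition dilate_points where
  "dilate_points l = (\<lambda>x. real l *\<^sub>R x) ` P \<inter> int_lattice"

lemma finite_dilate_points: "finite (dilate_points l)"
proof -
  have "bounded ((\<lambda>x. real l *\<^sub>R x) ` P)"
    using P_compact by (intro bounded_scaling compact_imp_bounded)
  thus ?thesis unfolding dilate_points_def by (metis finite_int_lattice_bounded inf_commute)
qed

text \<open>One absolutely convergent lattice sum evaluated in two ways: pointwise by the signed
  decomposition at \<open>x / l\<close>, and vertex by vertex.\<close>

lemma exp_sum_dilate_points: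
  fixes l :: nat
  assumes gen: "generic \<xi>" and l: "l \<ge> 1"
  shows "(\<Sum>x\<in>dilate_points l. exp (\<xi> \<bullet> x)) = (\<Sum>v\<in>verts. exp (real l * (\<xi> \<bullet> v)) * vertex_sum \<xi> v)"
proof -
  have l0: "real l \<noteq> 0" using l by simp
  have mem: "(1 / real l) *\<^sub>R x \<in> P \<longleftrightarrow> x \<in> (\<lambda>x. real l *\<^sub>R x) ` P" for x
    using l0 by (auto simp: image_iff intro!: bexI[of _ "(1 / real l) *\<^sub>R x"])
  have "((\<lambda>x. \<Sum>v\<in>verts. sgn_term \<xi> ((1 / real l) *\<^sub>R x) v * exp (\<xi> \<bullet> x)) has_sum
    (\<Sum>v\<in>verts. exp (real l * (\<xi> \<bullet> v)) * vertex_sum \<xi> v)) int_lattice"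
    by (intro has_sum_sum has_sum_vertex gen l)
  moreover have "(\<Sum>v\<in>verts. sgn_term \<xi> ((1 / real l) *\<^sub>R x) v * exp (\<xi> \<bullet> x))
    = of_bool (x \<in> (\<lambda>x. real l *\<^sub>R x) ` P) * exp (\<xi> \<bullet> x)" for x
    by (simp only: sum_distrib_right[symmetric] sum_sgn_term[OF gen] mem)
  ultimately have "((\<lambda>x. of_bool (x \<in> (\<lambda>x. real l *\<^sub>R x) ` P) * exp (\<xi> \<bullet> x)) has_sum
    (\<Sum>v\<in>verts. exp (real l * (\<xi> \<bullet> v)) * vertex_sum \<xi> v)) int_lattice" by simp
  moreover have "((\<lambda>x. of_bool (x \<in> (\<lambda>x. real l *\<^sub>R x) ` P) * exp (\<xi> \<bullet> x)) has_sum
    (\<Sum>x\<in>dilate_points l. exp (\<xi> \<bullet> x))) int_lattice"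
    using has_sum_finite[OF finite_dilate_points, of "\<lambda>x. exp (\<xi> \<bullet> x)" l]
    by (rule has_sum_cong_neutral[THEN iffD1, rotated -1]) (auto simp: dilate_points_def)
  ultimately show ?thesis using has_sum_unique by blast
qed

text \<open>Each generator contributes a simple pole, cancelled by one factor \<open>t\<close>. Only
  the \<open>t\<^sup>2\<close> coefficient is named, since it alone enters the linear Ehrhart
  coefficient.\<close>

lemma expansion_vertex:
  assumes gen: "generic \<xi>" and o: "ori v F G H"
  shows "\<exists>r0 r1 r3. expansion (\<lambda>t. \<Sum>g\<in>cell v. \<Prod>K\<in>fac v. t * (exp (coord v K g * (t * (\<xi> \<bullet> W v K))) / (1 - exp (t * (\<xi> \<bullet> W v K)))))
    r0 r1 (- (\<Sum>K\<in>fac v. vertex_coeff \<xi> v K)) r3"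
proof -
  note oD = oriD[OF o]
  define X1 where "X1 = \<xi> \<bullet> W v F"
  define X2 where "X2 = \<xi> \<bullet> W v G"
  define X3 where "X3 = \<xi> \<bullet> W v H"
  have X0: "X1 \<noteq> 0" "X2 \<noteq> 0" "X3 \<noteq> 0" using gen oD by (auto simp: generic_def X1_def X2_def X3_def)
  define f where "f g X t = t * (exp (g * (t * X)) / (1 - exp (t * X)))" for g X t :: real
  have fe: "expansion (f g X) (- 1 / X) (- bern1 g) (- bern2 g * X / 2) (- (g ^ 3 - 3/2 * g\<^sup>2 + g / 2) * X\<^sup>2 / 6)"
    if "X \<noteq> 0" for g X
    unfolding f_def[abs_def] bern1_def bern2_def using that by (rule expansion_bernoulli)
  define a where "a = coord v F"
  define b where "b = coord v G"
  define c where "c = coord v H"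
  have prod3: "(\<Prod>K\<in>fac v. h K) = h F * (h G * h H)" for h :: "(real^3) set \<Rightarrow> real"
    unfolding oD(2) using oD(4,5,6) by simp
  have sum3: "(\<Sum>K\<in>fac v. h K) = h F + (h G + h H)" for h :: "(real^3) set \<Rightarrow> real"
    unfolding oD(2) using oD(4,5,6) by simp
  have dif: "fac v - {F} = {G, H}" "fac v - {G} = {F, H}" "fac v - {H} = {F, G}"
    unfolding oD(2) using oD(4,5,6) by auto
  have prod2: "(\<Prod>K\<in>fac v - {F}. h K) = h G * h H" "(\<Prod>K\<in>fac v - {G}. h K) = h F * h H"
    "(\<Prod>K\<in>fac v - {H}. h K) = h F * h G" for h :: "(real^3) set \<Rightarrow> real"
    unfolding dif using oD(4,5,6) by simp_all
  \<comment> \<open>The six ways to reach degree two in a product of three Bernoulli series: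
    \<open>bern2\<close> once, or \<open>bern1\<close> from two of the factors.\<close>
  define r2 where "r2 g = - (bern2 (a g) * X1 / (2 * X2 * X3) + bern2 (b g) * X2 / (2 * X1 * X3) + bern2 (c g) * X3 / (2 * X1 * X2)
      + bern1 (b g) * bern1 (c g) / X1 + bern1 (a g) * bern1 (c g) / X2 + bern1 (a g) * bern1 (b g) / X3)" for g
  have "\<exists>r0 r1 r3. expansion (\<lambda>t. f (a g) X1 t * (f (b g) X2 t * f (c g) X3 t)) r0 r1 (r2 g) r3" for g
    by (intro exI, rule expansion_eqI[OF expansion_mult[OF fe[OF X0(1)] expansion_mult[OF fe[OF X0(2)] fe[OF X0(3)]]] refl refl _ refl])
      (use X0 in \<open>simp add: r2_def field_simps\<close>)
  then obtain r0 r1 r3 where "expansion (\<lambda>t. f (a g) X1 t * (f (b g) X2 t * f (c g) X3 t)) (r0 g) (r1 g) (r2 g) (r3 g)" for g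
    by metis
  hence ex: "expansion (\<lambda>t. \<Sum>g\<in>cell v. f (a g) X1 t * (f (b g) X2 t * f (c g) X3 t))
      (\<Sum>g\<in>cell v. r0 g) (\<Sum>g\<in>cell v. r1 g) (\<Sum>g\<in>cell v. r2 g) (\<Sum>g\<in>cell v. r3 g)"
    by (intro expansion_sum)
  have b2: "(\<Sum>g\<in>cell v. bern2 (a g)) = 1/6" "(\<Sum>g\<in>cell v. bern2 (b g)) = 1/6" "(\<Sum>g\<in>cell v. bern2 (c g)) = 1/6"
    unfolding a_def b_def c_def
    using ori_normal_basis[OF o] cell_sums(2)[OF o] apply metis
    using ori_normal_basis[OF ori_rotate[OF o]] cell_sums(2)[OF ori_rotate[OF o]] apply metis
    using ori_normal_basis[OF ori_rotate[OF ori_rotate[OF o]]] cell_sums(2)[OF ori_rotate[OF ori_rotate[OF o]]] apply metis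
    done
  have "(\<Sum>g\<in>cell v. r2 g) = - ((\<Sum>g\<in>cell v. bern2 (a g)) * (X1 / (2 * X2 * X3)) + (\<Sum>g\<in>cell v. bern2 (b g)) * (X2 / (2 * X1 * X3))
      + (\<Sum>g\<in>cell v. bern2 (c g)) * (X3 / (2 * X1 * X2)) + (\<Sum>g\<in>cell v. bern1 (b g) * bern1 (c g)) * (1 / X1)
      + (\<Sum>g\<in>cell v. bern1 (a g) * bern1 (c g)) * (1 / X2) + (\<Sum>g\<in>cell v. bern1 (a g) * bern1 (b g)) * (1 / X3))"
    unfolding sum_distrib_right sum.distrib[symmetric] sum_negf[symmetric] r2_def
    by (intro sum.cong refl) simp
  also have "\<dots> = - (\<Sum>K\<in>fac v. vertex_coeff \<xi> v K)"
    unfolding vertex_coeff_def b2 sum3 prod2 by (simp add: X1_def X2_def X3_def a_def b_def c_def)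
  finally have r2: "(\<Sum>g\<in>cell v. r2 g) = \<dots>" .
  show ?thesis
    unfolding r2[symmetric] prod3 using ex
    unfolding f_def a_def b_def c_def X1_def X2_def X3_def by (intro exI)
qed

lemma linear_coefficient_vertex_sum:
  assumes gen: "generic \<xi>"
    and cubic: "\<And>l::nat. real (lattice_points P l) = c3 * real l ^ 3 + c2 * real l ^ 2 + c1 * real l + c0"
  shows "c1 = - (\<Sum>v\<in>verts. (\<xi> \<bullet> v) * (\<Sum>K\<in>fac v. vertex_coeff \<xi> v K))"
proof -
  define R where "R v t = (\<Sum>g\<in>cell v. \<Prod>K\<in>fac v. t * (exp (coord v K g * (t * (\<xi> \<bullet> W v K))) / (1 - exp (t * (\<xi> \<bullet> W v K)))))" for v t
  define r2 where "r2 v = - (\<Sum>K\<in>fac v. vertex_coeff \<xi> v K)" for v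
  have "\<forall>v\<in>verts. \<exists>r0 r1 r3. expansion (R v) r0 r1 (r2 v) r3"
  proof
    fix v assume "v \<in> verts"
    then obtain F G H where "ori v F G H" by (rule ori_exists')
    from expansion_vertex[OF gen this] show "\<exists>r0 r1 r3. expansion (R v) r0 r1 (r2 v) r3"
      unfolding R_def[abs_def] r2_def .
  qed
  then obtain r0 r1 r3 where ex: "\<And>v. v \<in> verts \<Longrightarrow> expansion (R v) (r0 v) (r1 v) (r2 v) (r3 v)" by metis
  have "c1 = (\<Sum>v\<in>verts. (\<xi> \<bullet> v) * r2 v)"
  proof (rule linear_coefficient_of_exponential_sum[OF ex])
    fix l :: nat assume l: "l \<ge> 1"
    \<comment> \<open>As \<open>t\<close> tends to 0 every exponential tends to 1, and the sum
      counts the lattice points of \<open>l P\<close>.\<close>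
    have "((\<lambda>t. \<Sum>x\<in>dilate_points l. exp (t * (\<xi> \<bullet> x))) \<longlongrightarrow> (\<Sum>x\<in>dilate_points l. exp (0 * (\<xi> \<bullet> x)))) (at_right 0)"
      by (intro tendsto_intros)
    moreover have "(\<Sum>x\<in>dilate_points l. exp (0 * (\<xi> \<bullet> x))) = c3 * real l ^ 3 + c2 * (real l)\<^sup>2 + c1 * real l + c0"
      using cubic[of l] by (simp add: lattice_points_def dilate_points_def)
    ultimately have lim: "((\<lambda>t. \<Sum>x\<in>dilate_points l. exp (t * (\<xi> \<bullet> x))) \<longlongrightarrow> c3 * real l ^ 3 + c2 * (real l)\<^sup>2 + c1 * real l + c0) (at_right 0)"
      by simp
    \<comment> \<open>Positive multiples of \<xi> stay generic, and \<open>R v t\<close> is the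
      vertex sum freed of its pole of order three.\<close>
    have eq: "(\<Sum>x\<in>dilate_points l. exp (t * (\<xi> \<bullet> x))) = (\<Sum>v\<in>verts. exp (t * (real l * (\<xi> \<bullet> v))) * R v t) / t ^ 3" if t: "t > 0" for t
    proof -
      have "(\<Sum>x\<in>dilate_points l. exp (t * (\<xi> \<bullet> x))) = (\<Sum>x\<in>dilate_points l. exp ((t *\<^sub>R \<xi>) \<bullet> x))" by simp
      also have "\<dots> = (\<Sum>v\<in>verts. exp (real l * ((t *\<^sub>R \<xi>) \<bullet> v)) * vertex_sum (t *\<^sub>R \<xi>) v)"
        using t by (intro exp_sum_dilate_points generic_scaleR gen l) auto
      also have "\<dots> = (\<Sum>v\<in>verts. exp (t * (real l * (\<xi> \<bullet> v))) * (R v t / t ^ 3))"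
      proof (rule sum.cong[OF refl])
        fix v assume v: "v \<in> verts"
        have "R v t = t ^ 3 * vertex_sum (t *\<^sub>R \<xi>) v"
          unfolding R_def vertex_sum_def sum_distrib_left by (rule sum.cong[OF refl]) (simp only: prod.distrib prod_constant card_fac[OF v] inner_scaleR_left)
        hence "R v t / t ^ 3 = vertex_sum (t *\<^sub>R \<xi>) v"
          using t by simp
        thus "exp (real l * ((t *\<^sub>R \<xi>) \<bullet> v)) * vertex_sum (t *\<^sub>R \<xi>) v
          = exp (t * (real l * (\<xi> \<bullet> v))) * (R v t / t ^ 3)" by (simp add: mult_ac)
      qed
      finally show ?thesis by (simp add: sum_divide_distrib)
    qed
    show "((\<lambda>t. (\<Sum>v\<in>verts. exp (t * (real l * (\<xi> \<bullet> v))) * R v t) / t ^ 3) \<longlongrightarrow> c3 * real l ^ 3 + c2 * (real l)\<^sup>2 + c1 * real l + c0) (at_right 0)"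
      by (rule Lim_transform_eventually[OF lim]) (use eq in \<open>simp add: eventually_at_filter\<close>)
  qed
  thus ?thesis by (simp add: r2_def sum_negf)
qed

end

section \<open>Edges\<close>

text \<open>A segment determines its endpoints up to order and its primitive direction up to sign,
  neither of which affects the length.\<close>

lemma rel_vol_closed_segment:
  assumes "primitive u" "y - x = t *\<^sub>R u" "0 \<le> t"
  shows "rel_vol (closed_segment x y) = t"
  unfolding rel_vol_def
proof (rule the_equality)
  show "0 \<le> t \<and> (\<exists>x' y' u. closed_segment x y = closed_segment x' y' \<and> primitive u \<and> y' - x' = t *\<^sub>R u)"
    using assms by blast
  fix s assume "0 \<le> s \<and> (\<exists>x' y' u. closed_segment x y = closed_segment x' y' \<and> primitive u \<and> y' - x' = s *\<^sub>R u)"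
  then obtain x' y' w where s: "0 \<le> s" "closed_segment x y = closed_segment x' y'" "primitive w" "y' - x' = s *\<^sub>R w"
    by blast
  have "{x, y} = {x', y'}" using s(2) closed_segment_eq[of x y x' y'] by simp
  hence "(x' = x \<and> y' = y) \<or> (x' = y \<and> y' = x)" by (auto simp: doubleton_eq_iff)
  hence "s *\<^sub>R w = t *\<^sub>R u \<or> s *\<^sub>R w = t *\<^sub>R (- u)"
    using s(4) assms(2) by (metis minus_diff_eq scaleR_minus_right)
  hence "\<bar>s\<bar> = \<bar>t\<bar>" using primitive_scaleR_eq[OF s(3), of u] primitive_scaleR_eq[OF s(3), of "- u"] assms(1) by auto
  thus "s = t" using s(1) assms(3) by simp
qed

context simple_lattice_polytope
begin

lemma ori_diff: "ori v F G H \<Longrightarrow> fac v - {F} = {G, H}"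
  using oriD[of v F G H] by auto

lemma facet_face: "F \<in> facets \<Longrightarrow> F face_of P"
  by (simp add: facets_def facet_of_imp_face_of)

text \<open>\<open>G \<inter> H\<close> is compact and lies on the line through \<open>v\<close> in
  direction \<open>W v F\<close>, so the point of greatest height over \<open>F\<close> is the other
  endpoint.\<close>

lemma edge_segment:
  assumes o: "ori v F G H"
  obtains v' L where "v' \<in> verts" "L > 0" "v' - v = L *\<^sub>R W v F" "G \<inter> H = closed_segment v v'"
    "(G \<inter> H) edge_of P" "lam F v' > 0"
proof -
  note oD = oriD[OF o]
  define Q where "Q = G \<inter> H"
  define D where "D = nrm F \<bullet> (nrm G \<times> nrm H)"
  have D0: "D > 0" using oD(3) by (simp add: D_def)
  have face: "Q face_of P" unfolding Q_def using facet_face oD by (intro face_of_Int) auto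
  have comp: "compact Q" and conv: "convex Q"
    using face_of_imp_compact[OF P_convex P_compact face] face_of_imp_convex[OF face] by auto
  have vQ: "v \<in> Q" unfolding Q_def using oD fac_mem by auto
  have vP: "v \<in> P" using verts_in_P oD by auto
  have Qmem: "x \<in> Q \<longleftrightarrow> x \<in> P \<and> lam G x = 0 \<and> lam H x = 0" for x
    unfolding Q_def using mem_facet_iff oD by auto
  have exp: "D *\<^sub>R (x - v) = lam F x *\<^sub>R W v F" if "x \<in> Q" for x
  proof -
    have "lam G x = 0" "lam H x = 0" using that Qmem by auto
    moreover have "(\<Sum>K\<in>fac v. lam K x *\<^sub>R W v K) = lam F x *\<^sub>R W v F + lam G x *\<^sub>R W v G + lam H x *\<^sub>R W v H"
      unfolding oD(2) using oD(4,5,6) by simp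
    ultimately show ?thesis using vertex_expansion[OF o, of x] by (simp add: D_def)
  qed
  have "continuous_on Q (\<lambda>x. lam F x)" unfolding lam_def by (intro continuous_intros)
  then obtain y where y: "y \<in> Q" "\<And>x. x \<in> Q \<Longrightarrow> lam F x \<le> lam F y"
    using continuous_attains_sup[OF comp] vQ by blast
  have nn: "nrm K \<bullet> W v F \<ge> 0" if "K \<in> facets" "lam K v = 0" for K
  proof (cases "K = F")
    case True
    thus ?thesis using nrm_W(1)[OF oD(1,10)] by simp
  next
    case False
    have "K \<in> fac v" using that mem_fac_iff[OF vP] by simp
    thus ?thesis using nrm_W(2)[OF oD(1,10) _ False] by simp
  qed
  obtain e where e: "e > 0" "v + e *\<^sub>R W v F \<in> P" using move_into_P[OF vP nn] by blast
  have "nrm G \<bullet> W v F = 0" "nrm H \<bullet> W v F = 0"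
    using nrm_W(2)[OF oD(1,10,11)] nrm_W(2)[OF oD(1,10,12)] oD(4,6) by auto
  hence "v + e *\<^sub>R W v F \<in> Q" unfolding Qmem lam_add using e(2) fac_lam[OF oD(11)] fac_lam[OF oD(12)] by simp
  moreover have "lam F (v + e *\<^sub>R W v F) > 0"
    unfolding lam_add using fac_lam[OF oD(10)] e(1) nrm_W(1)[OF oD(1,10)] by simp
  ultimately have M: "lam F y > 0" using y(2) by fastforce
  have "D *\<^sub>R (y - v) = lam F y *\<^sub>R W v F" by (rule exp[OF y(1)])
  hence yv: "y - v = (lam F y / D) *\<^sub>R W v F"
    using D0 by (metis divide_inverse_commute less_irrefl scaleR_scaleR scaleR_one left_inverse)
  have seg: "Q = closed_segment v y"
  proof (intro subset_antisym subsetI)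
    fix x assume x: "x \<in> Q"
    define s where "s = lam F x / lam F y"
    have "0 \<le> lam F x" using lam_nonneg[OF oD(7)] x Qmem by auto
    hence s: "0 \<le> s" "s \<le> 1" using y(2)[OF x] M by (auto simp: s_def)
    have "D *\<^sub>R (x - v) = D *\<^sub>R (s *\<^sub>R (y - v))"
      unfolding exp[OF x] yv using M D0 by (simp add: s_def)
    hence "x - v = s *\<^sub>R (y - v) \<or> D = 0" by (rule scaleR_cancel_left[THEN iffD1])
    hence "x - v = s *\<^sub>R (y - v)" using D0 by simp
    hence "x = (1 - s) *\<^sub>R v + s *\<^sub>R y" by (simp add: algebra_simps)
    thus "x \<in> closed_segment v y" using s by (auto simp: closed_segment_def)
  next
    fix x assume "x \<in> closed_segment v y"
    thus "x \<in> Q" using closed_segment_subset[OF vQ y(1) conv] by blast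
  qed
  have "y extreme_point_of P" using segment_face_of(2) face seg by metis
  hence yV: "y \<in> verts" by (simp add: verts_def)
  have L: "lam F y / D > 0" using M D0 by simp
  have "y \<noteq> v" using yv L W_nonzero[OF oD(1,10)] by auto
  hence "aff_dim Q = 1" unfolding seg segment_convex_hull aff_dim_convex_hull by (simp add: aff_dim_2)
  hence "Q edge_of P" using face by (simp add: edge_of_def)
  thus ?thesis using that[OF yV L yv] seg M unfolding Q_def by blast
qed

text \<open>\<open>E\<close> is the intersection of the facets containing it, which are among the
  three facets at a vertex of \<open>E\<close>. All three would leave a point, a single one would be
  a facet, and none would leave the whole space; so there are two.\<close>

lemma edge_obtain_ori:
  assumes E: "E edge_of P"
  obtains v F G H where "ori v F G H" "E = G \<inter> H"
proof -
  have face: "E face_of P" and d1: "aff_dim E = 1" using E by (auto simp: edge_of_def)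
  have ne: "E \<noteq> {}" "E \<noteq> P" using d1 full_dim by auto
  have "verts \<inter> E \<noteq> {}" using convex_hull_verts_face[OF face] ne by auto
  then obtain v where v: "v \<in> verts" "v \<in> E" by auto
  define S where "S = {F. F facet_of P \<and> E \<subseteq> F}"
  have ES: "E = \<Inter>S" unfolding S_def by (rule face_of_polyhedron[OF P_polyhedron face ne])
  have Sf: "S \<subseteq> fac v" unfolding S_def fac_def using v by auto
  have "S \<noteq> fac v"
  proof
    assume S: "S = fac v"
    have "E = {v}"
    proof (intro subset_antisym subsetI)
      fix x assume "x \<in> E"
      hence "lam K x = 0" if "K \<in> fac v" for K
        using that ES S mem_facet_iff[OF fac_facets[OF that]] by blast
      thus "x \<in> {v}" using eq_vertex_if_lam_0[OF v(1)] by blast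
    qed (use v in auto)
    thus False using d1 by simp
  qed
  then obtain F where F: "F \<in> fac v" "F \<notin> S" using Sf by blast
  obtain G H where o: "ori v F G H" using ori_exists[OF v(1) F(1)] by blast
  have "S \<subseteq> {G, H}" using Sf F oriD(2)[OF o] by auto
  moreover have "S \<noteq> {}"
  proof
    assume "S = {}"
    hence "\<Inter>S = UNIV" by simp
    thus False using d1 unfolding ES[symmetric] by simp
  qed
  moreover have "S \<noteq> {A}" for A
  proof
    assume "S = {A}"
    hence "\<Inter>S = A" "A \<in> S" by simp_all
    hence "E = A" "A facet_of P" unfolding ES[symmetric] by (auto simp: S_def)
    thus False using d1 full_dim by (auto simp: facet_of_def)
  qed
  ultimately have "S = {G, H}" by blast
  hence "\<Inter>S = G \<inter> H" by simp
  hence "E = G \<inter> H" unfolding ES[symmetric] .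
  with o show ?thesis by (rule that)
qed

text \<open>Only three facets pass through \<open>v\<close>, and the third one, \<open>F\<close>,
  misses the other end of the edge.\<close>

lemma facets_of_edge:
  assumes o: "ori v F G H" and A: "A facet_of P" and sub: "G \<inter> H \<subseteq> A"
  shows "A = G \<or> A = H"
proof -
  have "v \<in> G \<inter> H" using fac_mem oriD[OF o] by blast
  hence Av: "A \<in> fac v" using A sub by (auto simp: fac_def)
  obtain v' L where v': "G \<inter> H = closed_segment v v'" "lam F v' > 0" by (rule edge_segment[OF o])
  have "v' \<in> A" using v'(1) sub by auto
  hence "A \<noteq> F" using v'(2) mem_facet_iff[OF oriD(7)[OF o]] by auto
  thus ?thesis using Av oriD(2)[OF o] by auto
qed

lemma facet_pair_iff:
  assumes o: "ori v F G H"
  shows "facet_pair P (G \<inter> H) A B \<longleftrightarrow> (A = G \<and> B = H) \<or> (A = H \<and> B = G)"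
proof
  assume fp: "facet_pair P (G \<inter> H) A B"
  hence "A = G \<or> A = H" "B = G \<or> B = H" "A \<noteq> B"
    using facets_of_edge[OF o, of A] facets_of_edge[OF o, of B] by (auto simp: facet_pair_def)
  thus "(A = G \<and> B = H) \<or> (A = H \<and> B = G)" by blast
next
  assume "(A = G \<and> B = H) \<or> (A = H \<and> B = G)"
  thus "facet_pair P (G \<inter> H) A B"
    using oriD(5,8,9)[OF o] by (auto simp: facet_pair_def facets_def)
qed

lemma edge_m_eq:
  assumes o: "ori v F G H"
  shows "edge_m P (G \<inter> H) = lattice_index (nrm G) (nrm H)"
  unfolding edge_m_def facet_pair_iff[OF o]
  by (rule the_equality) (use lattice_index_commute in auto)

lemma nrm_W_abs:
  assumes v: "v \<in> verts" and f: "fac v = {F, G, H}" and K: "K \<in> fac v"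
  shows "nrm K \<bullet> W v K = \<bar>nrm F \<bullet> (nrm G \<times> nrm H)\<bar>"
proof -
  have "nrm F \<bullet> (nrm G \<times> nrm H) \<noteq> 0" by (rule vertex_normals_independent[OF v f])
  hence "ori v F G H \<or> ori v F H G"
    using f v triple_swap[of "nrm F" "nrm H" "nrm G"] by (auto simp: ori_def)
  thus ?thesis
  proof
    assume o: "ori v F G H"
    show ?thesis using nrm_W_eq_det[OF o] oriD(3)[OF o] K f by auto
  next
    assume o: "ori v F H G"
    show ?thesis using nrm_W_eq_det[OF o] oriD(3)[OF o] K f triple_swap[of "nrm F" "nrm H" "nrm G"] by auto
  qed
qed

text \<open>No orientation of \<open>F\<close>, \<open>G\<close>, \<open>H\<close> is assumed, so
  the same symmetric sum can be evaluated with either facet in the first place.\<close>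

lemma cell_bern1_sum:
  assumes v: "v \<in> verts" and f: "fac v = {F, G, H}" and nb: "normal_basis (nrm F) (nrm G) e p q"
  shows "(\<Sum>x\<in>cell v. bern1 (coord v F x) * bern1 (coord v G x)) = of_int q * (dedekind_sum p q + 1/4)"
proof -
  have fcs: "F \<in> facets" "G \<in> facets" "H \<in> facets" using f fac_facets[of _ v] by auto
  have int: "nrm F \<in> int_lattice" "e \<in> int_lattice" "nrm H \<in> int_lattice" and pr: "primitive (nrm F \<times> e)"
    and q: "q > 0" and w: "nrm G = of_int p *\<^sub>R nrm F + of_int q *\<^sub>R e"
    using nb fcs by (auto simp: normal_basis_def)
  have nz: "nrm F \<bullet> (nrm G \<times> nrm H) \<noteq> 0" by (rule vertex_normals_independent[OF v f])
  have cop: "coprime p q" using normal_basis_coprime[OF nb] nrm_primitive fcs by simp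
  have nW: "nrm K \<bullet> W v K = \<bar>nrm F \<bullet> (nrm G \<times> nrm H)\<bar>" if "K \<in> {F, G, H}" for K
    using nrm_W_abs[OF v f] that f by simp
  have "cell v = box_points (nrm F) (nrm G) (nrm H)"
    unfolding cell_def box_points_def f using nW by auto
  thus ?thesis using box_points_bern_sums(2)[OF int pr q w nz cop] nW by (simp add: coord_def)
qed

lemma edge_s_m:
  assumes o: "ori v F G H"
  shows "(\<Sum>x\<in>cell v. \<Prod>J\<in>fac v - {F}. bern1 (coord v J x)) = edge_m P (G \<inter> H) * (edge_s P (G \<inter> H) + 1/4)"
    and "\<exists>w. primitive w \<and> W v F = real (edge_m P (G \<inter> H)) *\<^sub>R w"
    and "edge_m P (G \<inter> H) > 0"
proof -
  note oD = oriD[OF o]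
  note o' = ori_rotate[OF o]
  have gh: "fac v = {G, H, F}" "fac v = {H, G, F}" using oD(2) by auto
  obtain e p q where nb: "normal_basis (nrm G) (nrm H) e p q" using ori_normal_basis[OF o'] by blast
  have prG: "primitive (nrm G)" and prH: "primitive (nrm H)" using nrm_primitive oD by auto
  have nzc: "nrm G \<times> nrm H \<noteq> 0" "nrm H \<times> nrm G \<noteq> 0"
    using normal_basis_cross(2)[OF nb] cross_skew[of "nrm G" "nrm H"] by auto
  have m: "real (edge_m P (G \<inter> H)) = of_int q"
    unfolding edge_m_eq[OF o] using lattice_index_eq[OF nb prG] by (metis of_int_of_nat_eq)
  have q: "q > 0" using nb by (simp add: normal_basis_def)
  have sum_eq: "(\<Sum>x\<in>cell v. bern1 (coord v G x) * bern1 (coord v H x)) = of_int q * (dedekind_sum p q + 1/4)"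
    by (rule cell_bern1_sum[OF oD(1) gh(1) nb])
  have uniq: "dedekind_sum p' q' = dedekind_sum p q"
    if fp: "facet_pair P (G \<inter> H) A B" and nb': "normal_basis (nrm A) (nrm B) e' p' q'" for A B e' p' q'
  proof -
    have "of_int q' * (dedekind_sum p' q' + 1/4) = of_int q * (dedekind_sum p q + 1/4) \<and> q' = q"
      using fp unfolding facet_pair_iff[OF o]
    proof
      assume AB: "A = G \<and> B = H"
      have "q' = q" using lattice_index_eq[OF nb prG] lattice_index_eq[OF nb'] prG AB by auto
      thus ?thesis using cell_bern1_sum[OF oD(1) gh(1)] nb' AB sum_eq by metis
    next
      assume AB: "A = H \<and> B = G"
      have "q' = q" using lattice_index_eq[OF nb prG] lattice_index_eq[OF nb'] prH AB lattice_index_commute by metis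
      moreover have "(\<Sum>x\<in>cell v. bern1 (coord v H x) * bern1 (coord v G x)) = of_int q' * (dedekind_sum p' q' + 1/4)"
        using cell_bern1_sum[OF oD(1) gh(2)] nb' AB by blast
      ultimately show ?thesis using sum_eq by (auto simp: mult.commute)
    qed
    hence "of_int q * (dedekind_sum p' q' + 1/4) = of_int q * (dedekind_sum p q + 1/4)" by metis
    hence "dedekind_sum p' q' + 1/4 = dedekind_sum p q + 1/4"
      using q mult_left_cancel[of "real_of_int q"] by (metis less_irrefl of_int_0_eq_iff)
    thus ?thesis by simp
  qed
  have "edge_s P (G \<inter> H) = dedekind_sum p q"
    unfolding edge_s_def
  proof (rule the_equality)
    have "facet_pair P (G \<inter> H) G H" using facet_pair_iff[OF o] by simp
    thus "\<exists>A B e1 e2 p' q'. facet_pair P (G \<inter> H) A B \<and> independent {e1, e2} \<and> e1 \<noteq> e2 \<and>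
      int_span e1 e2 = plane_lattice (nrm A) (nrm B) \<and> nrm A = e1 \<and>
      nrm B = of_int p' *\<^sub>R e1 + of_int q' *\<^sub>R e2 \<and> 0 \<le> p' \<and> p' < q' \<and> dedekind_sum p q = dedekind_sum p' q'"
      using nb unfolding normal_basis_iff[OF prG nzc(1)] by blast
  next
    fix s assume "\<exists>A B e1 e2 p' q'. facet_pair P (G \<inter> H) A B \<and> independent {e1, e2} \<and> e1 \<noteq> e2 \<and>
      int_span e1 e2 = plane_lattice (nrm A) (nrm B) \<and> nrm A = e1 \<and>
      nrm B = of_int p' *\<^sub>R e1 + of_int q' *\<^sub>R e2 \<and> 0 \<le> p' \<and> p' < q' \<and> s = dedekind_sum p' q'"
    then obtain A B e1 e2 p' q' where fp: "facet_pair P (G \<inter> H) A B" and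
      R: "independent {nrm A, e2} \<and> nrm A \<noteq> e2 \<and> int_span (nrm A) e2 = plane_lattice (nrm A) (nrm B) \<and>
      nrm B = of_int p' *\<^sub>R nrm A + of_int q' *\<^sub>R e2 \<and> 0 \<le> p' \<and> p' < q'" and s: "s = dedekind_sum p' q'" by blast
    have "primitive (nrm A)" "nrm A \<times> nrm B \<noteq> 0"
      using fp prG prH nzc unfolding facet_pair_iff[OF o] by auto
    hence "normal_basis (nrm A) (nrm B) e2 p' q'" using R normal_basis_iff by blast
    thus "s = dedekind_sum p q" using uniq[OF fp] s by simp
  qed
  thus "(\<Sum>x\<in>cell v. \<Prod>J\<in>fac v - {F}. bern1 (coord v J x)) = edge_m P (G \<inter> H) * (edge_s P (G \<inter> H) + 1/4)"
    using sum_eq m oD(5) unfolding ori_diff[OF o] by simp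
  show "\<exists>w. primitive w \<and> W v F = real (edge_m P (G \<inter> H)) *\<^sub>R w"
    using W_eq(1)[OF o] normal_basis_cross(1)[OF nb] m nb by (auto simp: normal_basis_def)
  show "edge_m P (G \<inter> H) > 0" using m q by (metis of_int_0_less_iff of_nat_0_less_iff)
qed

lemma edge_data:
  assumes o: "ori v F G H"
  obtains v' L where "v' \<in> verts" "L > 0" "v' - v = L *\<^sub>R W v F" "G \<inter> H = closed_segment v v'"
    "(G \<inter> H) edge_of P" "rel_vol (G \<inter> H) = L * edge_m P (G \<inter> H)" "v' \<noteq> v"
proof -
  obtain v' L where v': "v' \<in> verts" "L > 0" "v' - v = L *\<^sub>R W v F" "G \<inter> H = closed_segment v v'"
    "(G \<inter> H) edge_of P" by (rule edge_segment[OF o])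
  obtain w where w: "primitive w" "W v F = real (edge_m P (G \<inter> H)) *\<^sub>R w" using edge_s_m(2)[OF o] by blast
  have "v' - v = (L * edge_m P (G \<inter> H)) *\<^sub>R w" using v'(3) w(2) by simp
  hence "rel_vol (G \<inter> H) = L * edge_m P (G \<inter> H)"
    unfolding v'(4) by (intro rel_vol_closed_segment[OF w(1)]) (use v'(2,4) in auto)
  moreover have "v' \<noteq> v" using v'(2,3) W_nonzero[OF oriD(1,10)[OF o]] by auto
  ultimately show ?thesis using that v' by blast
qed

text \<open>The edge at \<open>v\<close> along \<open>W v K\<close>. Pairs of a vertex and a facet
  through it thus serve as half-edges.\<close>

definition ed where "ed v K = \<Inter>(fac v - {K})"

lemma ed_eq: "ori v F G H \<Longrightarrow> ed v F = G \<inter> H"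
  by (simp add: ed_def ori_diff)

lemma ed_edge: "v \<in> verts \<Longrightarrow> K \<in> fac v \<Longrightarrow> ed v K edge_of P"
  by (metis ori_exists ed_eq edge_segment)

definition edges where "edges = {E. E edge_of P}"

lemma finite_edges: "finite edges"
  unfolding edges_def edge_of_def using finite_polytope_faces[OF P_polytope] by (rule finite_subset[rotated]) auto

text \<open>By simplicity exactly one facet besides \<open>G\<close> and \<open>H\<close> passes
  through \<open>v'\<close>; it gives the second of the two half-edges that make up the
  edge.\<close>

lemma other_end:
  assumes o: "ori v F G H" and v': "v' \<in> verts" "G \<inter> H = closed_segment v v'" "v' \<noteq> v"
  obtains F' where "ori v' F' G H \<or> ori v' F' H G" "F' \<in> fac v'" "ed v' F' = G \<inter> H"
    "{(u, K). u \<in> verts \<and> K \<in> fac u \<and> ed u K = G \<inter> H} = {(v, F), (v', F')}"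
proof -
  note oD = oriD[OF o]
  have "v' \<in> G \<inter> H" unfolding v'(2) by simp
  hence gh: "G \<in> fac v'" "H \<in> fac v'" using oD(8,9) by (auto simp: fac_def facets_def)
  have "card (fac v' - {G, H}) = 1" using card_fac[OF v'(1)] gh oD(5) by (subst card_Diff_subset) auto
  then obtain F' where F': "fac v' - {G, H} = {F'}" by (auto simp: card_1_singleton_iff)
  have F'f: "F' \<in> fac v'" "F' \<noteq> G" "F' \<noteq> H" using F' by blast+
  obtain A B where o': "ori v' F' A B" using ori_exists[OF v'(1) F'f(1)] by blast
  have "fac v' - {F'} = {G, H}" using F' gh F'f by blast
  hence ABset: "{A, B} = {G, H}" using ori_diff[OF o'] by simp
  hence AB: "(A = G \<and> B = H) \<or> (A = H \<and> B = G)" by (auto simp: doubleton_eq_iff)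
  have ed': "ed v' F' = G \<inter> H" using ed_eq[OF o'] AB by blast
  have sub: "(u, K) = (v, F) \<or> (u, K) = (v', F')" if u: "u \<in> verts" "K \<in> fac u" "ed u K = G \<inter> H" for u K
  proof -
    obtain C D where ou: "ori u K C D" using ori_exists[OF u(1,2)] by blast
    have CD: "C \<inter> D = G \<inter> H" using ed_eq[OF ou] u(3) by simp
    have CDf: "C facet_of P" "D facet_of P" using oriD(8,9)[OF ou] by (simp_all add: facets_def)
    have "C = G \<or> C = H" by (rule facets_of_edge[OF o CDf(1)]) (use CD in blast)
    moreover have "D = G \<or> D = H" by (rule facets_of_edge[OF o CDf(2)]) (use CD in blast)
    ultimately have CDset: "{C, D} = {G, H}" using oriD(5)[OF ou] by blast
    have "u \<in> C \<inter> D" using fac_mem oriD(11,12)[OF ou] by blast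
    hence "u \<in> closed_segment v v'" using CD v'(2) by simp
    moreover have "closed_segment v v' face_of P" using ed_edge[OF u(1,2)] u(3) v'(2) by (simp add: edge_of_def)
    ultimately have "u extreme_point_of closed_segment v v'"
      using u(1) extreme_point_of_face by (auto simp: verts_def)
    hence "u = v \<or> u = v'" by (simp add: extreme_point_of_segment)
    moreover have "K = F" if "u = v"
    proof -
      have "fac v - {K} = fac v - {F}" using ori_diff[OF ou] ori_diff[OF o] CDset that by simp
      thus ?thesis using u(2) that oD(10) by blast
    qed
    moreover have "K = F'" if "u = v'"
    proof -
      have "fac v' - {K} = fac v' - {F'}" using ori_diff[OF ou] ori_diff[OF o'] CDset ABset that by simp
      thus ?thesis using u(2) that F'f by blast
    qed
    ultimately show ?thesis by blast
  qed
  have "{(u, K). u \<in> verts \<and> K \<in> fac u \<and> ed u K = G \<inter> H} = {(v, F), (v', F')}"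
  proof (intro subset_antisym subsetI)
    fix x assume "x \<in> {(u, K). u \<in> verts \<and> K \<in> fac u \<and> ed u K = G \<inter> H}"
    then obtain u K where "x = (u, K)" "u \<in> verts" "K \<in> fac u" "ed u K = G \<inter> H" by blast
    thus "x \<in> {(v, F), (v', F')}" using sub[of u K] by blast
  next
    fix x assume "x \<in> {(v, F), (v', F')}"
    hence "x = (v, F) \<or> x = (v', F')" by simp
    thus "x \<in> {(u, K). u \<in> verts \<and> K \<in> fac u \<and> ed u K = G \<inter> H}"
      using oD(1,10) ed_eq[OF o] v'(1) F'f(1) ed' by (elim disjE) simp_all
  qed
  moreover have "ori v' F' G H \<or> ori v' F' H G" using o' AB by blast
  ultimately show ?thesis using that[OF _ F'f(1) ed'] by blast
qed

text \<open>The two half-edges of an edge have the same lattice point sum \<open>c\<close> and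
  opposite directions, so \<xi> cancels: \<open>\<xi> \<bullet> v' - \<xi> \<bullet> v\<close> is
  \<open>L\<close> times the denominator.\<close>

lemma sum_half_edges:
  assumes gen: "generic \<xi>"
  shows "(\<Sum>v\<in>verts. \<Sum>K\<in>fac v. (\<xi> \<bullet> v) * ((\<Sum>g\<in>cell v. \<Prod>J\<in>fac v - {K}. bern1 (coord v J g)) / (\<xi> \<bullet> W v K)))
    = - (\<Sum>E\<in>edges. (edge_s P E + 1/4) * rel_vol E)"
proof -
  define h where "h = (\<lambda>(v, K). (\<xi> \<bullet> v) * ((\<Sum>g\<in>cell v. \<Prod>J\<in>fac v - {K}. bern1 (coord v J g)) / (\<xi> \<bullet> W v K)))"
  define HE where "HE = Sigma verts fac"
  have HE: "finite HE" unfolding HE_def using finite_verts by auto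
  have img: "(\<lambda>(v, K). ed v K) ` HE \<subseteq> edges" using ed_edge by (auto simp: HE_def edges_def)
  have "(\<Sum>v\<in>verts. \<Sum>K\<in>fac v. (\<xi> \<bullet> v) * ((\<Sum>g\<in>cell v. \<Prod>J\<in>fac v - {K}. bern1 (coord v J g)) / (\<xi> \<bullet> W v K))) = sum h HE"
    unfolding HE_def h_def using finite_verts by (subst sum.Sigma) auto
  also have "\<dots> = (\<Sum>E\<in>edges. sum h {x \<in> HE. (\<lambda>(v, K). ed v K) x = E})"
    by (rule sum.group[OF HE finite_edges img, symmetric])
  also have "\<dots> = (\<Sum>E\<in>edges. - ((edge_s P E + 1/4) * rel_vol E))"
  proof (rule sum.cong[OF refl])
    fix E assume "E \<in> edges"
    hence "E edge_of P" by (simp add: edges_def)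
    then obtain v F G H where o: "ori v F G H" and E: "E = G \<inter> H" by (rule edge_obtain_ori)
    obtain v' L where v': "v' \<in> verts" "L > 0" "v' - v = L *\<^sub>R W v F" "G \<inter> H = closed_segment v v'"
      "(G \<inter> H) edge_of P" "rel_vol (G \<inter> H) = L * edge_m P (G \<inter> H)" "v' \<noteq> v" by (rule edge_data[OF o])
    obtain F' where F': "ori v' F' G H \<or> ori v' F' H G" "F' \<in> fac v'" "ed v' F' = G \<inter> H"
      "{(u, K). u \<in> verts \<and> K \<in> fac u \<and> ed u K = G \<inter> H} = {(v, F), (v', F')}"
      by (rule other_end[OF o v'(1,4,7)])
    define c where "c = real (edge_m P E) * (edge_s P E + 1/4)"
    have fib: "{x \<in> HE. (\<lambda>(v, K). ed v K) x = E} = {(v, F), (v', F')}"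
      unfolding F'(4)[symmetric] E HE_def by auto
    obtain A B where o': "ori v' F' A B" and AB: "A \<inter> B = G \<inter> H" using F'(1) by blast
    obtain v'' L' where v'': "L' > 0" "v'' - v' = L' *\<^sub>R W v' F'" "A \<inter> B = closed_segment v' v''"
      "rel_vol (A \<inter> B) = L' * edge_m P (A \<inter> B)" "v'' \<noteq> v'" by (rule edge_data[OF o'])
    have "closed_segment v v' = closed_segment v' v''" using v'(4) v''(3) AB by simp
    hence "{v, v'} = {v', v''}" using closed_segment_eq[of v v' v' v''] by simp
    hence vv: "v'' = v" using v''(5) v'(7) by (auto simp: doubleton_eq_iff)
    \<comment> \<open>Both ends describe the same edge, with the same \<open>rel_vol\<close> and
      \<open>edge_m\<close>.\<close>
    have LL: "L' = L" using v''(4) v'(6) AB edge_s_m(3)[OF o] by simp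
    have c1: "h (v, F) = (\<xi> \<bullet> v) * (c / (\<xi> \<bullet> W v F))" unfolding h_def c_def E using edge_s_m(1)[OF o] by simp
    have c2: "h (v', F') = (\<xi> \<bullet> v') * (c / (\<xi> \<bullet> W v' F'))" unfolding h_def c_def E using edge_s_m(1)[OF o'] AB by simp
    have "\<xi> \<bullet> (v' - v) = \<xi> \<bullet> (L *\<^sub>R W v F)" using v'(3) by simp
    hence x1: "\<xi> \<bullet> v' - \<xi> \<bullet> v = L * (\<xi> \<bullet> W v F)" by (simp add: inner_diff_right)
    have "\<xi> \<bullet> (v - v') = \<xi> \<bullet> (L *\<^sub>R W v' F')" using v''(2) vv LL by simp
    hence x2: "\<xi> \<bullet> v - \<xi> \<bullet> v' = L * (\<xi> \<bullet> W v' F')" by (simp add: inner_diff_right)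
    have X: "\<xi> \<bullet> W v F \<noteq> 0" using gen oriD[OF o] by (auto simp: generic_def)
    have "L * (\<xi> \<bullet> W v F + \<xi> \<bullet> W v' F') = 0" using x1 x2 by (simp add: algebra_simps)
    hence W': "\<xi> \<bullet> W v' F' = - (\<xi> \<bullet> W v F)" using v'(2) by simp
    have "sum h {(v, F), (v', F')} = h (v, F) + h (v', F')" using v'(7) by simp
    also have "\<dots> = - (c * ((\<xi> \<bullet> v' - \<xi> \<bullet> v) / (\<xi> \<bullet> W v F)))"
      unfolding c1 c2 W' using X by (simp add: field_simps)
    also have "\<dots> = - (c * L)" unfolding x1 using X by simp
    also have "\<dots> = - ((edge_s P E + 1/4) * rel_vol E)" unfolding c_def using v'(6) E by simp
    finally show "sum h {x \<in> HE. (\<lambda>(v, K). ed v K) x = E} = - ((edge_s P E + 1/4) * rel_vol E)" unfolding fib .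
  qed
  finally show ?thesis by (simp add: sum_negf)
qed

section \<open>Collecting the quadratic terms by facets\<close>

text \<open>The dependence on \<xi> is only apparent: \<open>C_formula_eq_facet_term\<close>
  identifies the value with an expression without \<xi>.\<close>

definition facet_term where
  "facet_term \<xi> F = - (\<Sum>v\<in>verts \<inter> F. (\<xi> \<bullet> v) * ((\<xi> \<bullet> W v F) / (\<Prod>J\<in>fac v - {F}. \<xi> \<bullet> W v J)))"

lemma linear_coefficient_facet_terms:
  assumes gen: "generic \<xi>"
    and cubic: "\<And>l::nat. real (lattice_points P l) = c3 * real l ^ 3 + c2 * real l ^ 2 + c1 * real l + c0"
  shows "c1 = (\<Sum>E\<in>edges. (edge_s P E + 1/4) * rel_vol E) + 1/12 * (\<Sum>F\<in>facets. facet_term \<xi> F)"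
proof -
  define t where "t v F = (\<xi> \<bullet> v) * ((\<xi> \<bullet> W v F) / (\<Prod>J\<in>fac v - {F}. \<xi> \<bullet> W v J))" for v F
  have "(\<Sum>v\<in>verts. \<Sum>F\<in>fac v. t v F) = (\<Sum>v\<in>verts. \<Sum>F\<in>facets. if v \<in> F then t v F else 0)"
  proof (rule sum.cong[OF refl])
    fix v assume "v \<in> verts"
    have eq: "fac v = {F \<in> facets. v \<in> F}" by (auto simp: fac_def facets_def)
    show "(\<Sum>F\<in>fac v. t v F) = (\<Sum>F\<in>facets. if v \<in> F then t v F else 0)"
      unfolding eq by (rule sum.inter_filter[OF finite_facets])
  qed
  also have "\<dots> = (\<Sum>F\<in>facets. \<Sum>v\<in>verts. if v \<in> F then t v F else 0)" by (rule sum.swap)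
  also have "\<dots> = (\<Sum>F\<in>facets. - facet_term \<xi> F)"
  proof (rule sum.cong[OF refl])
    fix F
    have eq: "verts \<inter> F = {v \<in> verts. v \<in> F}" by auto
    show "(\<Sum>v\<in>verts. if v \<in> F then t v F else 0) = - facet_term \<xi> F"
      unfolding facet_term_def t_def[symmetric] eq minus_minus by (rule sum.inter_filter[OF finite_verts, symmetric])
  qed
  finally have ft: "(\<Sum>v\<in>verts. \<Sum>F\<in>fac v. t v F) = - (\<Sum>F\<in>facets. facet_term \<xi> F)" by (simp add: sum_negf)
  have "c1 = - (\<Sum>v\<in>verts. (\<xi> \<bullet> v) * (\<Sum>K\<in>fac v. vertex_coeff \<xi> v K))"
    by (rule linear_coefficient_vertex_sum[OF gen cubic])
  also have "\<dots> = - (1/12 * (\<Sum>v\<in>verts. \<Sum>F\<in>fac v. t v F) +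
    (\<Sum>v\<in>verts. \<Sum>K\<in>fac v. (\<xi> \<bullet> v) * ((\<Sum>g\<in>cell v. \<Prod>J\<in>fac v - {K}. bern1 (coord v J g)) / (\<xi> \<bullet> W v K))))"
    unfolding sum_distrib_left sum.distrib[symmetric] t_def vertex_coeff_def
    by (intro arg_cong[where f = uminus] sum.cong refl) (simp add: algebra_simps)
  finally show ?thesis unfolding ft sum_half_edges[OF gen] by simp
qed

end

section \<open>Facets\<close>

lemma tridiag_det_0: "tridiag_det 0 d e = 1"
  by (simp add: tridiag_det_def)

lemma tridiag_det_1: "tridiag_det (Suc 0) d e = d 0"
  unfolding tridiag_det_def by (subst det_single) auto

text \<open>The continuant recurrence: expansion along the last row, and for the off-diagonal minor
  along its last column.\<close>

lemma tridiag_det_Suc_Suc: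
  "tridiag_det (Suc (Suc n)) d e = d (Suc n) * tridiag_det (Suc n) d e - (e n)\<^sup>2 * tridiag_det n d e"
proof -
  define f where "f = (\<lambda>(k, l). if k = l then d k else if l = k + 1 then e k else if k = l + 1 then e l else (0::real))"
  define A where "A m = Matrix.mat m m f" for m
  have T: "tridiag_det m d e = Determinant.det (A m)" for m
    by (simp add: tridiag_det_def A_def f_def)
  let ?N = "Suc (Suc n)"
  have car: "A ?N \<in> carrier_mat ?N ?N" by (simp add: A_def)
  have del1: "mat_delete (A ?N) (Suc n) (Suc n) = A (Suc n)"
    by (rule eq_matI) (auto simp: mat_delete_def A_def)
  define B where "B = mat_delete (A ?N) (Suc n) n"
  have carB: "B \<in> carrier_mat (Suc n) (Suc n)" by (simp add: B_def A_def mat_delete_def)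
  have Bn: "B $$ (i, n) = (if i = n then e n else 0)" if "i \<le> n" for i
    using that by (auto simp: B_def mat_delete_def A_def f_def)
  have del2: "mat_delete B n n = A n"
    by (rule eq_matI) (auto simp: mat_delete_def A_def B_def)
  have detB: "Determinant.det B = e n * Determinant.det (A n)"
  proof -
    have "Determinant.det B = (\<Sum>i<Suc n. B $$ (i, n) * cofactor B i n)"
      by (rule laplace_expansion_column[OF carB]) simp
    also have "\<dots> = (\<Sum>i<Suc n. if i = n then e n * cofactor B n n else 0)"
      using Bn by (intro sum.cong) auto
    also have "\<dots> = e n * cofactor B n n" by simp
    also have "cofactor B n n = Determinant.det (A n)" by (simp add: Determinant.cofactor_def del2)
    finally show ?thesis .
  qed
  have "Determinant.det (A ?N) = (\<Sum>j<?N. A ?N $$ (Suc n, j) * cofactor (A ?N) (Suc n) j)"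
    by (rule laplace_expansion_row[OF car]) simp
  also have "\<dots> = (\<Sum>j<?N. if j = Suc n then d (Suc n) * cofactor (A ?N) (Suc n) (Suc n)
      else if j = n then e n * cofactor (A ?N) (Suc n) n else 0)"
    by (intro sum.cong) (auto simp: A_def f_def)
  also have "\<dots> = e n * cofactor (A ?N) (Suc n) n + d (Suc n) * cofactor (A ?N) (Suc n) (Suc n)"
    by simp
  also have "cofactor (A ?N) (Suc n) (Suc n) = Determinant.det (A (Suc n))"
    by (simp add: Determinant.cofactor_def del1)
  also have "cofactor (A ?N) (Suc n) n = - (e n * Determinant.det (A n))"
    by (simp add: Determinant.cofactor_def B_def[symmetric] detB)
  finally show ?thesis by (simp add: T power2_eq_square)
qed

text \<open>Variation of constants. Each inhomogeneity \<open>a i\<close> acts as a source whose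
  response solves the homogeneous recurrence; that solution is a continuant, rescaled by the product
  of the \<open>\<epsilon> k\<close>.\<close>

lemma three_term_recurrence_solution:
  fixes x a b \<epsilon> :: "nat \<Rightarrow> real"
  assumes x: "x 1 = 0" "x 2 = 0"
    and rec: "\<And>i. 2 \<le> i \<Longrightarrow> i < r \<Longrightarrow> x (i + 1) = \<epsilon> i * (a i + b i * x i - x (i - 1) / \<epsilon> (i - 1))"
    and nz: "\<And>i. 1 \<le> i \<Longrightarrow> i \<le> r \<Longrightarrow> \<epsilon> i \<noteq> 0"
    and j: "1 \<le> j" "j \<le> r"
  shows "x j = (\<Sum>i\<in>{2..<j}. a i * tridiag_det (j - i - 1) (\<lambda>k. b (i + 1 + k)) (\<lambda>k. inverse (\<epsilon> (i + 1 + k))) * (\<Prod>k\<in>{i..<j}. \<epsilon> k))"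
proof -
  define T where "T i j = tridiag_det (j - i - 1) (\<lambda>k. b (i + 1 + k)) (\<lambda>k. inverse (\<epsilon> (i + 1 + k)))" for i j
  \<comment> \<open>The response at \<open>j\<close> to a unit source at \<open>i\<close>. The value
    0 up to \<open>j = i\<close> lets the homogeneous recurrence hold from \<open>j = i + 1\<close>
    on.\<close>
  define G where "G i j = (if i < j then T i j * (\<Prod>k\<in>{i..<j}. \<epsilon> k) else 0)" for i j
  have T1: "T i (i + 1) = 1" for i by (simp add: T_def tridiag_det_0)
  have T2: "T i (i + 2) = b (i + 1)" for i by (simp add: T_def tridiag_det_1)
  have T3: "T i (j + 1) = b j * T i j - (inverse (\<epsilon> (j - 1)))\<^sup>2 * T i (j - 1)" if ij: "i + 2 \<le> j" for i j
  proof -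
    obtain m where m: "j = i + 2 + m" using ij le_Suc_ex by blast
    show ?thesis unfolding T_def m using tridiag_det_Suc_Suc[of m "\<lambda>k. b (i + 1 + k)" "\<lambda>k. inverse (\<epsilon> (i + 1 + k))"]
      by simp
  qed
  have G1: "G j (j + 1) = \<epsilon> j" for j using T1[of j] by (simp add: G_def)
  have G: "G i (j + 1) = \<epsilon> j * b j * G i j - \<epsilon> j / \<epsilon> (j - 1) * G i (j - 1)"
    if ij: "2 \<le> i" "i < j" "j \<le> r" for i j
  proof (cases "j = i + 1")
    case True
    thus ?thesis using T1[of i] T2[of i] nz[of i] ij by (simp add: G_def prod.atLeastLessThan_Suc)
  next
    case False
    hence ij': "i + 2 \<le> j" using ij by simp
    have j1: "j = Suc (j - 1)" using ij by simp
    have p1: "(\<Prod>k\<in>{i..<j + 1}. \<epsilon> k) = (\<Prod>k\<in>{i..<j}. \<epsilon> k) * \<epsilon> j" using ij by (simp add: prod.atLeastLessThan_Suc)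
    have p2: "(\<Prod>k\<in>{i..<j}. \<epsilon> k) = (\<Prod>k\<in>{i..<j - 1}. \<epsilon> k) * \<epsilon> (j - 1)"
      using ij' by (subst j1, subst prod.atLeastLessThan_Suc) auto
    have e: "\<epsilon> (j - 1) \<noteq> 0" using nz[of "j - 1"] ij by simp
    have "G i (j + 1) = (b j * T i j - (inverse (\<epsilon> (j - 1)))\<^sup>2 * T i (j - 1)) * ((\<Prod>k\<in>{i..<j}. \<epsilon> k) * \<epsilon> j)"
      using ij by (simp only: G_def T3[OF ij'] p1) simp
    also have "\<dots> = \<epsilon> j * b j * (T i j * (\<Prod>k\<in>{i..<j}. \<epsilon> k)) - \<epsilon> j / \<epsilon> (j - 1) * (T i (j - 1) * (\<Prod>k\<in>{i..<j - 1}. \<epsilon> k))"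
      unfolding p2 using e by (simp add: field_simps power2_eq_square)
    also have "\<dots> = \<epsilon> j * b j * G i j - \<epsilon> j / \<epsilon> (j - 1) * G i (j - 1)"
      using ij' by (simp add: G_def)
    finally show ?thesis .
  qed
  have "x j = (\<Sum>i\<in>{2..<j}. a i * G i j)" using j
  proof (induction j rule: less_induct)
    case (less j)
    consider "j = 1" | "j = 2" | "j \<ge> 3" using less.prems by linarith
    thus ?case
    proof cases
      case 3
      define m where "m = j - 1"
      have m: "j = m + 1" "2 \<le> m" "m < r" using 3 less.prems by (auto simp: m_def)
      have xm: "x m = (\<Sum>i\<in>{2..<m}. a i * G i m)" using less.IH[of m] m by auto
      have xm1: "x (m - 1) = (\<Sum>i\<in>{2..<m - 1}. a i * G i (m - 1))" using less.IH[of "m - 1"] m by auto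
      also have "\<dots> = (\<Sum>i\<in>{2..<m}. a i * G i (m - 1))"
        by (rule sum.mono_neutral_left) (auto simp: G_def)
      finally have xm1: "x (m - 1) = (\<Sum>i\<in>{2..<m}. a i * G i (m - 1))" .
      have "(\<Sum>i\<in>{2..<j}. a i * G i j) = (\<Sum>i\<in>{2..<m}. a i * G i (m + 1)) + a m * G m (m + 1)"
        using m by (simp add: sum.atLeastLessThan_Suc)
      also have "(\<Sum>i\<in>{2..<m}. a i * G i (m + 1))
        = (\<Sum>i\<in>{2..<m}. a i * (\<epsilon> m * b m * G i m - \<epsilon> m / \<epsilon> (m - 1) * G i (m - 1)))"
        using m by (intro sum.cong refl) (subst G, auto)
      also have "\<dots> = \<epsilon> m * b m * x m - \<epsilon> m / \<epsilon> (m - 1) * x (m - 1)"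
        unfolding xm xm1 by (simp add: sum_distrib_left sum_subtractf algebra_simps)
      finally have "(\<Sum>i\<in>{2..<j}. a i * G i j) = \<epsilon> m * b m * x m - \<epsilon> m / \<epsilon> (m - 1) * x (m - 1) + a m * \<epsilon> m"
        by (simp only: G1)
      also have "\<dots> = x j" using rec[of m] m by (simp add: algebra_simps)
      finally show ?thesis by simp
    qed (use x in auto)
  qed
  also have "\<dots> = (\<Sum>i\<in>{2..<j}. a i * T i j * (\<Prod>k\<in>{i..<j}. \<epsilon> k))"
    by (intro sum.cong refl) (simp add: G_def)
  finally show ?thesis by (simp add: T_def)
qed

text \<open>The origin of the numbers a and b in C(F): \<open>n\<close> is the normal of
  \<open>F\<close>, and \<open>m\<close>, \<open>c\<close>, \<open>s\<close> are those of three
  consecutive neighbours. In the expansion of \<open>s\<close> by the others, pairing with the edge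
  \<open>d\<close> leaving \<open>F\<close> isolates the coefficient of \<open>n\<close>; pairing
  with the edge \<open>e\<close> between \<open>F\<close> and the facet of \<open>s\<close> gives
  that of \<open>c\<close>.\<close>

lemma four_normals_relation:
  fixes n m c s d e :: "real^3"
  assumes \<delta>: "\<delta> = n \<bullet> (c \<times> m)" "\<delta> \<noteq> 0" and \<epsilon>: "\<epsilon> = n \<bullet> (s \<times> c)" "\<epsilon> \<noteq> 0"
    and d: "d \<bullet> m = 0" "d \<bullet> c = 0" "d \<bullet> n \<noteq> 0"
    and e: "e \<bullet> n = 0" "e \<bullet> s = 0" "e \<bullet> c \<noteq> 0"
    and a: "a = (d \<bullet> s) / (\<epsilon> * (d \<bullet> n))" and b: "b = (e \<bullet> m) / (\<delta> * (e \<bullet> c))"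
  shows "s = \<epsilon> *\<^sub>R (a *\<^sub>R n + b *\<^sub>R c - (1 / \<delta>) *\<^sub>R m)"
proof -
  define A where "A = s \<bullet> (c \<times> m)"
  define B where "B = s \<bullet> (m \<times> n)"
  have C: "s \<bullet> (n \<times> c) = - \<epsilon>" unfolding \<epsilon>(1) by (simp add: cross3_simps)
  have ex: "\<delta> *\<^sub>R s = A *\<^sub>R n + B *\<^sub>R c + (- \<epsilon>) *\<^sub>R m"
    using triple_expansion[of n c m s] unfolding \<delta>(1)[symmetric] C A_def B_def by simp
  have "d \<bullet> (\<delta> *\<^sub>R s) = A * (d \<bullet> n)" unfolding ex using d by (simp add: inner_add_right inner_diff_right)
  hence A: "A = \<delta> * \<epsilon> * a" using d(3) \<epsilon>(2) unfolding a by (simp add: field_simps)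
  have "e \<bullet> (\<delta> *\<^sub>R s) = B * (e \<bullet> c) - \<epsilon> * (e \<bullet> m)" unfolding ex using e by (simp add: inner_add_right inner_diff_right)
  hence B: "B = \<delta> * \<epsilon> * b" using e \<delta>(2) unfolding b by (simp add: field_simps)
  have "\<delta> *\<^sub>R s = \<delta> *\<^sub>R (\<epsilon> *\<^sub>R (a *\<^sub>R n + b *\<^sub>R c - (1 / \<delta>) *\<^sub>R m))"
    unfolding ex A B using \<delta>(2) by (simp add: algebra_simps)
  thus ?thesis using \<delta>(2) scaleR_cancel_left by metis
qed

text \<open>Cramer's linear relation among \<open>n\<close>, \<open>s\<close>, \<open>c\<close>,
  \<open>x\<close>, paired with \<open>u\<close>; the term of \<open>x\<close> drops out.\<close>

lemma orthogonal_triple_identity: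
  fixes u x n s c :: "real^3"
  assumes "u \<bullet> x = 0"
  shows "(u \<bullet> n) * (x \<bullet> (s \<times> c)) = (u \<bullet> s) * (x \<bullet> (n \<times> c)) - (u \<bullet> c) * (x \<bullet> (n \<times> s))"
proof -
  have "(u \<bullet> n) * (x \<bullet> (s \<times> c)) - (u \<bullet> s) * (x \<bullet> (n \<times> c)) + (u \<bullet> c) * (x \<bullet> (n \<times> s)) = (u \<bullet> x) * (n \<bullet> (s \<times> c))"
    by (simp add: cross3_simps)
  thus ?thesis using assms by simp
qed

lemma facet_labellingD:
  assumes "facet_labelling P F r G p q"
  shows "bij_betw G {1..r} {H. H facet_of P \<and> (F \<inter> H) edge_of P}" "bij_betw p {1..r} {x. x extreme_point_of F}"
    "G (r + 1) = G 1" "p 0 = p r"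
    "\<And>i. 1 \<le> i \<Longrightarrow> i \<le> r \<Longrightarrow> F \<inter> G i \<inter> G (i + 1) = {p i}"
    "\<And>i. 1 \<le> i \<Longrightarrow> i \<le> r \<Longrightarrow> F \<inter> G i = closed_segment (p (i - 1)) (p i)"
    "\<And>i. 1 \<le> i \<Longrightarrow> i \<le> r \<Longrightarrow> G i \<inter> G (i + 1) = closed_segment (p i) (q i)"
    "\<And>i. 1 \<le> i \<Longrightarrow> i \<le> r \<Longrightarrow> 0 < eps P F G i"
proof -
  show "bij_betw G {1..r} {H. H facet_of P \<and> (F \<inter> H) edge_of P}" "bij_betw p {1..r} {x. x extreme_point_of F}"
    "G (r + 1) = G 1" "p 0 = p r"
    using assms unfolding facet_labelling_def by blast+
  have *: "\<forall>i\<in>{1..r}. F \<inter> G i \<inter> G (i + 1) = {p i} \<and> F \<inter> G i = closed_segment (p (i - 1)) (p i)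
    \<and> (G i \<inter> G (i + 1)) edge_of P \<and> G i \<inter> G (i + 1) = closed_segment (p i) (q i) \<and> 0 < eps P F G i"
    using assms unfolding facet_labelling_def by blast
  fix i assume "1 \<le> i" "i \<le> r"
  hence "i \<in> {1..r}" by simp
  from bspec[OF * this] show "F \<inter> G i \<inter> G (i + 1) = {p i}" "F \<inter> G i = closed_segment (p (i - 1)) (p i)"
    "G i \<inter> G (i + 1) = closed_segment (p i) (q i)" "0 < eps P F G i" by blast+
qed

section \<open>The formula for C(F) along a labelling\<close>

context simple_lattice_polytope
begin

text \<open>The positive determinant makes the three facets at \<open>p i\<close> distinct, so by
  simplicity they are all facets there.\<close>

lemma facet_labelling_ori:
  assumes F: "F \<in> facets" and lab: "facet_labelling P F r G p q" and i: "1 \<le> i" "i \<le> r"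
  shows "ori (p i) F (G (i + 1)) (G i)" and "eps P F G i = nrm F \<bullet> (nrm (G (i + 1)) \<times> nrm (G i))"
    and "eps P F G i > 0" "G i \<in> facets"
proof -
  have Gf: "G j \<in> facets" if "1 \<le> j" "j \<le> r" for j
    using bij_betwE[OF facet_labellingD(1)[OF lab]] that by (auto simp: facets_def)
  have G2: "G (i + 1) \<in> facets"
  proof (cases "i = r")
    case True
    hence "G (i + 1) = G 1" using facet_labellingD(3)[OF lab] by simp
    thus ?thesis using Gf[of 1] i by simp
  next
    case False
    thus ?thesis using Gf[of "i + 1"] i by simp
  qed
  show "G i \<in> facets" using Gf i by simp
  have pe: "p i extreme_point_of F"
    using bij_betwE[OF facet_labellingD(2)[OF lab]] i by auto
  hence pv: "p i \<in> verts" using extreme_point_of_face[OF facet_face[OF F]] by (simp add: verts_def)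
  have "F \<inter> G i \<inter> G (i + 1) = {p i}" by (rule facet_labellingD(5)[OF lab i])
  hence mem: "p i \<in> F" "p i \<in> G i" "p i \<in> G (i + 1)" by blast+
  show e: "eps P F G i = nrm F \<bullet> (nrm (G (i + 1)) \<times> nrm (G i))" by (simp add: eps_def dot_cross_det)
  show pos: "eps P F G i > 0" by (rule facet_labellingD(8)[OF lab i])
  have sub: "{F, G (i + 1), G i} \<subseteq> fac (p i)" using mem F Gf[OF i] G2 by (auto simp: fac_def facets_def)
  have "F \<noteq> G (i + 1)" "F \<noteq> G i" "G (i + 1) \<noteq> G i" using pos unfolding e by (auto simp: dot_cross_self)
  hence "card {F, G (i + 1), G i} = 3" by simp
  hence "fac (p i) = {F, G (i + 1), G i}" using sub card_fac[OF pv] by (metis card_subset_eq finite_fac)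
  thus "ori (p i) F (G (i + 1)) (G i)" using pv pos e by (simp add: ori_def)
qed

text \<open>Seen from \<open>p i\<close>, the edge runs backwards along
  \<open>W (p i) (G (i + 1))\<close>, that is \<open>nrm (G i) \<times> nrm F\<close>. The quotient
  appears because this vector is \<open>edge_m\<close> times a primitive one.\<close>

lemma facet_labelling_edge:
  assumes F: "F \<in> facets" and lab: "facet_labelling P F r G p q" and i: "1 \<le> i" "i \<le> r"
  defines "E \<equiv> closed_segment (p (i - 1)) (p i)"
  shows "p i - p (i - 1) = (rel_vol E / edge_m P E) *\<^sub>R (nrm F \<times> nrm (G i))" "rel_vol E / edge_m P E > 0"
proof -
  note o = facet_labelling_ori(1)[OF F lab i]
  note o2 = ori_rotate[OF o]
  have E: "G i \<inter> F = E" using facet_labellingD(6)[OF lab i] by (simp add: E_def Int_commute)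
  obtain v' L where v': "L > 0" "v' - p i = L *\<^sub>R W (p i) (G (i + 1))" "G i \<inter> F = closed_segment (p i) v'"
      "rel_vol (G i \<inter> F) = L * edge_m P (G i \<inter> F)" "v' \<noteq> p i" by (rule edge_data[OF o2])
  have m: "edge_m P E > 0" using edge_s_m(3)[OF o2] E by simp
  have "closed_segment (p (i - 1)) (p i) = closed_segment (p i) v'" using E v'(3) by (simp add: E_def)
  hence "{p (i - 1), p i} = {p i, v'}" using closed_segment_eq[of "p (i - 1)" "p i" "p i" v'] by simp
  hence vp: "v' = p (i - 1)" using v'(5) by (auto simp: doubleton_eq_iff)
  have L: "rel_vol E / edge_m P E = L" using v'(4) m unfolding E by simp
  show "rel_vol E / edge_m P E > 0" using L v'(1) by simp
  have "W (p i) (G (i + 1)) = nrm (G i) \<times> nrm F" using W_eq(2)[OF o] .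
  hence "p (i - 1) - p i = L *\<^sub>R (nrm (G i) \<times> nrm F)" using v'(2) vp by simp
  hence "p i - p (i - 1) = L *\<^sub>R (- (nrm (G i) \<times> nrm F))" by (metis minus_diff_eq scaleR_minus_right)
  thus "p i - p (i - 1) = (rel_vol E / edge_m P E) *\<^sub>R (nrm F \<times> nrm (G i))"
    unfolding L using cross_skew[of "nrm F" "nrm (G i)"] by simp
qed

lemma facet_labelling_transversal:
  assumes F: "F \<in> facets" and lab: "facet_labelling P F r G p q" and i: "1 \<le> i" "i \<le> r"
  shows "(q i - p i) \<bullet> nrm F > 0" "(q i - p i) \<bullet> nrm (G i) = 0" "(q i - p i) \<bullet> nrm (G (i + 1)) = 0"
proof -
  note o = facet_labelling_ori(1)[OF F lab i]
  obtain v' L where v': "L > 0" "v' - p i = L *\<^sub>R W (p i) F" "G (i + 1) \<inter> G i = closed_segment (p i) v'" "v' \<noteq> p i"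
    by (rule edge_data[OF o])
  have "G i \<inter> G (i + 1) = closed_segment (p i) (q i)" by (rule facet_labellingD(7)[OF lab i])
  hence "closed_segment (p i) (q i) = closed_segment (p i) v'" using v'(3) by (simp add: Int_commute)
  hence "{p i, q i} = {p i, v'}" using closed_segment_eq[of "p i" "q i" "p i" v'] by simp
  hence qv: "q i = v'" using v'(4) by (auto simp: doubleton_eq_iff)
  have d: "(q i - p i) \<bullet> nrm K = L * (nrm K \<bullet> W (p i) F)" for K
    unfolding qv v'(2) by (simp add: inner_commute)
  note oD = oriD[OF o]
  show "(q i - p i) \<bullet> nrm F > 0" unfolding d using nrm_W(1)[OF oD(1,10)] v'(1) by simp
  show "(q i - p i) \<bullet> nrm (G i) = 0" "(q i - p i) \<bullet> nrm (G (i + 1)) = 0"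
    unfolding d using nrm_W(2)[OF oD(1,10,11)] nrm_W(2)[OF oD(1,10,12)] oD(4,6) by simp_all
qed

text \<open>Two choices of \<open>u\<close> in the same identity \<open>closed\<close>: the edge
  leaving \<open>F\<close> at \<open>p 1\<close> leads to the recurrence behind the formula, a
  vector orthogonal to \<xi> to the sum over the vertices. Both sides are
  \<open>- \<kappa>\<close>.\<close>

lemma C_formula_eq_facet_term:
  assumes F: "F \<in> facets" and lab: "facet_labelling P F r G p q" and gen: "generic \<xi>"
  shows "C_formula P F r G p q = facet_term \<xi> F"
proof -
  define n where "n = nrm F"
  define N where "N i = nrm (G i)" for i
  define \<epsilon> where "\<epsilon> = eps P F G"
  define L where "L i = rel_vol (closed_segment (p (i - 1)) (p i)) / edge_m P (closed_segment (p (i - 1)) (p i))" for i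
  have wrap: "p 0 = p r" "G (r + 1) = G 1" using facet_labellingD(3,4)[OF lab] by auto
  have ori: "ori (p i) F (G (i + 1)) (G i)" and eps: "\<epsilon> i = n \<bullet> (N (i + 1) \<times> N i)" "\<epsilon> i > 0"
    if "1 \<le> i" "i \<le> r" for i
    using facet_labelling_ori[OF F lab that] by (auto simp: \<epsilon>_def n_def N_def)
  have step: "p i - p (i - 1) = L i *\<^sub>R (n \<times> N i)" "L i > 0" if "1 \<le> i" "i \<le> r" for i
    using facet_labelling_edge[OF F lab that] by (auto simp: L_def n_def N_def)
  have tr: "(q i - p i) \<bullet> n > 0" "(q i - p i) \<bullet> N i = 0" "(q i - p i) \<bullet> N (i + 1) = 0" if "1 \<le> i" "i \<le> r" for i
    using facet_labelling_transversal[OF F lab that] by (auto simp: n_def N_def)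
  have "bij_betw p {1..r} {x. x extreme_point_of F}" by (rule facet_labellingD(2)[OF lab])
  moreover have "{x. x extreme_point_of F} = verts \<inter> F"
    using extreme_point_of_face[OF facet_face[OF F]] by (auto simp: verts_def)
  ultimately have bij: "bij_betw p {1..r} (verts \<inter> F)" by simp
  obtain v0 where "v0 \<in> verts \<inter> F" using facet_obtain_points F by (metis facets_def mem_Collect_eq)
  hence r1: "1 \<le> r" using bij by (metis atLeastatMost_empty_iff bij_betw_def empty_iff image_empty)
  \<comment> \<open>The product with \<open>n\<close> turns the summands into the edge vectors of
    the closed polygon \<open>F\<close>.\<close>
  define \<kappa>vec where "\<kappa>vec = (\<Sum>j\<in>{1..r}. L j *\<^sub>R N j)"
  have cross_sum: "n \<times> (\<Sum>j\<in>A. f j) = (\<Sum>j\<in>A. n \<times> f j)" for A :: "nat set" and f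
    by (induction A rule: infinite_finite_induct) (auto simp: cross_add_right)
  have "n \<times> \<kappa>vec = (\<Sum>j\<in>{1..r}. p j - p (j - 1))"
    unfolding \<kappa>vec_def cross_sum using step(1) by (intro sum.cong refl) (simp add: cross_mult_right)
  also have "\<dots> = p r - p 0" using sum_telescope''[of 0 r p] r1 by (simp add: sum.atLeast_Suc_atMost_Suc_shift)
  finally have "n \<times> \<kappa>vec = 0" using wrap by simp
  moreover have n0: "n \<noteq> 0" unfolding n_def using primitive_nonzero nrm_primitive[OF F] by blast
  ultimately obtain \<kappa> where \<kappa>: "\<kappa>vec = \<kappa> *\<^sub>R n" using cross3_eq_0_obtain by blast
  have closed: "(\<Sum>j\<in>{1..r}. L j * ((u \<bullet> N j) / (u \<bullet> n))) = \<kappa>" if "u \<bullet> n \<noteq> 0" for u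
  proof -
    have "(\<Sum>j\<in>{1..r}. L j * (u \<bullet> N j)) = u \<bullet> \<kappa>vec" by (simp add: \<kappa>vec_def inner_sum_right)
    also have "\<dots> = \<kappa> * (u \<bullet> n)" by (simp add: \<kappa>)
    finally have "(\<Sum>j\<in>{1..r}. L j * (u \<bullet> N j)) / (u \<bullet> n) = \<kappa>" using that by simp
    thus ?thesis by (simp add: sum_divide_distrib)
  qed
  have "C_formula P F r G p q = - \<kappa>"
  proof -
    \<comment> \<open>A direction in both \<open>G 1\<close> and \<open>G 2\<close>, so the
      recurrence starts with \<open>x 1 = x 2 = 0\<close>.\<close>
    define u where "u = q 1 - p 1"
    define x where "x j = (u \<bullet> N j) / (u \<bullet> n)" for j
    have un: "u \<bullet> n > 0" using tr(1)[of 1] r1 by (simp add: u_def)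
    have x12: "x 1 = 0" "x 2 = 0" using tr(2,3)[of 1] r1 by (auto simp: x_def u_def numeral_2_eq_2)
    have rec: "x (i + 1) = \<epsilon> i * (coeff_a P F G p q i + coeff_b P F G p i * x i - x (i - 1) / \<epsilon> (i - 1))"
      if i: "2 \<le> i" "i < r" for i
    proof -
      have i1: "1 \<le> i - 1" "i - 1 \<le> r" "i - 1 + 1 = i" and i2: "1 \<le> i" "i \<le> r" and i3: "1 \<le> i + 1" "i + 1 \<le> r" "i + 1 - 1 = i" using i by auto
      define d where "d = q (i - 1) - p (i - 1)"
      define e where "e = p (i + 1) - p i"
      have e: "e = L (i + 1) *\<^sub>R (n \<times> N (i + 1))" "L (i + 1) > 0" using step[OF i3(1,2)] by (simp_all add: e_def)
      have en: "e \<bullet> n = 0" "e \<bullet> N (i + 1) = 0" unfolding e by (simp_all add: dot_cross_self)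
      have "e \<bullet> N i = L (i + 1) * \<epsilon> i" unfolding e eps(1)[OF i2] by (simp add: cross3_simps)
      hence ei: "e \<bullet> N i \<noteq> 0" using e(2) eps(2)[OF i2] by simp
      have "\<epsilon> (i - 1) = n \<bullet> (N i \<times> N (i - 1))" "\<epsilon> (i - 1) \<noteq> 0" using eps[OF i1(1,2)] i1(3) by auto
      moreover have "\<epsilon> i = n \<bullet> (N (i + 1) \<times> N i)" "\<epsilon> i \<noteq> 0" using eps[OF i2] by auto
      moreover have "d \<bullet> N (i - 1) = 0" "d \<bullet> N i = 0" "d \<bullet> n \<noteq> 0" using tr[OF i1(1,2)] i1(3) by (auto simp: d_def)
      moreover have "coeff_a P F G p q i = (d \<bullet> N (i + 1)) / (\<epsilon> i * (d \<bullet> n))"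
        "coeff_b P F G p i = (e \<bullet> N (i - 1)) / (\<epsilon> (i - 1) * (e \<bullet> N i))"
        by (simp_all add: coeff_a_def coeff_b_def d_def e_def N_def n_def \<epsilon>_def)
      ultimately have "N (i + 1) = \<epsilon> i *\<^sub>R (coeff_a P F G p q i *\<^sub>R n + coeff_b P F G p i *\<^sub>R N i - (1 / \<epsilon> (i - 1)) *\<^sub>R N (i - 1))"
        using en ei by (intro four_normals_relation)
      hence "u \<bullet> N (i + 1) = \<epsilon> i * (coeff_a P F G p q i * (u \<bullet> n) + coeff_b P F G p i * (u \<bullet> N i) - (1 / \<epsilon> (i - 1)) * (u \<bullet> N (i - 1)))"
        by (simp only: inner_scaleR_right inner_add_right inner_diff_right)
      thus ?thesis unfolding x_def using un by (simp add: field_simps)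
    qed
    have eps0: "\<epsilon> i \<noteq> 0" if "1 \<le> i" "i \<le> r" for i using eps(2)[OF that] by simp
    \<comment> \<open>With \<open>j\<close> outermost the inner sum is the solution at
      \<open>j\<close>; it is empty for \<open>j \<le> 2\<close>, in accordance with the initial
      values.\<close>
    have pairs: "{(i, j). 2 \<le> i \<and> i < j \<and> j \<le> r} = (\<lambda>(j, i). (i, j)) ` Sigma {1..r} (\<lambda>j. {2..<j})" by force
    define t where "t i j = coeff_a P F G p q i * tridiag_det (j - i - 1) (\<lambda>k. coeff_b P F G p (i + 1 + k)) (\<lambda>k. inverse (\<epsilon> (i + 1 + k)))
      * (\<Prod>k\<in>{i..<j}. \<epsilon> k)" for i j
    have "C_formula P F r G p q = - (\<Sum>(i, j)\<in>{(i, j). 2 \<le> i \<and> i < j \<and> j \<le> r}. t i j * L j)"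
      unfolding C_formula_def t_def L_def \<epsilon>_def by simp
    also have "(\<Sum>(i, j)\<in>{(i, j). 2 \<le> i \<and> i < j \<and> j \<le> r}. t i j * L j) = (\<Sum>(j, i)\<in>Sigma {1..r} (\<lambda>j. {2..<j}). t i j * L j)"
      unfolding pairs by (subst sum.reindex) (auto simp: inj_on_def case_prod_unfold)
    also have "\<dots> = (\<Sum>j\<in>{1..r}. \<Sum>i\<in>{2..<j}. t i j * L j)"
      by (subst sum.Sigma) auto
    also have "\<dots> = (\<Sum>j\<in>{1..r}. L j * x j)"
    proof (rule sum.cong[OF refl])
      fix j assume j: "j \<in> {1..r}"
      have "x j = (\<Sum>i\<in>{2..<j}. t i j)"
        unfolding t_def by (rule three_term_recurrence_solution[OF x12 rec eps0]) (use j in auto)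
      thus "(\<Sum>i\<in>{2..<j}. t i j * L j) = L j * x j" by (simp add: sum_distrib_left mult.commute)
    qed
    also have "\<dots> = \<kappa>" unfolding x_def using closed un by simp
    finally show ?thesis .
  qed
  moreover have "facet_term \<xi> F = - \<kappa>"
  proof -
    \<comment> \<open>A multiple of the component of \<open>n\<close> orthogonal to \<xi>;
      \<open>u \<bullet> n\<close> is the squared norm of \<open>n \<times> \<xi>\<close>.\<close>
    define u where "u = (\<xi> \<bullet> \<xi>) *\<^sub>R n - (\<xi> \<bullet> n) *\<^sub>R \<xi>"
    define y where "y j = \<xi> \<bullet> (n \<times> N j)" for j
    define x where "x j = (u \<bullet> N j) / (u \<bullet> n)" for j
    define \<alpha> where "\<alpha> j = \<xi> \<bullet> p j" for j
    have y0: "y i \<noteq> 0" "y (i + 1) \<noteq> 0" if i: "1 \<le> i" "i \<le> r" for i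
    proof -
      note o = ori[OF i] note oD = oriD[OF o]
      have "W (p i) (G (i + 1)) = N i \<times> n" "W (p i) (G i) = n \<times> N (i + 1)" using W_eq[OF o] by (simp_all add: N_def n_def)
      moreover have "\<xi> \<bullet> W (p i) (G (i + 1)) \<noteq> 0" "\<xi> \<bullet> W (p i) (G i) \<noteq> 0" using gen oD by (auto simp: generic_def)
      ultimately show "y i \<noteq> 0" "y (i + 1) \<noteq> 0" using cross_skew[of n "N i"] by (auto simp: y_def)
    qed
    have u\<xi>: "u \<bullet> \<xi> = 0" by (simp add: u_def inner_diff_left inner_commute[of n \<xi>])
    have "n \<times> \<xi> \<noteq> 0"
    proof
      assume "n \<times> \<xi> = 0"
      then obtain c where "\<xi> = c *\<^sub>R n" using cross3_eq_0_obtain n0 by blast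
      hence "y 1 = 0" by (simp add: y_def dot_cross_self)
      thus False using y0(1)[of 1] r1 by simp
    qed
    moreover have "u \<bullet> n = (n \<times> \<xi>) \<bullet> (n \<times> \<xi>)" unfolding u_def dot_cross by (simp add: inner_diff_left inner_commute[of n \<xi>])
    ultimately have un: "u \<bullet> n \<noteq> 0" by simp
    have dif: "\<alpha> j - \<alpha> (j - 1) = L j * y j" if "1 \<le> j" "j \<le> r" for j
    proof -
      have "\<xi> \<bullet> (p j - p (j - 1)) = \<xi> \<bullet> (L j *\<^sub>R (n \<times> N j))" by (simp only: step(1)[OF that])
      thus ?thesis by (simp add: \<alpha>_def y_def inner_diff_right)
    qed
    have "facet_term \<xi> F = - (\<Sum>i\<in>{1..r}. \<alpha> i * ((\<xi> \<bullet> W (p i) F) / (\<Prod>J\<in>fac (p i) - {F}. \<xi> \<bullet> W (p i) J)))"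
      unfolding facet_term_def \<alpha>_def by (subst sum.reindex_bij_betw[OF bij, symmetric]) simp
    also have "\<dots> = - (\<Sum>i\<in>{1..r}. \<alpha> i * (x i / y i - x (i + 1) / y (i + 1)))"
    proof (intro arg_cong[where f = uminus] sum.cong refl)
      fix i assume "i \<in> {1..r}"
      hence i: "1 \<le> i" "i \<le> r" by auto
      note o = ori[OF i] note oD = oriD[OF o]
      have Ws: "\<xi> \<bullet> W (p i) F = \<xi> \<bullet> (N (i + 1) \<times> N i)" "\<xi> \<bullet> W (p i) (G (i + 1)) = - y i" "\<xi> \<bullet> W (p i) (G i) = y (i + 1)"
        using W_eq[OF o] cross_skew[of "N i" n] by (simp_all add: N_def n_def y_def)
      have PR: "(\<Prod>J\<in>fac (p i) - {F}. \<xi> \<bullet> W (p i) J) = - (y i * y (i + 1))"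
        unfolding ori_diff[OF o] using oD(5) Ws by simp
      \<comment> \<open>As \<open>u\<close> is orthogonal to \<xi>, the numerator splits into one
        part for each edge of \<open>F\<close> at \<open>p i\<close>. Summation by parts then moves
        the differences onto \<alpha>, where they cancel the denominators \<open>y\<close>.\<close>
      have X: "\<xi> \<bullet> (N (i + 1) \<times> N i) = x (i + 1) * y i - x i * y (i + 1)"
      proof -
        have "(u \<bullet> n) * (\<xi> \<bullet> (N (i + 1) \<times> N i)) = (u \<bullet> N (i + 1)) * y i - (u \<bullet> N i) * y (i + 1)"
          unfolding y_def by (rule orthogonal_triple_identity[OF u\<xi>])
        thus ?thesis unfolding x_def using un by (simp add: field_simps)
      qed
      show "\<alpha> i * ((\<xi> \<bullet> W (p i) F) / (\<Prod>J\<in>fac (p i) - {F}. \<xi> \<bullet> W (p i) J)) = \<alpha> i * (x i / y i - x (i + 1) / y (i + 1))"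
        unfolding PR Ws(1) X using y0[OF i] by (simp add: field_simps)
    qed
    also have "\<dots> = - ((\<Sum>i\<in>{1..r}. \<alpha> i * (x i / y i)) - (\<Sum>i\<in>{1..r}. \<alpha> i * (x (i + 1) / y (i + 1))))"
      by (simp add: right_diff_distrib sum_subtractf)
    also have "(\<Sum>i\<in>{1..r}. \<alpha> i * (x (i + 1) / y (i + 1))) = (\<Sum>i\<in>{1..r}. \<alpha> (i - 1) * (x i / y i))"
    proof -
      \<comment> \<open>Cyclic shift of the index, closed by \<open>G (r + 1) = G 1\<close> and
        \<open>p 0 = p r\<close>.\<close>
      define f where "f i = \<alpha> (i - 1) * (x i / y i)" for i
      have "x (r + 1) / y (r + 1) = x 1 / y 1" using wrap by (simp add: x_def y_def N_def)
      hence fr: "f (r + 1) = f 1" using wrap by (simp add: f_def \<alpha>_def)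
      have "(\<Sum>i\<in>{1..r}. \<alpha> i * (x (i + 1) / y (i + 1))) = (\<Sum>i\<in>{1..r}. f (i + 1))" by (simp add: f_def)
      also have "\<dots> = (\<Sum>i\<in>{2..r + 1}. f i)" using sum.shift_bounds_cl_nat_ivl[of f 1 1 r] by (simp add: numeral_2_eq_2)
      also have "\<dots> = (\<Sum>i\<in>{2..r}. f i) + f (r + 1)" using r1 by simp
      also have "\<dots> = (\<Sum>i\<in>{1..r}. f i)" using fr sum.atLeast_Suc_atMost[OF r1, of f] by (simp add: numeral_2_eq_2)
      finally show ?thesis by (simp add: f_def)
    qed
    also have "- ((\<Sum>i\<in>{1..r}. \<alpha> i * (x i / y i)) - (\<Sum>i\<in>{1..r}. \<alpha> (i - 1) * (x i / y i)))
      = - (\<Sum>i\<in>{1..r}. L i * ((u \<bullet> N i) / (u \<bullet> n)))"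
      unfolding sum_subtractf[symmetric]
    proof (intro arg_cong[where f = uminus] sum.cong refl)
      fix i assume "i \<in> {1..r}"
      hence i: "1 \<le> i" "i \<le> r" by auto
      have "\<alpha> i * (x i / y i) - \<alpha> (i - 1) * (x i / y i) = (\<alpha> i - \<alpha> (i - 1)) * (x i / y i)" by (simp add: algebra_simps diff_divide_distrib)
      also have "\<dots> = L i * x i" unfolding dif[OF i] using y0(1)[OF i] by simp
      finally show "\<alpha> i * (x i / y i) - \<alpha> (i - 1) * (x i / y i) = L i * ((u \<bullet> N i) / (u \<bullet> n))" by (simp add: x_def)
    qed
    also have "\<dots> = - \<kappa>" using closed[OF un] by simp
    finally show ?thesis .
  qed
  ultimately show ?thesis by simp
qed

end

section \<open>Existence of a labelling\<close>

text \<open>Injectivity on a finite orbit forces a return to \<open>m\<close>, and the least return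
  time is the size of the orbit. Counting from 1 matches labellings, where the starting point sits
  at both 0 and \<open>r\<close>.\<close>

lemma funpow_enumerates_cycle:
  assumes X: "X = range (\<lambda>n. (\<sigma> ^^ n) m)" and fin: "finite X" and inj: "inj_on \<sigma> X"
  shows "bij_betw (\<lambda>i. (\<sigma> ^^ i) m) {1..card X} X" "(\<sigma> ^^ card X) m = m"
proof -
  have mX: "m \<in> X" unfolding X by (metis funpow_0 rangeI)
  have "\<sigma> ` X \<subseteq> X" unfolding X by (auto intro!: rangeI image_eqI[of _ _ "Suc _"])
  hence "\<sigma> ` X = X" using fin inj endo_inj_surj by metis
  then obtain u where u: "u \<in> X" "\<sigma> u = m" using mX by force
  then obtain k where "u = (\<sigma> ^^ k) m" unfolding X by auto
  hence "(\<sigma> ^^ Suc k) m = m" using u(2) by simp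
  hence ex: "\<exists>n. n > 0 \<and> (\<sigma> ^^ n) m = m" by (intro exI[of _ "Suc k"]) simp
  define n where "n = (LEAST n. n > 0 \<and> (\<sigma> ^^ n) m = m)"
  have n: "n > 0" "(\<sigma> ^^ n) m = m" using LeastI_ex[OF ex] by (auto simp: n_def)
  have least: "(\<sigma> ^^ k) m \<noteq> m" if "0 < k" "k < n" for k
    using not_less_Least[of k "\<lambda>n. n > 0 \<and> (\<sigma> ^^ n) m = m"] that by (auto simp: n_def)
  have inj0: "inj_on (\<lambda>k. (\<sigma> ^^ k) m) {0..<n}"
    by (rule inj_on_funpow_least) (use n least in auto)
  have img: "(\<lambda>k. (\<sigma> ^^ k) m) ` {0..<n} = X"
  proof (intro subset_antisym subsetI)
    fix x assume "x \<in> X"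
    then obtain k where "x = (\<sigma> ^^ k) m" unfolding X by auto
    hence "x = (\<sigma> ^^ (k mod n)) m" using funpow_mod_eq[OF n(2)] by simp
    thus "x \<in> (\<lambda>k. (\<sigma> ^^ k) m) ` {0..<n}" using n(1) by (intro image_eqI[of _ _ "k mod n"]) auto
  qed (auto simp: X)
  have card: "card X = n" using card_image[OF inj0] img by simp
  show "(\<sigma> ^^ card X) m = m" using n card by simp
  have img1: "(\<lambda>k. (\<sigma> ^^ k) m) ` {1..n} = X"
  proof -
    have "{1..n} = insert n {1..<n}" "{0..<n} = insert 0 {1..<n}" using n(1) by auto
    thus ?thesis using img n(2) by simp
  qed
  moreover have "inj_on (\<lambda>k. (\<sigma> ^^ k) m) {1..n}"
    by (rule eq_card_imp_inj_on) (use img1 card in auto)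
  ultimately show "bij_betw (\<lambda>i. (\<sigma> ^^ i) m) {1..card X} X" unfolding card bij_betw_def by simp
qed

context simple_lattice_polytope
begin

lemma closed_segment_other_end:
  "closed_segment x y = closed_segment x z \<Longrightarrow> y \<noteq> x \<Longrightarrow> z = y" for x y z :: "real^3"
  using closed_segment_eq[of x y x z] by (auto simp: doubleton_eq_iff)

text \<open>
  Walking along the edges of \<open>F\<close> with the orientation prescribed by \<open>eps\<close> permutes the vertices of \<open>F\<close>.
  There is only one orbit, since every orbit contains the unique local minimum of \<open>\<xi>\<close> on \<open>F\<close>.
\<close>

lemma facet_labelling_exists:
  assumes F: "F \<in> facets"
  shows "\<exists>r G p q. facet_labelling P F r G p q"
proof -
  define X where "X = verts \<inter> F"
  have finX: "finite X" using finite_verts by (simp add: X_def)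
  have XF: "F \<in> fac v" "v \<in> verts" if "v \<in> X" for v
    using that F by (auto simp: X_def fac_def facets_def)
  have "\<forall>v\<in>X. \<exists>B A. ori v F B A" using XF ori_exists by metis
  \<comment> \<open>At \<open>v = p i\<close>, \<open>B v\<close> is to be \<open>G (i + 1)\<close>
    and \<open>A v\<close> is to be \<open>G i\<close>; the orientation is the positivity of
    \<open>eps\<close>.\<close>
  then obtain B A where o: "\<And>v. v \<in> X \<Longrightarrow> ori v F (B v) (A v)" by metis
  have "\<forall>v\<in>X. \<exists>w L. w \<in> verts \<and> L > 0 \<and> w - v = L *\<^sub>R W v (A v) \<and> F \<inter> B v = closed_segment v w
    \<and> (F \<inter> B v) edge_of P \<and> w \<noteq> v"
  proof
    fix v assume "v \<in> X"
    from ori_rotate[OF ori_rotate[OF o[OF this]]]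
    show "\<exists>w L. w \<in> verts \<and> L > 0 \<and> w - v = L *\<^sub>R W v (A v) \<and> F \<inter> B v = closed_segment v w
      \<and> (F \<inter> B v) edge_of P \<and> w \<noteq> v" by (rule edge_data) blast
  qed
  \<comment> \<open>\<open>\<sigma> v\<close> is the successor of \<open>v\<close>: the far end of
    the edge of \<open>F\<close> that leaves \<open>A v\<close>.\<close>
  then obtain \<sigma> L where \<sigma>: "\<And>v. v \<in> X \<Longrightarrow> \<sigma> v \<in> verts \<and> L v > 0 \<and> \<sigma> v - v = L v *\<^sub>R W v (A v)
    \<and> F \<inter> B v = closed_segment v (\<sigma> v) \<and> (F \<inter> B v) edge_of P \<and> \<sigma> v \<noteq> v" by metis
  have "\<forall>v\<in>X. \<exists>w. B v \<inter> A v = closed_segment v w \<and> (B v \<inter> A v) edge_of P"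
  proof
    fix v assume "v \<in> X"
    from o[OF this] show "\<exists>w. B v \<inter> A v = closed_segment v w \<and> (B v \<inter> A v) edge_of P"
      by (rule edge_data) blast
  qed
  then obtain \<tau> where \<tau>: "\<And>v. v \<in> X \<Longrightarrow> B v \<inter> A v = closed_segment v (\<tau> v) \<and> (B v \<inter> A v) edge_of P" by metis
  have WA: "W v (A v) = nrm F \<times> nrm (B v)" and WB: "W v (B v) = nrm (A v) \<times> nrm F" if "v \<in> X" for v
    using W_eq[OF o[OF that]] by auto
  have \<sigma>X: "\<sigma> v \<in> X" and \<sigma>B: "\<sigma> v \<in> B v" if "v \<in> X" for v
  proof -
    have "\<sigma> v \<in> F \<inter> B v" using \<sigma>[OF that] by auto
    thus "\<sigma> v \<in> X" "\<sigma> v \<in> B v" using \<sigma>[OF that] by (auto simp: X_def)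
  qed
  \<comment> \<open>Otherwise \<open>B v\<close> would be the next facet at both ends of one edge,
    and positive multiples of \<open>nrm F \<times> nrm (B v)\<close> would lead from
    \<open>v\<close> to \<open>\<sigma> v\<close> and back.\<close>
  have A\<sigma>: "A (\<sigma> v) = B v" if v: "v \<in> X" for v
  proof (rule ccontr)
    assume ne: "A (\<sigma> v) \<noteq> B v"
    have "B v \<in> fac (\<sigma> v)" using \<sigma>B[OF v] oriD(8)[OF o[OF v]] by (simp add: fac_def facets_def)
    moreover have "B v \<noteq> F" using oriD(4)[OF o[OF v]] by simp
    ultimately have BB: "B (\<sigma> v) = B v" using ne oriD(2)[OF o[OF \<sigma>X[OF v]]] by auto
    have "closed_segment (\<sigma> v) (\<sigma> (\<sigma> v)) = closed_segment (\<sigma> v) v"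
      using \<sigma>[OF v] \<sigma>[OF \<sigma>X[OF v]] BB by (simp add: closed_segment_commute)
    hence ret: "v = \<sigma> (\<sigma> v)" by (rule closed_segment_other_end) (use \<sigma>[OF \<sigma>X[OF v]] in blast)
    have e1: "L (\<sigma> v) *\<^sub>R (nrm F \<times> nrm (B v)) = v - \<sigma> v"
      using \<sigma>[OF \<sigma>X[OF v]] WA[OF \<sigma>X[OF v]] BB ret by simp
    have e2: "L v *\<^sub>R (nrm F \<times> nrm (B v)) = \<sigma> v - v" using \<sigma>[OF v] WA[OF v] by simp
    have "(L v + L (\<sigma> v)) *\<^sub>R (nrm F \<times> nrm (B v)) = 0"
      unfolding scaleR_left_distrib e1 e2 by simp
    moreover have "nrm F \<times> nrm (B v) \<noteq> 0" using W_nonzero[OF XF(2)[OF v] oriD(12)[OF o[OF v]]] WA[OF v] by simp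
    moreover have "L v > 0" "L (\<sigma> v) > 0" using \<sigma>[OF v] \<sigma>[OF \<sigma>X[OF v]] by blast+
    ultimately show False by simp
  qed
  have inj: "inj_on \<sigma> X"
  proof (rule inj_onI)
    fix v w assume vw: "v \<in> X" "w \<in> X" "\<sigma> v = \<sigma> w"
    have "B v = B w" using A\<sigma>[OF vw(1)] A\<sigma>[OF vw(2)] vw(3) by simp
    hence "closed_segment (\<sigma> v) w = closed_segment (\<sigma> v) v"
      using \<sigma>[OF vw(1)] \<sigma>[OF vw(2)] vw(3) by (simp add: closed_segment_commute)
    thus "v = w" by (rule closed_segment_other_end) (use \<sigma>[OF vw(2)] vw(3) in metis)
  qed
  have pw: "(\<sigma> ^^ k) v \<in> X" if "v \<in> X" for v k
    using that by (induction k) (auto intro: \<sigma>X)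
  obtain \<xi> where gen: "generic \<xi>" using exists_generic[of UNIV] by auto
  obtain v0 where v0: "v0 \<in> X" using facet_obtain_points[of F] F by (auto simp: facets_def X_def)
  have "{F} \<subseteq> fac v0" using XF(1)[OF v0] by simp
  from ex1_iff_eq[OF unique_local_minimum[OF gen XF(2)[OF v0] this]] obtain m where
    m: "\<forall>v. v \<in> verts \<and> {F} \<subseteq> fac v \<and> (\<forall>K\<in>fac v - {F}. 0 < \<xi> \<bullet> W v K) \<longleftrightarrow> v = m" ..
  \<comment> \<open>At the lowest vertex of an invariant set both successor and predecessor belong
    to the set, so \<xi> increases along both edges of \<open>F\<close> there.\<close>
  have minimal: "m \<in> Orb" if Orb: "Orb \<subseteq> X" "Orb \<noteq> {}" "\<sigma> ` Orb \<subseteq> Orb" for Orb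
  proof -
    have finO: "finite Orb" using Orb finX finite_subset by blast
    have surj: "\<sigma> ` Orb = Orb" using endo_inj_surj[OF finO Orb(3)] inj_on_subset[OF inj Orb(1)] by blast
    obtain v where v: "v \<in> Orb" "\<And>w. w \<in> Orb \<Longrightarrow> \<xi> \<bullet> v \<le> \<xi> \<bullet> w"
      using arg_min_if_finite(1)[OF finO Orb(2), of "\<lambda>v. \<xi> \<bullet> v"] arg_min_least[OF finO Orb(2), of _ "\<lambda>v. \<xi> \<bullet> v"] by blast
    have vX: "v \<in> X" using v Orb by auto
    note oD = oriD[OF o[OF vX]]
    have nz: "\<xi> \<bullet> W v (A v) \<noteq> 0" "\<xi> \<bullet> W v (B v) \<noteq> 0" using gen oD by (auto simp: generic_def)
    have "\<sigma> v \<in> Orb" using v Orb by auto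
    hence "0 \<le> \<xi> \<bullet> (\<sigma> v - v)" using v(2) by (simp add: inner_diff_right)
    hence "0 \<le> L v * (\<xi> \<bullet> W v (A v))" using \<sigma>[OF vX] by (metis inner_scaleR_right)
    hence a: "0 < \<xi> \<bullet> W v (A v)" using \<sigma>[OF vX] nz by (simp add: zero_le_mult_iff)
    obtain u where u: "u \<in> Orb" "v = \<sigma> u" using surj v(1) by blast
    have uX: "u \<in> X" using u Orb by auto
    have "W u (A u) = - W v (B v)" using WA[OF uX] WB[OF vX] A\<sigma>[OF uX] u(2) cross_skew[of "nrm F" "nrm (B u)"] by simp
    moreover have "\<xi> \<bullet> (v - u) \<le> 0" using v(2)[OF u(1)] by (simp add: inner_diff_right)
    hence "L u * (\<xi> \<bullet> W u (A u)) \<le> 0" using \<sigma>[OF uX] u(2) by (metis inner_scaleR_right)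
    ultimately have "0 \<le> L u * (\<xi> \<bullet> W v (B v))" by simp
    hence b: "0 < \<xi> \<bullet> W v (B v)" using \<sigma>[OF uX] nz by (simp add: zero_le_mult_iff)
    have "\<forall>K\<in>fac v - {F}. 0 < \<xi> \<bullet> W v K" unfolding ori_diff[OF o[OF vX]] using a b by simp
    hence "v = m" using spec[OF m, of v] XF[OF vX] by blast
    thus ?thesis using v(1) by simp
  qed
  have mX: "m \<in> X" using minimal[of X] v0 \<sigma>X by blast
  define Orb where "Orb = range (\<lambda>n. (\<sigma> ^^ n) m)"
  have OX: "Orb \<subseteq> X" using pw[OF mX] by (auto simp: Orb_def)
  have mO: "m \<in> Orb" unfolding Orb_def by (metis funpow_0 rangeI)
  have \<sigma>Orb: "\<sigma> ` Orb \<subseteq> Orb" unfolding Orb_def by (auto intro!: rangeI image_eqI[of _ _ "Suc _"])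
  \<comment> \<open>The complement of the orbit is invariant as well and, if nonempty, would also
    contain \<open>m\<close>.\<close>
  have Orb: "X = Orb"
  proof (rule ccontr)
    assume "X \<noteq> Orb"
    hence ne: "X - Orb \<noteq> {}" using OX by blast
    have surj: "\<sigma> ` Orb = Orb" using endo_inj_surj[OF finite_subset[OF OX finX] \<sigma>Orb] inj_on_subset[OF inj OX] by blast
    have "\<sigma> ` (X - Orb) \<subseteq> X - Orb"
    proof
      fix y assume "y \<in> \<sigma> ` (X - Orb)"
      then obtain x where x: "x \<in> X" "x \<notin> Orb" "y = \<sigma> x" by blast
      have "y \<notin> Orb"
      proof
        assume "y \<in> Orb"
        then obtain z where z: "z \<in> Orb" "y = \<sigma> z" using surj by blast
        hence "x = z" using inj_onD[OF inj, of x z] x OX by auto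
        thus False using z x by simp
      qed
      thus "y \<in> X - Orb" using \<sigma>X x by simp
    qed
    hence "m \<in> X - Orb" using minimal[of "X - Orb"] ne by blast
    thus False using mO by simp
  qed
  define r where "r = card X"
  define p where "p i = (\<sigma> ^^ i) m" for i
  define G where "G i = A (p i)" for i
  define q where "q i = \<tau> (p i)" for i
  have cyc: "bij_betw p {1..r} X" "p r = m"
    using funpow_enumerates_cycle[OF Orb[unfolded Orb_def] finX inj] unfolding p_def[abs_def] r_def by auto
  have pX: "p i \<in> X" and pS: "p (Suc i) = \<sigma> (p i)" for i using pw[OF mX] by (auto simp: p_def)
  have p0: "p 0 = p r" "p (Suc r) = p (Suc 0)" using cyc(2) by (auto simp: p_def)
  have GS: "G (Suc i) = B (p i)" for i unfolding G_def pS by (rule A\<sigma>[OF pX])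
  have extX: "{x. x extreme_point_of F} = X"
    using extreme_point_of_face[OF facet_face[OF F]] by (auto simp: verts_def X_def)
  have surjX: "\<sigma> ` X = X" using endo_inj_surj[OF finX _ inj] \<sigma>X by blast
  have FA: "\<exists>u\<in>X. v = \<sigma> u \<and> A v = B u \<and> F \<inter> A v = closed_segment u v \<and> (F \<inter> A v) edge_of P" if v: "v \<in> X" for v
  proof -
    obtain u where u: "u \<in> X" "v = \<sigma> u" using surjX v by blast
    have "A v = B u" using A\<sigma>[OF u(1)] u(2) by simp
    thus ?thesis using \<sigma>[OF u(1)] u by auto
  qed
  have injA: "inj_on A X"
  proof (rule inj_onI)
    fix v w assume vw: "v \<in> X" "w \<in> X" "A v = A w"
    obtain u where u: "u \<in> X" "v = \<sigma> u" "A v = B u" "F \<inter> A v = closed_segment u v" using FA[OF vw(1)] by blast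
    obtain t where t: "t \<in> X" "w = \<sigma> t" "A w = B t" "F \<inter> A w = closed_segment t w" using FA[OF vw(2)] by blast
    have "closed_segment u v = closed_segment t w" using u(4) t(4) vw(3) by simp
    hence "{u, v} = {t, w}" using closed_segment_eq[of u v t w] by simp
    \<comment> \<open>The same edge might be traversed in opposite directions; then the preceding
      and the following facet at \<open>u\<close> would coincide.\<close>
    hence "v = w \<or> u = w" by (auto simp: doubleton_eq_iff)
    moreover have "u \<noteq> w"
    proof
      assume "u = w"
      hence "A u = B u" using u(3) vw(3) by simp
      thus False using oriD(5)[OF o[OF u(1)]] by simp
    qed
    ultimately show "v = w" by simp
  qed
  have imgA: "A ` X = {H. H facet_of P \<and> (F \<inter> H) edge_of P}"
  proof (intro subset_antisym subsetI)
    fix H assume "H \<in> A ` X"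
    then obtain v where v: "v \<in> X" "H = A v" by auto
    thus "H \<in> {H. H facet_of P \<and> (F \<inter> H) edge_of P}"
      using FA[OF v(1)] oriD(9)[OF o[OF v(1)]] by (auto simp: facets_def)
  next
    fix H assume "H \<in> {H. H facet_of P \<and> (F \<inter> H) edge_of P}"
    hence H: "H facet_of P" "(F \<inter> H) edge_of P" by auto
    obtain v K C D where ov: "ori v K C D" and FH: "F \<inter> H = C \<inter> D" by (rule edge_obtain_ori[OF H(2)])
    have "F \<noteq> H"
    proof
      assume "F = H"
      hence "F edge_of P" using H by simp
      thus False using F full_dim by (simp add: edge_of_def facets_def facet_of_def)
    qed
    have FP: "F facet_of P" using F by (simp add: facets_def)
    have "F = C \<or> F = D" by (rule facets_of_edge[OF ov FP]) (unfold FH[symmetric], blast)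
    moreover have "H = C \<or> H = D" by (rule facets_of_edge[OF ov H(1)]) (unfold FH[symmetric], blast)
    ultimately have fs: "F \<in> fac v" "H \<in> fac v" using oriD(11,12)[OF ov] by blast+
    have vX: "v \<in> X" using oriD(1)[OF ov] fac_mem[OF fs(1)] by (simp add: X_def)
    have "H = A v \<or> H = B v" using fs(2) \<open>F \<noteq> H\<close> oriD(2)[OF o[OF vX]] by auto
    thus "H \<in> A ` X" using A\<sigma>[OF vX] \<sigma>X[OF vX] vX by (metis imageI)
  qed
  have bijG: "bij_betw G {1..r} {H. H facet_of P \<and> (F \<inter> H) edge_of P}"
  proof -
    have "bij_betw A X {H. H facet_of P \<and> (F \<inter> H) edge_of P}" using injA imgA by (simp add: bij_betw_def)
    from bij_betw_trans[OF cyc(1) this] show ?thesis by (simp add: G_def[abs_def] o_def)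
  qed
  have "facet_labelling P F r G p q"
    unfolding facet_labelling_def extX
  proof (intro conjI ballI)
    show "r = card X" by (rule r_def)
    show "bij_betw G {1..r} {H. H facet_of P \<and> (F \<inter> H) edge_of P}" by (rule bijG)
    show "bij_betw p {1..r} X" by (rule cyc(1))
    show "G 0 = G r" "G (r + 1) = G 1" "p 0 = p r" "p (r + 1) = p 1" "q 0 = q r"
      using p0 by (simp_all add: G_def q_def)
    fix i assume i: "i \<in> {1..r}"
    define v where "v = p i"
    have v: "v \<in> X" by (simp add: v_def pX)
    note oD = oriD[OF o[OF v]]
    have Gi: "G i = A v" "G (i + 1) = B v" using GS[of i] by (simp_all add: G_def v_def)
    show "F \<inter> G i \<inter> G (i + 1) = {p i}"
      unfolding Gi v_def[symmetric]
    proof (intro subset_antisym subsetI)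
      fix x assume x: "x \<in> F \<inter> A v \<inter> B v"
      hence "lam K x = 0" if "K \<in> fac v" for K
        using that oD(2) mem_facet_iff[OF fac_facets[OF that]] by blast
      thus "x \<in> {v}" using eq_vertex_if_lam_0[OF oD(1)] by blast
    next
      fix x assume "x \<in> {v}"
      thus "x \<in> F \<inter> A v \<inter> B v" using fac_mem[OF oD(10)] fac_mem[OF oD(11)] fac_mem[OF oD(12)] by simp
    qed
    obtain j where j: "i = Suc j" using i by (cases i) auto
    have vj: "v = \<sigma> (p j)" unfolding v_def j by (rule pS)
    have "A v = B (p j)" unfolding vj by (rule A\<sigma>[OF pX])
    thus "F \<inter> G i = closed_segment (p (i - 1)) (p i)"
      unfolding Gi v_def[symmetric] using \<sigma>[OF pX[of j]] vj j by simp
    show "(G i \<inter> G (i + 1)) edge_of P" "G i \<inter> G (i + 1) = closed_segment (p i) (q i)"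
      unfolding Gi q_def v_def[symmetric] using \<tau>[OF v] unfolding Int_commute[of "B v" "A v"] by blast+
    show "0 < eps P F G i" unfolding eps_def Gi using oD(3) by (simp add: dot_cross_det)
  qed
  thus ?thesis by blast
qed

end

theorem theorem5:
  fixes P :: "(real^3) set" and c0 c1 c2 c3 :: real
  assumes "integral_polytope P"
    and "simple_polytope P"
    and "aff_dim P = 3"
    and "\<And>l::nat. real (lattice_points P l) = c3 * real l ^ 3 + c2 * real l ^ 2 + c1 * real l + c0"
  shows "c1 = (\<Sum>E\<in>{E. E edge_of P}. (edge_s P E + 1/4) * rel_vol E)
            + 1/12 * (\<Sum>F\<in>{F. F facet_of P}. facet_C P F)"
proof -
  interpret simple_lattice_polytope P
    using assms(1-3) by unfold_locales
  obtain \<xi> where gen: "generic \<xi>" using exists_generic[of UNIV] by auto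
  \<comment> \<open>The right-hand side mentions no labelling, so the definite description only asks
    for the existence of one.\<close>
  have "facet_C P F = facet_term \<xi> F" if F: "F \<in> facets" for F
    unfolding facet_C_def
  proof (rule the_equality)
    show "\<exists>r G p q. facet_labelling P F r G p q \<and> facet_term \<xi> F = C_formula P F r G p q"
      using facet_labelling_exists[OF F] C_formula_eq_facet_term[OF F _ gen] by metis
  qed (use C_formula_eq_facet_term[OF F _ gen] in auto)
  hence "(\<Sum>F\<in>facets. facet_term \<xi> F) = (\<Sum>F\<in>{F. F facet_of P}. facet_C P F)"
    by (simp add: facets_def)
  thus ?thesis
    using linear_coefficient_facet_terms[OF gen assms(4)] by (simp add: edges_def)
qed

end
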